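(* Let $d,r\ge 1$ be integers, and let $M\subseteq H^2\otimes\mathbb C^r$ be a closed invariant subspace for the $d$-shift $\bar S=(S_1,\dots,S_d)$ of rank $r$ that is generated, as a closed invariant subspace, by some set of monomials. Let $\bar T=(T_1,\dots,T_d)$ be the $d$-contraction obtained by compressing $\bar S$ to $(H^2\otimes\mathbb C^r)/M\cong M^\perp$, that is, $T_k=(\mathbf 1-P_M)S_k|_{M^\perp}$ with $P_M$ the orthogonal projection onto $M$, and let $\mathcal A$ be the $*$-algebra of operators on $M^\perp$ generated by $\{T_1,\dots,T_d\}$ and the identity. Then: (i) the commutator ideal of $\mathcal A$ is contained in $\mathcal L^p$ for every $p>d$; and (ii) $\bar T$ is a Fredholm multioperator.
   Context: $H^2=H^2(\mathbb C^d)$ is the symmetric Fock space over $\mathbb C^d$, realized as a Hilbert space of holomorphic functions on the open unit ball of $\mathbb C^d$ in which the monomials $z^n=z_1^{n_1}\cdots z_d^{n_d}$, $n=(n_1,\dots,n_d)\in\mathbb Z^d$, $n\ge0$ (meaning every $n_k\ge 0$), form an orthogonal set with dense span, with $\|z^n\|^2=\frac{n_1!\cdots n_d!}{(n_1+\cdots+n_d)!}$. The $d$-shift of rank $r$ is the $d$-tuple of commuting bounded operators $S_1,\dots,S_d$ on $H^2\otimes\mathbb C^r$ determined by $S_k(f\otimes\zeta)=z_kf\otimes\zeta$ for $f\in H^2$, $\zeta\in\mathbb C^r$. A monomial in $H^2\otimes\mathbb C^r$ is an element $z^n\otimes\zeta$ with $n\ge0$, $\zeta\in\mathbb C^r$.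 A closed subspace is invariant if it is mapped into itself by each $S_k$; the closed invariant subspace generated by a set is the smallest one containing it. $\mathcal L^p$ denotes the Schatten–von Neumann class of all compact operators whose singular value list is $p$-summable. The commutator ideal of $\mathcal A$ is the two-sided ideal of $\mathcal A$ generated by all commutators $AB-BA$, $A,B\in\mathcal A$. A multioperator is a $d$-tuple $\bar T=(T_1,\dots,T_d)$ of mutually commuting bounded operators on a common Hilbert space $H$; it is a $d$-contraction if $T_1T_1^*+\cdots+T_dT_d^*\le\mathbf 1$. Dirac operator: let $Z$ be a $d$-dimensional Hilbert space with orthonormal basis $e_1,\dots,e_d$, $\Lambda Z=\bigoplus_{k=0}^d\Lambda^kZ$ its exterior algebra with inner product $\langle z_1\wedge\cdots\wedge z_k,w_1\wedge\cdots\wedge w_k\rangle=\det(\langle z_i,w_j\rangle)$ on $\Lambda^kZ$ ($\Lambda^0Z=\mathbb C$), and let $C_i$ be the creation operator $C_i(\omega)=e_i\wedge\omega$ on $\Lambda Z$. The Dirac operator of $\bar T$ is the self-adjoint operator $D=B+B^*$ on $H\otimes\Lambda Z$, where $B=T_1\otimes C_1+\cdots+T_d\otimes C_d$. $\bar T$ is a Fredholm multioperator if $D$ is a Fredholm operator (closed range and finite-dimensional kernel). *)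

theory Defs
  imports "HOL-Analysis.Analysis"
begin

section \<open>Complex Hilbert spaces\<close>

text \<open>The inner product \<open>cinner\<close> is linear in its first argument; its real part is
  the real inner product of the library, so that norm and topology are the library's.\<close>

class complex_inner = real_inner +
  fixes scaleC :: "complex \<Rightarrow> 'a \<Rightarrow> 'a"  (infixr \<open>*\<^sub>C\<close> 75)
    and cinner :: "'a \<Rightarrow> 'a \<Rightarrow> complex"
  assumes scaleC_add_right: "a *\<^sub>C (x + y) = a *\<^sub>C x + a *\<^sub>C y"
    and scaleC_add_left: "(a + b) *\<^sub>C x = a *\<^sub>C x + b *\<^sub>C x"
    and scaleC_scaleC: "a *\<^sub>C b *\<^sub>C x = (a * b) *\<^sub>C x"
    and scaleR_scaleC: "scaleR r x = complex_of_real r *\<^sub>C x"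
    and cinner_add_left: "cinner (x + y) z = cinner x z + cinner y z"
    and cinner_scaleC_left: "cinner (a *\<^sub>C x) y = a * cinner x y"
    and cinner_commute: "cinner x y = cnj (cinner y x)"
    and inner_cinner: "inner x y = Re (cinner x y)"

class chilbert_space = complex_inner + complete_space

global_interpretation complex_vector: vector_space "scaleC :: complex \<Rightarrow> 'a \<Rightarrow> 'a::complex_inner"
  defines csubspace = complex_vector.subspace
    and cspan = complex_vector.span
    and cdim = complex_vector.dim
proof
  fix a b :: complex and x y :: 'a
  show "1 *\<^sub>C x = x"
    using scaleR_scaleC[of 1 x] by simp
qed (simp_all add: scaleC_add_right scaleC_add_left scaleC_scaleC)

instantiation complex :: chilbert_space
begin

definition scaleC_complex :: "complex \<Rightarrow> complex \<Rightarrow> complex"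
  where "scaleC_complex a x = a * x"

definition cinner_complex :: "complex \<Rightarrow> complex \<Rightarrow> complex"
  where "cinner_complex x y = x * cnj y"

instance
  by standard (simp_all add: scaleC_complex_def cinner_complex_def algebra_simps
      scaleR_conv_of_real inner_complex_def)

end

instantiation vec :: (complex_inner, finite) complex_inner
begin

definition scaleC_vec :: "complex \<Rightarrow> 'a ^ 'b \<Rightarrow> 'a ^ 'b"
  where "scaleC_vec a x = (\<chi> i. a *\<^sub>C x $ i)"

definition cinner_vec :: "'a ^ 'b \<Rightarrow> 'a ^ 'b \<Rightarrow> complex"
  where "cinner_vec x y = (\<Sum>i\<in>UNIV. cinner (x $ i) (y $ i))"

instance
proof
  fix x y :: "'a ^ 'b"
  show "cinner x y = cnj (cinner y x)"
    unfolding cinner_vec_def cnj_sum by (intro sum.cong refl cinner_commute)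
qed (simp_all add: scaleC_vec_def cinner_vec_def vec_eq_iff scaleC_add_right scaleC_add_left
      scaleC_scaleC scaleR_scaleC cinner_add_left cinner_scaleC_left inner_vec_def inner_cinner
      sum.distrib sum_distrib_left)

end

instance vec :: (chilbert_space, finite) chilbert_space ..


section \<open>The space \<open>H\<^sup>2\<close>\<close>

text \<open>Multi-indices are functions \<open>'d \<Rightarrow> nat\<close>, where \<open>d = CARD('d)\<close>.\<close>

definition zpow :: "complex ^ 'd \<Rightarrow> ('d::finite \<Rightarrow> nat) \<Rightarrow> complex"
  where "zpow z n = (\<Prod>k\<in>UNIV. (z $ k) ^ n k)"

definition weight :: "('d::finite \<Rightarrow> nat) \<Rightarrow> real"
  where "weight n = (\<Prod>k\<in>UNIV. fact (n k)) / fact (\<Sum>k\<in>UNIV. n k)"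

definition square_summable :: "(('d::finite \<Rightarrow> nat) \<Rightarrow> complex) \<Rightarrow> bool"
  where "square_summable a \<longleftrightarrow> (\<lambda>n. weight n * (cmod (a n))\<^sup>2) summable_on UNIV"

definition power_series_on_ball :: "(('d::finite \<Rightarrow> nat) \<Rightarrow> complex) \<Rightarrow> (complex ^ 'd \<Rightarrow> complex) \<Rightarrow> bool"
  where "power_series_on_ball a f \<longleftrightarrow> (\<forall>z\<in>ball 0 1. ((\<lambda>n. a n * zpow z n) has_sum f z) UNIV)"

lemma weight_pos [simp]: "weight n > 0"
  by (auto simp: weight_def intro!: divide_pos_pos prod_pos)

lemma weight_nonneg [simp]: "weight n \<ge> 0"
  by (rule less_imp_le) simp

lemma weight_nonzero [simp]: "weight n \<noteq> 0"
  using weight_pos[of n] by linarith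

lemma square_summable_zero: "square_summable (\<lambda>_. 0)"
  by (simp add: square_summable_def)

lemma square_summable_cmult:
  assumes "square_summable a" shows "square_summable (\<lambda>n. c * a n)"
  using summable_on_cmult_right[OF assms[unfolded square_summable_def], of "(cmod c)\<^sup>2"]
  by (simp add: square_summable_def norm_mult power_mult_distrib mult_ac)

lemma square_summable_add:
  assumes "square_summable a" "square_summable b" shows "square_summable (\<lambda>n. a n + b n)"
  unfolding square_summable_def
proof (rule summable_on_comparison_test)
  show "(\<lambda>n. 2 * (weight n * (cmod (a n))\<^sup>2) + 2 * (weight n * (cmod (b n))\<^sup>2)) summable_on UNIV"
    by (intro summable_on_add summable_on_cmult_right assms[unfolded square_summable_def])
  fix n
  have "(cmod (a n + b n))\<^sup>2 \<le> (cmod (a n) + cmod (b n))\<^sup>2"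
    by (intro power_mono norm_triangle_ineq) auto
  also have "\<dots> \<le> 2 * (cmod (a n))\<^sup>2 + 2 * (cmod (b n))\<^sup>2"
    using sum_squares_bound[of "cmod (a n)" "cmod (b n)"] by (simp add: power2_sum)
  finally have "(cmod (a n + b n))\<^sup>2 \<le> 2 * (cmod (a n))\<^sup>2 + 2 * (cmod (b n))\<^sup>2" .
  from mult_left_mono[OF this, of "weight n"]
  show "weight n * (cmod (a n + b n))\<^sup>2 \<le> 2 * (weight n * (cmod (a n))\<^sup>2) + 2 * (weight n * (cmod (b n))\<^sup>2)"
    using weight_pos[of n] by (simp add: algebra_simps)
qed simp_all

lemma square_summable_uminus: "square_summable a \<Longrightarrow> square_summable (\<lambda>n. - a n)"
  using square_summable_cmult[of a "-1"] by simp

lemma square_summable_diff: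
  "square_summable a \<Longrightarrow> square_summable b \<Longrightarrow> square_summable (\<lambda>n. a n - b n)"
  using square_summable_add[of a "\<lambda>n. - b n"] by (simp add: square_summable_uminus)

lemma abs_summable_square_summable_mult:
  assumes "square_summable a" "square_summable b"
  shows "(\<lambda>n. weight n * cmod (a n) * cmod (b n)) summable_on UNIV"
proof (rule summable_on_comparison_test)
  show "(\<lambda>n. weight n * (cmod (a n))\<^sup>2 + weight n * (cmod (b n))\<^sup>2) summable_on UNIV"
    by (intro summable_on_add assms[unfolded square_summable_def])
  fix n
  have "cmod (a n) * cmod (b n) \<le> (cmod (a n))\<^sup>2 + (cmod (b n))\<^sup>2"
    using sum_squares_bound[of "cmod (a n)" "cmod (b n)"]
      mult_nonneg_nonneg[of "cmod (a n)" "cmod (b n)"] by (simp add: mult.assoc del: mult_nonneg_nonneg)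
  from mult_left_mono[OF this, of "weight n"]
  show "weight n * cmod (a n) * cmod (b n) \<le> weight n * (cmod (a n))\<^sup>2 + weight n * (cmod (b n))\<^sup>2"
    using weight_pos[of n] by (simp add: algebra_simps)
qed simp_all

lemma summable_square_summable_mult:
  assumes "square_summable a" "square_summable b"
  shows "(\<lambda>n. complex_of_real (weight n) * a n * cnj (b n)) summable_on UNIV"
  by (rule abs_summable_summable)
    (use abs_summable_square_summable_mult[OF assms] in \<open>simp add: norm_mult\<close>)

lemma finite_degree_eq: "finite {n :: 'd::finite \<Rightarrow> nat. (\<Sum>k\<in>UNIV. n k) = m}"
proof (rule finite_subset)
  show "{n :: 'd \<Rightarrow> nat. (\<Sum>k\<in>UNIV. n k) = m} \<subseteq> PiE UNIV (\<lambda>_. {..m})"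
    by (auto simp: PiE_def member_le_sum)
  show "finite (PiE (UNIV :: 'd set) (\<lambda>_. {..m}))"
    by (intro finite_PiE) auto
qed

lemma sum_fun_upd_Suc:
  fixes n :: "'d::finite \<Rightarrow> nat"
  shows "(\<Sum>k\<in>UNIV. (n(i := Suc (n i))) k) = Suc (\<Sum>k\<in>UNIV. n k)"
  by (subst (1 2) sum.remove[of _ i]) (auto intro!: sum.cong)

lemma prod_fact_fun_upd_Suc:
  fixes n :: "'d::finite \<Rightarrow> nat"
  shows "(\<Prod>k\<in>UNIV. fact ((n(i := Suc (n i))) k)) = (real (Suc (n i))) * (\<Prod>k\<in>UNIV. fact (n k))"
proof -
  have "(\<Prod>k\<in>UNIV - {i}. fact ((n(i := Suc (n i))) k)) = (\<Prod>k\<in>UNIV-{i}. fact (n k) :: real)"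
    by (intro prod.cong) auto
  then show ?thesis
    by (subst (1 2) prod.remove[of _ i]) auto
qed

lemma weight_fun_upd_Suc:
  fixes n :: "'d::finite \<Rightarrow> nat"
  shows "weight (n(i := Suc (n i))) = real (Suc (n i)) / real (Suc (\<Sum>k\<in>UNIV. n k)) * weight n"
  unfolding weight_def sum_fun_upd_Suc prod_fact_fun_upd_Suc by simp

lemma zpow_fun_upd_Suc:
  fixes n :: "'d::finite \<Rightarrow> nat"
  shows "zpow z (n(i := Suc (n i))) = z $ i * zpow z n"
proof -
  have "(\<Prod>k\<in>UNIV - {i}. (z $ k) ^ ((n(i := Suc (n i))) k)) = (\<Prod>k\<in>UNIV-{i}. (z $ k) ^ (n k))"
    by (intro prod.cong) auto
  then show ?thesis
    unfolding zpow_def by (subst (1 2) prod.remove[of _ i]) auto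
qed

lemma sum_degree_zpow:
  fixes z :: "complex ^ 'd::finite"
  shows "(\<Sum>n | (\<Sum>k\<in>UNIV. n k) = m. (cmod (zpow z n))\<^sup>2 / weight n) = ((norm z)\<^sup>2) ^ m"
proof (induction m)
  case 0
  have "{n :: 'd \<Rightarrow> nat. (\<Sum>k\<in>UNIV. n k) = 0} = {\<lambda>_. 0}"
    by auto
  then show ?case by (simp add: zpow_def weight_def)
next
  case (Suc m)
  let ?q = "\<lambda>n. (cmod (zpow z n))\<^sup>2 / weight n"
  let ?D = "\<lambda>m. {n :: 'd \<Rightarrow> nat. (\<Sum>k\<in>UNIV. n k) = m}"
  have *: "real (Suc m) * (cmod (z $ i))\<^sup>2 * ?q n = real (Suc (n i)) * ?q (n(i := Suc (n i)))"
    if "n \<in> ?D m" for n i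
    using that weight_pos[of n] unfolding weight_fun_upd_Suc zpow_fun_upd_Suc
    by (simp add: norm_mult power_mult_distrib field_simps del: of_nat_Suc)
  have **: "(\<Sum>n\<in>?D m. real (Suc (n i)) * ?q (n(i := Suc (n i)))) = (\<Sum>n\<in>?D (Suc m). real (n i) * ?q n)" for i
  proof -
    have "(\<Sum>n\<in>?D (Suc m). real (n i) * ?q n) = (\<Sum>n\<in>{n\<in>?D (Suc m). n i > 0}. real (n i) * ?q n)"
      by (intro sum.mono_neutral_right) (auto simp: finite_degree_eq)
    also have "\<dots> = (\<Sum>n\<in>?D m. real (Suc (n i)) * ?q (n(i := Suc (n i))))"
    proof (rule sum.reindex_bij_witness[where i = "\<lambda>n. n(i := Suc (n i))" and j = "\<lambda>n. n(i := n i - 1)"])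
      fix n assume n: "n \<in> {n\<in>?D (Suc m). n i > 0}"
      show eq: "(n(i := n i - 1))(i := Suc ((n(i := n i - 1)) i)) = n"
        using n by auto
      show "n(i := n i - 1) \<in> ?D m"
        using sum_fun_upd_Suc[of "n(i := n i - 1)" i] n unfolding eq by simp
    qed (auto simp: sum_fun_upd_Suc simp del: fun_upd_apply, auto)
    finally show ?thesis by simp
  qed
  have "real (Suc m) * (norm z)\<^sup>2 ^ Suc m = (\<Sum>i\<in>UNIV. \<Sum>n\<in>?D m. real (Suc m) * (cmod (z $ i))\<^sup>2 * ?q n)"
  proof -
    have "(norm z)\<^sup>2 = (\<Sum>i\<in>UNIV. (cmod (z $ i))\<^sup>2)"
      by (simp add: norm_vec_def L2_set_def sum_nonneg)
    then have "real (Suc m) * (norm z)\<^sup>2 ^ Suc m =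
        (\<Sum>i\<in>UNIV. real (Suc m) * (cmod (z $ i))\<^sup>2) * (\<Sum>n\<in>?D m. ?q n)"
      unfolding Suc.IH by (simp add: sum_distrib_left[symmetric] mult.assoc del: of_nat_Suc)
    then show ?thesis
      by (simp only: sum_product)
  qed
  also have "\<dots> = (\<Sum>i\<in>UNIV. \<Sum>n\<in>?D (Suc m). real (n i) * ?q n)"
  proof (rule sum.cong[OF refl])
    fix i
    have "(\<Sum>n\<in>?D m. real (Suc m) * (cmod (z $ i))\<^sup>2 * ?q n) =
        (\<Sum>n\<in>?D m. real (Suc (n i)) * ?q (n(i := Suc (n i))))"
      by (rule sum.cong[OF refl]) (rule *)
    then show "(\<Sum>n\<in>?D m. real (Suc m) * (cmod (z $ i))\<^sup>2 * ?q n) = (\<Sum>n\<in>?D (Suc m). real (n i) * ?q n)"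
      unfolding ** .
  qed
  also have "\<dots> = (\<Sum>n\<in>?D (Suc m). (\<Sum>i\<in>UNIV. real (n i)) * ?q n)"
    by (subst sum.swap) (simp only: sum_distrib_right)
  also have "\<dots> = (\<Sum>n\<in>?D (Suc m). real (Suc m) * ?q n)"
    by (intro sum.cong refl) (auto simp flip: of_nat_sum)
  finally have eq: "real (Suc m) * (norm z)\<^sup>2 ^ Suc m = real (Suc m) * (\<Sum>n\<in>?D (Suc m). ?q n)"
    by (simp only: sum_distrib_left)
  have "real (Suc m) \<noteq> 0" by (rule of_nat_neq_0)
  from eq[unfolded mult_left_cancel[OF this]] show ?case by (rule sym)
qed

lemma summable_zpow_weight:
  fixes z :: "complex ^ 'd::finite"
  assumes "norm z < 1"
  shows "(\<lambda>n. (cmod (zpow z n))\<^sup>2 / weight n) summable_on UNIV"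
proof (rule nonneg_bounded_partial_sums_imp_summable_on)
  let ?q = "\<lambda>n. (cmod (zpow z n))\<^sup>2 / weight n"
  show "?q n \<ge> 0" for n using weight_pos[of n] by simp
  show "\<forall>\<^sub>F F in finite_subsets_at_top UNIV. sum ?q F \<le> 1 / (1 - (norm z)\<^sup>2)"
  proof (rule eventually_finite_subsets_at_top_weakI)
    fix F :: "('d \<Rightarrow> nat) set" assume F: "finite F" 
    define N where "N = Max ((\<lambda>n. \<Sum>k\<in>UNIV. n k) ` F)"
    have "sum ?q F \<le> sum ?q (\<Union>m\<in>{..N}. {n. (\<Sum>k\<in>UNIV. n k) = m})"
      using F weight_pos by (intro sum_mono2) (auto simp: finite_degree_eq N_def less_imp_le)
    also have "\<dots> = (\<Sum>m\<le>N. ((norm z)\<^sup>2) ^ m)"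
      by (subst sum.UNION_disjoint) (auto simp: finite_degree_eq sum_degree_zpow)
    also have "\<dots> \<le> (\<Sum>m. ((norm z)\<^sup>2) ^ m)"
      using assms by (intro sum_le_suminf summable_geometric) (auto simp: power_less_one_iff abs_square_less_1)
    also have "\<dots> = 1 / (1 - (norm z)\<^sup>2)"
      using assms by (intro suminf_geometric) (auto simp: abs_square_less_1)
    finally show "sum ?q F \<le> 1 / (1 - (norm z)\<^sup>2)" .
  qed
qed

lemma summable_square_summable_zpow:
  fixes z :: "complex ^ 'd::finite"
  assumes "norm z < 1" "square_summable a"
  shows "(\<lambda>n. norm (a n * zpow z n)) summable_on UNIV"
proof (rule summable_on_comparison_test)
  show "(\<lambda>n. weight n * (cmod (a n))\<^sup>2 + (cmod (zpow z n))\<^sup>2 / weight n) summable_on UNIV"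
    using assms by (intro summable_on_add summable_zpow_weight) (auto simp: square_summable_def)
  fix n :: "'d \<Rightarrow> nat"
  let ?s = "sqrt (weight n)"
  have "2 * (?s * cmod (a n)) * (cmod (zpow z n) / ?s) \<le> (?s * cmod (a n))\<^sup>2 + (cmod (zpow z n) / ?s)\<^sup>2"
    by (rule sum_squares_bound)
  then have "2 * (cmod (a n) * cmod (zpow z n)) \<le> weight n * (cmod (a n))\<^sup>2 + (cmod (zpow z n))\<^sup>2 / weight n"
    using weight_pos[of n] by (simp add: power_mult_distrib power_divide)
  then show "norm (a n * zpow z n) \<le> weight n * (cmod (a n))\<^sup>2 + (cmod (zpow z n))\<^sup>2 / weight n"
    using mult_nonneg_nonneg[of "cmod (a n)" "cmod (zpow z n)"]
    by (simp add: norm_mult del: mult_nonneg_nonneg)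
qed auto

lemma power_series_zero_imp_coeffs_zero:
  fixes a :: "nat \<Rightarrow> complex"
  assumes "\<And>t. norm t < 1 \<Longrightarrow> (\<lambda>m. a m * t ^ m) sums 0"
  shows "a m = 0"
proof (induction m rule: less_induct)
  case (less m)
  have "(\<lambda>i. a (i + m) * t ^ i) sums 0" if "norm t < 1" "t \<noteq> 0" for t
  proof -
    have "(\<lambda>i. a (i + m) * t ^ (i + m)) sums (0 - (\<Sum>i<m. a i * t ^ i))"
      by (rule sums_split_initial_segment) (rule assms[OF that(1)])
    then have "(\<lambda>i. a (i + m) * t ^ (i + m)) sums 0"
      using less.IH by simp
    from sums_mult[OF this, of "1 / t ^ m"] show ?thesis
      using that by (simp add: power_add)
  qed
  from powser_limit_0_strong[of 1 "\<lambda>i. a (i + m)" "\<lambda>_. 0", OF _ this]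
  have "((\<lambda>_. 0) \<longlongrightarrow> a m) (at (0::complex))" by simp
  then show "a m = 0"
    using tendsto_unique[OF _ _ tendsto_const, of "at (0::complex)"] by (metis at_neq_bot)
qed

lemma base_digits_unique:
  fixes f g :: "nat \<Rightarrow> nat"
  assumes "\<forall>i<D. f i < B" "\<forall>i<D. g i < B" "(\<Sum>i<D. f i * B ^ i) = (\<Sum>i<D. g i * B ^ i)"
  shows "\<forall>i<D. f i = g i"
  using assms
proof (induction D arbitrary: f g)
  case (Suc D)
  have eq: "f 0 + B * (\<Sum>i<D. f (Suc i) * B ^ i) = g 0 + B * (\<Sum>i<D. g (Suc i) * B ^ i)"
    using Suc.prems(3) by (simp only: sum.lessThan_Suc_shift sum_distrib_left) (simp add: mult_ac)
  have B: "f 0 < B" "g 0 < B" using Suc.prems by auto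
  have "f 0 = g 0" using arg_cong[OF eq, of "\<lambda>x. x mod B"] B by simp
  moreover have "\<forall>i<D. f (Suc i) = g (Suc i)"
    using Suc.prems eq \<open>f 0 = g 0\<close> B by (intro Suc.IH) auto
  ultimately show ?case by (auto simp: less_Suc_eq_0_disj)
qed auto

lemma zpow_scaleC:
  fixes z :: "complex ^ 'd::finite"
  shows "zpow (t *\<^sub>C z) n = t ^ (\<Sum>k\<in>UNIV. n k) * zpow z n"
  by (simp add: zpow_def scaleC_vec_def scaleC_complex_def power_mult_distrib prod.distrib power_sum)

lemma norm_scaleC: "norm (c *\<^sub>C x) = cmod c * norm (x :: 'a::complex_inner)"
proof -
  have r: "cinner x (c *\<^sub>C y) = cnj c * cinner x y" for x y :: 'a and c
    by (metis cinner_commute cinner_scaleC_left complex_cnj_mult)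
  have "cinner x x = complex_of_real (inner x x)"
    using cinner_commute[of x x] by (simp add: complex_eq_iff inner_cinner)
  then have "inner (c *\<^sub>C x) (c *\<^sub>C x) = (cmod c)\<^sup>2 * inner x x"
    unfolding cmod_power2 by (simp add: inner_cinner cinner_scaleC_left r power2_eq_square algebra_simps)
  then show ?thesis
    by (simp add: norm_eq_sqrt_inner real_sqrt_mult)
qed

lemma coeffs_zero:
  fixes a :: "('d::finite \<Rightarrow> nat) \<Rightarrow> complex"
  assumes "square_summable a" and z: "\<And>z. norm z < 1 \<Longrightarrow> ((\<lambda>n. a n * zpow z n) has_sum 0) UNIV"
  shows "a n = 0"
proof -
  let ?D = "\<lambda>m. {n :: 'd \<Rightarrow> nat. (\<Sum>k\<in>UNIV. n k) = m}"
  define m where "m = (\<Sum>k\<in>UNIV. n k)"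
  have hom0: "(\<Sum>n\<in>?D m. a n * zpow z n) = 0" if nz: "norm z < 1" for z m
  proof (rule power_series_zero_imp_coeffs_zero[where a = "\<lambda>m. \<Sum>n\<in>?D m. a n * zpow z n"])
    fix t :: complex assume t: "norm t < 1"
    have "norm (t *\<^sub>C z) < 1"
      using mult_strict_mono[of "norm t" 1 "norm z" 1] t nz by (simp add: norm_scaleC)
    then have "((\<lambda>n. a n * zpow (t *\<^sub>C z) n) has_sum 0) UNIV" by (rule z)
    moreover have bij: "bij_betw snd (Sigma UNIV ?D) UNIV"
      by (auto simp: bij_betw_def inj_on_def image_def)
    ultimately have "((\<lambda>x. a (snd x) * zpow (t *\<^sub>C z) (snd x)) has_sum 0) (Sigma UNIV ?D)"
      using has_sum_reindex_bij_betw[OF bij, of "\<lambda>n. a n * zpow (t *\<^sub>C z) n"] by simp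
    then have "((\<lambda>m. \<Sum>n\<in>?D m. a n * zpow (t *\<^sub>C z) n) has_sum 0) UNIV"
      by (rule has_sum_SigmaD) (auto intro!: has_sum_finiteI finite_degree_eq)
    moreover have "(\<Sum>n\<in>?D m. a n * zpow (t *\<^sub>C z) n) = (\<Sum>n\<in>?D m. a n * zpow z n) * t ^ m" for m
      by (auto simp: zpow_scaleC sum_distrib_right intro!: sum.cong)
    ultimately show "(\<lambda>m. (\<Sum>n\<in>?D m. a n * zpow z n) * t ^ m) sums 0"
      by (simp add: has_sum_imp_sums)
  qed
  have hom: "(\<Sum>n\<in>?D m. a n * zpow z n) = 0" for z
  proof -
    define t where "t = 1 / (2 + norm z)"
    have "2 + norm z > 0" by (intro add_pos_nonneg) auto
    then have t: "t > 0" "t * norm z < 1" by (auto simp: t_def field_simps)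
    have "(\<Sum>n\<in>?D m. a n * zpow (complex_of_real t *\<^sub>C z) n) = 0"
      using t by (intro hom0) (simp add: norm_scaleC)
    moreover have "(\<Sum>n\<in>?D m. a n * zpow (complex_of_real t *\<^sub>C z) n) = complex_of_real t ^ m * (\<Sum>n\<in>?D m. a n * zpow z n)"
      by (auto simp: zpow_scaleC sum_distrib_left intro!: sum.cong)
    ultimately show ?thesis using t by simp
  qed
  obtain e :: "nat \<Rightarrow> 'd" where e: "bij_betw e {..<CARD('d)} UNIV"
    using ex_bij_betw_nat_finite[of "UNIV :: 'd set"] by (auto simp: atLeast0LessThan)
  define idx where "idx = the_inv_into {..<CARD('d)} e"
  have idx: "idx (e i) = i" if "i < CARD('d)" for i
    using e that by (auto simp: idx_def bij_betw_def the_inv_into_f_f)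
  define N where "N n = (\<Sum>k\<in>UNIV. n k * Suc m ^ idx k)" for n :: "'d \<Rightarrow> nat"
  have N: "N n = (\<Sum>i<CARD('d). n (e i) * Suc m ^ i)" for n
    unfolding N_def by (subst sum.reindex_bij_betw[OF e, symmetric]) (simp add: idx)
  have inj: "inj_on N (?D m)"
  proof (rule inj_onI)
    fix n n' assume n: "n \<in> ?D m" "n' \<in> ?D m" "N n = N n'"
    have le: "n i < Suc m" "n' i < Suc m" for i
      using n member_le_sum[of i UNIV n] member_le_sum[of i UNIV n'] by auto
    have "\<forall>i<CARD('d). n (e i) = n' (e i)"
      using n(3) le unfolding N by (intro base_digits_unique[where B = "Suc m"]) auto
    note digits = this
    show "n = n'"
    proof
      fix k
      have "k \<in> e ` {..<CARD('d)}"
        using e by (simp add: bij_betw_def)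
      then obtain i where "i < CARD('d)" "k = e i" by auto
      then show "n k = n' k" using digits by simp
    qed
  qed
  have zp: "zpow (\<chi> k. s ^ (Suc m ^ idx k)) n = s ^ N n" for s n
    by (simp only: zpow_def N_def power_sum vec_lambda_beta power_mult[symmetric] mult.commute)
  define K where "K = Max (N ` ?D m)"
  define c where "c j = (\<Sum>n\<in>{n\<in>?D m. N n = j}. a n)" for j
  have "(\<Sum>j\<le>K. c j * s ^ j) = 0" for s
  proof -
    have "(\<Sum>j\<le>K. c j * s ^ j) = (\<Sum>j\<le>K. \<Sum>n\<in>{n\<in>?D m. N n = j}. a n * s ^ N n)"
      by (auto simp: c_def sum_distrib_right intro!: sum.cong)
    also have "\<dots> = (\<Sum>n\<in>?D m. a n * s ^ N n)"
      by (rule sum.group) (auto simp: K_def finite_degree_eq)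
    also have "\<dots> = 0" using hom[of "\<chi> k. s ^ (Suc m ^ idx k)"] by (simp add: zp)
    finally show ?thesis .
  qed
  then have "c (N n) = 0"
    using polyfun_eq_0[of c K] by (auto simp: K_def finite_degree_eq m_def)
  moreover have "{n'\<in>?D m. N n' = N n} = {n}"
    using inj by (auto simp: inj_on_def m_def)
  ultimately show ?thesis by (simp add: c_def)
qed


text \<open>An element of \<open>H\<^sup>2\<close> is a function on the open unit ball, extended by \<open>0\<close> off the ball,
  that has a power series expansion \<open>\<Sum> a\<^sub>n z\<^sup>n\<close> there with \<open>\<Sum> weight n \<bar>a\<^sub>n\<bar>\<^sup>2 < \<infinity>\<close>;
  these are exactly the functions in the Hilbert space of functions on the ball in which the
  monomials are orthogonal with \<open>\<parallel>z\<^sup>n\<parallel>\<^sup>2 = weight n\<close> and have dense span.\<close>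

typedef ('d::finite) fock = "{f :: complex ^ 'd \<Rightarrow> complex.
    (\<exists>a. square_summable a \<and> power_series_on_ball a f) \<and> (\<forall>z. z \<notin> ball 0 1 \<longrightarrow> f z = 0)}"
  morphisms fock_fun Abs_fock
  by (rule exI[of _ "\<lambda>_. 0"])
    (auto simp: power_series_on_ball_def intro!: exI[of _ "\<lambda>_. 0"] square_summable_zero)

setup_lifting type_definition_fock

definition taylor_coeff :: "'d::finite fock \<Rightarrow> ('d \<Rightarrow> nat) \<Rightarrow> complex"
  where "taylor_coeff f = (THE a. square_summable a \<and> power_series_on_ball a (fock_fun f))"

lemma power_series_on_ball_zero: "power_series_on_ball (\<lambda>_. 0) (\<lambda>_. 0)"
  by (simp add: power_series_on_ball_def)

lemma power_series_on_ball_add: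
  "power_series_on_ball a f \<Longrightarrow> power_series_on_ball b g \<Longrightarrow>
    power_series_on_ball (\<lambda>n. a n + b n) (\<lambda>z. f z + g z)"
  by (simp add: power_series_on_ball_def distrib_right has_sum_add)

lemma power_series_on_ball_cmult:
  "power_series_on_ball a f \<Longrightarrow> power_series_on_ball (\<lambda>n. c * a n) (\<lambda>z. c * f z)"
  by (simp add: power_series_on_ball_def mult.assoc has_sum_cmult_right)

lemma power_series_on_ball_uminus:
  "power_series_on_ball a f \<Longrightarrow> power_series_on_ball (\<lambda>n. - a n) (\<lambda>z. - f z)"
  using power_series_on_ball_cmult[of a f "-1"] by simp

lemma power_series_on_ball_diff:
  "power_series_on_ball a f \<Longrightarrow> power_series_on_ball b g \<Longrightarrow>
    power_series_on_ball (\<lambda>n. a n - b n) (\<lambda>z. f z - g z)"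
  using power_series_on_ball_add[of a f "\<lambda>n. - b n" "\<lambda>z. - g z"]
  by (simp add: power_series_on_ball_uminus)

lemma power_series_on_ball_unique:
  assumes "square_summable a" "square_summable b" "power_series_on_ball a f" "power_series_on_ball b f"
  shows "a = b"
proof
  fix n
  have "a n - b n = 0"
    using power_series_on_ball_diff[OF assms(3,4)] square_summable_diff[OF assms(1,2)]
    by (intro coeffs_zero[of "\<lambda>n. a n - b n"]) (auto simp: power_series_on_ball_def)
  then show "a n = b n" by simp
qed

lemma taylor_coeff_eqI:
  assumes "square_summable a" "power_series_on_ball a (fock_fun f)"
  shows "taylor_coeff f = a"
  unfolding taylor_coeff_def using assms by (blast intro: the_equality power_series_on_ball_unique)

lemma square_summable_taylor_coeff: "square_summable (taylor_coeff f)"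
  and power_series_taylor_coeff: "power_series_on_ball (taylor_coeff f) (fock_fun f)"
proof -
  obtain a where a: "square_summable a" "power_series_on_ball a (fock_fun f)"
    using fock_fun[of f] by auto
  with taylor_coeff_eqI[OF a] show "square_summable (taylor_coeff f)" "power_series_on_ball (taylor_coeff f) (fock_fun f)"
    by auto
qed

lemma fock_fun_outside: "z \<notin> ball 0 1 \<Longrightarrow> fock_fun f z = 0"
  using fock_fun[of f] by auto

lemma fock_eqI:
  assumes "taylor_coeff f = taylor_coeff g" shows "f = g"
proof -
  have "fock_fun f z = fock_fun g z" for z
  proof (cases "z \<in> ball 0 1")
    case True
    have "((\<lambda>n. taylor_coeff h n * zpow z n) has_sum fock_fun h z) UNIV" for h
      using power_series_taylor_coeff[of h] True unfolding power_series_on_ball_def by (rule bspec)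
    from this[of f] this[of g] show ?thesis
      unfolding assms by (rule has_sum_unique)
  qed (simp add: fock_fun_outside)
  then show ?thesis by (simp add: fock_fun_inject[symmetric] fun_eq_iff)
qed

lemma ex_fock_coeff:
  assumes "square_summable a" shows "\<exists>f. taylor_coeff f = a"
proof -
  define f where "f = (\<lambda>z. if z \<in> ball 0 1 then \<Sum>\<^sub>\<infinity>n. a n * zpow z n else 0)"
  have "power_series_on_ball a f"
    using abs_summable_summable[OF summable_square_summable_zpow[OF _ assms]]
    unfolding power_series_on_ball_def f_def by simp
  moreover from this assms have "fock_fun (Abs_fock f) = f"
    by (intro Abs_fock_inverse) (auto simp: f_def)
  ultimately have "taylor_coeff (Abs_fock f) = a"
    using assms by (intro taylor_coeff_eqI) auto
  then show ?thesis ..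
qed

instantiation fock :: (finite) complex_inner
begin

lift_definition zero_fock :: "'a fock" is "\<lambda>_. 0"
  by (intro conjI exI) (rule square_summable_zero, rule power_series_on_ball_zero, simp)

lift_definition plus_fock :: "'a fock \<Rightarrow> 'a fock \<Rightarrow> 'a fock" is "\<lambda>f g z. f z + g z"
  by (elim conjE exE, intro conjI exI) (erule (1) square_summable_add, erule (1) power_series_on_ball_add, simp)

lift_definition minus_fock :: "'a fock \<Rightarrow> 'a fock \<Rightarrow> 'a fock" is "\<lambda>f g z. f z - g z"
  by (elim conjE exE, intro conjI exI) (erule (1) square_summable_diff, erule (1) power_series_on_ball_diff, simp)

lift_definition uminus_fock :: "'a fock \<Rightarrow> 'a fock" is "\<lambda>f z. - f z"
  by (elim conjE exE, intro conjI exI) (erule (0) square_summable_uminus, erule (0) power_series_on_ball_uminus, simp)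

lift_definition scaleC_fock :: "complex \<Rightarrow> 'a fock \<Rightarrow> 'a fock" is "\<lambda>c f z. c * f z"
  by (elim conjE exE, intro conjI exI) (erule (0) square_summable_cmult, erule (0) power_series_on_ball_cmult, simp)

definition scaleR_fock :: "real \<Rightarrow> 'a fock \<Rightarrow> 'a fock"
  where "scaleR_fock r f = complex_of_real r *\<^sub>C f"

definition cinner_fock :: "'a fock \<Rightarrow> 'a fock \<Rightarrow> complex"
  where "cinner_fock f g = (\<Sum>\<^sub>\<infinity>n. complex_of_real (weight n) * taylor_coeff f n * cnj (taylor_coeff g n))"

definition inner_fock :: "'a fock \<Rightarrow> 'a fock \<Rightarrow> real"
  where "inner_fock f g = Re (cinner f g)"

definition norm_fock :: "'a fock \<Rightarrow> real"
  where "norm_fock f = sqrt (inner f f)"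

definition dist_fock :: "'a fock \<Rightarrow> 'a fock \<Rightarrow> real"
  where "dist_fock f g = norm (f - g)"

definition sgn_fock :: "'a fock \<Rightarrow> 'a fock"
  where "sgn_fock f = inverse (norm f) *\<^sub>R f"

definition uniformity_fock :: "('a fock \<times> 'a fock) filter"
  where "uniformity_fock = (INF e\<in>{0 <..}. principal {(x, y). dist x y < e})"

definition open_fock :: "'a fock set \<Rightarrow> bool"
  where "open_fock U \<longleftrightarrow> (\<forall>x\<in>U. eventually (\<lambda>(x', y). x' = x \<longrightarrow> y \<in> U) uniformity)"

lemma taylor_coeff_zero: "taylor_coeff (0 :: 'a fock) = (\<lambda>_. 0)"
  by (rule taylor_coeff_eqI) (simp_all add: square_summable_zero zero_fock.rep_eq power_series_on_ball_zero)

lemma taylor_coeff_add: "taylor_coeff (f + g :: 'a fock) = (\<lambda>n. taylor_coeff f n + taylor_coeff g n)"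
  by (rule taylor_coeff_eqI) (simp_all add: square_summable_taylor_coeff square_summable_add plus_fock.rep_eq
      power_series_on_ball_add power_series_taylor_coeff)

lemma taylor_coeff_diff: "taylor_coeff (f - g :: 'a fock) = (\<lambda>n. taylor_coeff f n - taylor_coeff g n)"
  by (rule taylor_coeff_eqI) (simp_all add: square_summable_taylor_coeff square_summable_diff minus_fock.rep_eq
      power_series_on_ball_diff power_series_taylor_coeff)

lemma taylor_coeff_uminus: "taylor_coeff (- f :: 'a fock) = (\<lambda>n. - taylor_coeff f n)"
  by (rule taylor_coeff_eqI) (simp_all add: square_summable_taylor_coeff square_summable_uminus uminus_fock.rep_eq
      power_series_on_ball_uminus power_series_taylor_coeff)

lemma taylor_coeff_scaleC: "taylor_coeff (c *\<^sub>C f :: 'a fock) = (\<lambda>n. c * taylor_coeff f n)"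
  by (rule taylor_coeff_eqI) (simp_all add: square_summable_taylor_coeff square_summable_cmult scaleC_fock.rep_eq
      power_series_on_ball_cmult power_series_taylor_coeff)

lemma inner_fock_self: "inner f f = (\<Sum>\<^sub>\<infinity>n. weight n * (cmod (taylor_coeff f n))\<^sup>2)" for f :: "'a fock"
proof -
  have "complex_of_real (weight n) * taylor_coeff f n * cnj (taylor_coeff f n) =
      complex_of_real (weight n * (cmod (taylor_coeff f n))\<^sup>2)" for n
    by (simp only: of_real_mult complex_norm_square mult.assoc)
  then have "cinner f f = (\<Sum>\<^sub>\<infinity>n. complex_of_real (weight n * (cmod (taylor_coeff f n))\<^sup>2))"
    unfolding cinner_fock_def by presburger
  also have "\<dots> = complex_of_real (\<Sum>\<^sub>\<infinity>n. weight n * (cmod (taylor_coeff f n))\<^sup>2)"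
    using square_summable_taylor_coeff[of f] unfolding square_summable_def
    by (intro infsumI has_sum_of_real has_sum_infsum)
  finally show ?thesis by (simp add: inner_fock_def)
qed

instance
proof
  fix f g h :: "'a fock" and a b :: complex and r s :: real
  show "f + g + h = f + (g + h)" by (rule fock_eqI) (simp add: taylor_coeff_add add.assoc)
  show "f + g = g + f" by (rule fock_eqI) (simp add: taylor_coeff_add add.commute)
  show "0 + f = f" by (rule fock_eqI) (simp add: taylor_coeff_add taylor_coeff_zero)
  show "- f + f = 0" by (rule fock_eqI) (simp add: taylor_coeff_add taylor_coeff_zero taylor_coeff_uminus)
  show "f - g = f + - g" by (rule fock_eqI) (simp add: taylor_coeff_add taylor_coeff_diff taylor_coeff_uminus)
  show "r *\<^sub>R (f + g) = r *\<^sub>R f + r *\<^sub>R g"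
    by (rule fock_eqI) (simp add: taylor_coeff_add taylor_coeff_scaleC scaleR_fock_def algebra_simps)
  show "(r + s) *\<^sub>R f = r *\<^sub>R f + s *\<^sub>R f"
    by (rule fock_eqI) (simp add: taylor_coeff_add taylor_coeff_scaleC scaleR_fock_def algebra_simps)
  show "r *\<^sub>R s *\<^sub>R f = (r * s) *\<^sub>R f"
    by (rule fock_eqI) (simp add: taylor_coeff_scaleC scaleR_fock_def algebra_simps)
  show "1 *\<^sub>R f = f"
    by (rule fock_eqI) (simp add: taylor_coeff_scaleC scaleR_fock_def)
  show "a *\<^sub>C (f + g) = a *\<^sub>C f + a *\<^sub>C g"
    by (rule fock_eqI) (simp add: taylor_coeff_add taylor_coeff_scaleC algebra_simps)
  show "(a + b) *\<^sub>C f = a *\<^sub>C f + b *\<^sub>C f"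
    by (rule fock_eqI) (simp add: taylor_coeff_add taylor_coeff_scaleC algebra_simps)
  show "a *\<^sub>C b *\<^sub>C f = (a * b) *\<^sub>C f"
    by (rule fock_eqI) (simp add: taylor_coeff_scaleC algebra_simps)
  show "r *\<^sub>R f = complex_of_real r *\<^sub>C f" by (simp add: scaleR_fock_def)
  show "dist f g = norm (f - g)" by (simp add: dist_fock_def)
  show "sgn f = inverse (norm f) *\<^sub>R f" by (simp add: sgn_fock_def)
  show "uniformity = (INF e\<in>{0 <..}. principal {(x, y :: 'a fock). dist x y < e})"
    by (simp add: uniformity_fock_def)
  show "open U \<longleftrightarrow> (\<forall>x\<in>U. eventually (\<lambda>(x', y). x' = x \<longrightarrow> y \<in> U) uniformity)"
    for U :: "'a fock set"
    by (simp add: open_fock_def)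
  show "inner f g = Re (cinner f g)" by (simp add: inner_fock_def)
  show "norm f = sqrt (inner f f)" by (simp add: norm_fock_def)
  note sm = summable_square_summable_mult[OF square_summable_taylor_coeff square_summable_taylor_coeff]
  show add: "cinner (f + g) h = cinner f h + cinner g h" for f g h :: "'a fock"
    unfolding cinner_fock_def taylor_coeff_add infsum_add[OF sm sm, symmetric]
    by (simp add: algebra_simps)
  show scale: "cinner (a *\<^sub>C f) g = a * cinner f g" for a and f g :: "'a fock"
    unfolding cinner_fock_def taylor_coeff_scaleC infsum_cmult_right'[symmetric]
    by (simp add: algebra_simps)
  show comm: "cinner f g = cnj (cinner g f)" for f g :: "'a fock"
    unfolding cinner_fock_def infsum_cnj[symmetric] by (simp add: mult_ac)
  show "inner f g = inner g f"
    unfolding inner_fock_def by (subst comm) simp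
  show "inner (f + g) h = inner f h + inner g h"
    by (simp add: inner_fock_def add)
  show "inner (r *\<^sub>R f) g = r * inner f g"
    by (simp add: inner_fock_def scaleR_fock_def scale)
  show "0 \<le> inner f f"
    unfolding inner_fock_self by (rule infsum_nonneg) simp
  show "inner f f = 0 \<longleftrightarrow> f = 0"
  proof
    assume "inner f f = 0"
    then have "weight n * (cmod (taylor_coeff f n))\<^sup>2 = 0" for n
      using square_summable_taylor_coeff[of f] unfolding inner_fock_self square_summable_def
      by (intro nonneg_infsum_le_0D[where A = UNIV and f = "\<lambda>n. weight n * (cmod (taylor_coeff f n))\<^sup>2"]) auto
    then show "f = 0" by (intro fock_eqI) (auto simp: taylor_coeff_zero)
  next
    assume "f = 0"
    then show "inner f f = 0" unfolding inner_fock_self by (simp add: taylor_coeff_zero)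
  qed
qed

end

lemma norm_fock: "(norm f)\<^sup>2 = (\<Sum>\<^sub>\<infinity>n. weight n * (cmod (taylor_coeff f n))\<^sup>2)"
  by (simp add: power2_norm_eq_inner inner_fock_self)

lemma sum_coeff_le_norm:
  assumes "finite F" shows "(\<Sum>n\<in>F. weight n * (cmod (taylor_coeff f n))\<^sup>2) \<le> (norm f)\<^sup>2"
  unfolding norm_fock using square_summable_taylor_coeff[of f] assms
  by (intro finite_sum_le_infsum) (auto simp: square_summable_def)

lemma norm_fock_leI:
  assumes "\<And>F. finite F \<Longrightarrow> (\<Sum>n\<in>F. weight n * (cmod (taylor_coeff f n))\<^sup>2) \<le> c\<^sup>2" "c \<ge> 0"
  shows "norm f \<le> c"
proof -
  have "(norm f)\<^sup>2 \<le> c\<^sup>2"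
    unfolding norm_fock using square_summable_taylor_coeff[of f] assms(1)
    by (intro infsum_le_finite_sums) (auto simp: square_summable_def)
  then show ?thesis using assms(2) by (rule power2_le_imp_le)
qed

instance fock :: (finite) chilbert_space
proof
  fix X :: "nat \<Rightarrow> 'a fock"
  assume X: "Cauchy X"
  have "Cauchy (\<lambda>i. taylor_coeff (X i) n)" for n
  proof (rule metric_CauchyI)
    fix e :: real assume e: "e > 0"
    then obtain M where M: "\<And>i j. i \<ge> M \<Longrightarrow> j \<ge> M \<Longrightarrow> dist (X i) (X j) < e * sqrt (weight n)"
      using metric_CauchyD[OF X, of "e * sqrt (weight n)"] by auto
    have "dist (taylor_coeff (X i) n) (taylor_coeff (X j) n) < e" if "i \<ge> M" "j \<ge> M" for i j
    proof -
      have "(sqrt (weight n) * cmod (taylor_coeff (X i - X j) n))\<^sup>2 \<le> (norm (X i - X j))\<^sup>2"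
        using sum_coeff_le_norm[of "{n}" "X i - X j"] by (simp add: power_mult_distrib)
      then have "sqrt (weight n) * cmod (taylor_coeff (X i - X j) n) \<le> norm (X i - X j)"
        by (rule power2_le_imp_le) simp
      also have "\<dots> < sqrt (weight n) * e" using M[OF that] by (simp add: dist_norm mult.commute)
      finally show ?thesis by (simp add: taylor_coeff_diff dist_norm)
    qed
    then show "\<exists>M. \<forall>i\<ge>M. \<forall>j\<ge>M. dist (taylor_coeff (X i) n) (taylor_coeff (X j) n) < e" by blast
  qed
  then have "\<forall>n. \<exists>l. (\<lambda>i. taylor_coeff (X i) n) \<longlonglongrightarrow> l"
    by (auto simp: Cauchy_convergent_iff convergent_def)
  then obtain a where a: "\<And>n. (\<lambda>i. taylor_coeff (X i) n) \<longlonglongrightarrow> a n" by metis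
  have bound: "(\<Sum>n\<in>F. weight n * (cmod (taylor_coeff (X i) n - a n))\<^sup>2) \<le> e\<^sup>2"
    if "finite F" "\<And>j. j \<ge> M \<Longrightarrow> dist (X i) (X j) < e" for F i e M
  proof (rule tendsto_upperbound)
    show "(\<lambda>j. \<Sum>n\<in>F. weight n * (cmod (taylor_coeff (X i) n - taylor_coeff (X j) n))\<^sup>2) \<longlonglongrightarrow>
        (\<Sum>n\<in>F. weight n * (cmod (taylor_coeff (X i) n - a n))\<^sup>2)"
      by (intro tendsto_intros a)
    have "(\<Sum>n\<in>F. weight n * (cmod (taylor_coeff (X i) n - taylor_coeff (X j) n))\<^sup>2) \<le> e\<^sup>2" if "j \<ge> M" for j
    proof -
      have "(\<Sum>n\<in>F. weight n * (cmod (taylor_coeff (X i) n - taylor_coeff (X j) n))\<^sup>2) \<le> (norm (X i - X j))\<^sup>2"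
        using sum_coeff_le_norm[OF \<open>finite F\<close>, of "X i - X j"] by (simp add: taylor_coeff_diff)
      also have "\<dots> \<le> e\<^sup>2"
        using \<open>\<And>j. j \<ge> M \<Longrightarrow> dist (X i) (X j) < e\<close>[OF that]
        by (intro power_mono) (auto simp: dist_norm)
      finally show ?thesis .
    qed
    then show "\<forall>\<^sub>F j in sequentially.
        (\<Sum>n\<in>F. weight n * (cmod (taylor_coeff (X i) n - taylor_coeff (X j) n))\<^sup>2) \<le> e\<^sup>2"
      by (auto simp: eventually_sequentially)
  qed auto
  obtain M1 where M1: "\<And>j. j \<ge> M1 \<Longrightarrow> dist (X M1) (X j) < 1"
    using metric_CauchyD[OF X, of 1] by auto
  have "square_summable (\<lambda>n. taylor_coeff (X M1) n - a n)"
    unfolding square_summable_def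
    by (rule nonneg_bounded_partial_sums_imp_summable_on[where C = "1\<^sup>2"])
      (use bound[OF _ M1] in \<open>auto intro!: eventually_finite_subsets_at_top_weakI\<close>)
  from square_summable_diff[OF square_summable_taylor_coeff[of "X M1"] this] have "square_summable a"
    by simp
  then obtain f where f: "taylor_coeff f = a" using ex_fock_coeff by blast
  have "X \<longlonglongrightarrow> f"
  proof (rule metric_LIMSEQ_I)
    fix e :: real assume e: "e > 0"
    then obtain M where M: "\<And>i j. i \<ge> M \<Longrightarrow> j \<ge> M \<Longrightarrow> dist (X i) (X j) < e / 2"
      using metric_CauchyD[OF X, of "e / 2"] by auto
    have "norm (X i - f) \<le> e / 2" if "i \<ge> M" for i
      using bound[OF _ M[OF that]] e by (intro norm_fock_leI) (auto simp: taylor_coeff_diff f)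
    then show "\<exists>M. \<forall>i\<ge>M. dist (X i) f < e"
      using e by (intro exI[of _ M]) (force simp: dist_norm)
  qed
  then show "convergent X" by (auto simp: convergent_def)
qed


lift_definition z_monomial :: "('d::finite \<Rightarrow> nat) \<Rightarrow> 'd fock"
  is "\<lambda>n z. if z \<in> ball 0 1 then zpow z n else 0"
proof (intro conjI allI impI exI)
  fix n :: "'d \<Rightarrow> nat"
  let ?a = "\<lambda>m. if m = n then 1 else 0 :: complex"
  show "square_summable ?a"
    unfolding square_summable_def
    by (rule finite_nonzero_values_imp_summable_on) (rule finite_subset[of _ "{n}"], auto)
  show "power_series_on_ball ?a (\<lambda>z. if z \<in> ball 0 1 then zpow z n else 0)"
    unfolding power_series_on_ball_def
    by (intro ballI has_sum_finite_neutralI[of "{n}"]) (simp_all split: if_splits)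
qed auto

lemma taylor_coeff_z_monomial: "taylor_coeff (z_monomial n) = (\<lambda>m. if m = n then 1 else 0)"
proof (rule taylor_coeff_eqI)
  show "square_summable (\<lambda>m. if m = n then 1 else 0)"
    unfolding square_summable_def
    by (rule finite_nonzero_values_imp_summable_on) (rule finite_subset[of _ "{n}"], auto)
  show "power_series_on_ball (\<lambda>m. if m = n then 1 else 0) (fock_fun (z_monomial n))"
    unfolding power_series_on_ball_def z_monomial.rep_eq
    by (intro ballI has_sum_finite_neutralI[of "{n}"]) (simp_all split: if_splits)
qed

lemma cinner_z_monomial:
  "cinner (z_monomial m) (z_monomial n) = (if m = n then complex_of_real (weight n) else 0)"
proof -
  have "cinner (z_monomial m) (z_monomial n) = (\<Sum>\<^sub>\<infinity>l\<in>{n}. if m = n then complex_of_real (weight n) else 0)"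
    unfolding cinner_fock_def taylor_coeff_z_monomial by (rule infsum_cong_neutral) auto
  then show ?thesis by simp
qed

lemma taylor_coeff_sum:
  "finite F \<Longrightarrow> taylor_coeff (\<Sum>i\<in>F. f i) n = (\<Sum>i\<in>F. taylor_coeff (f i) n)"
  by (induction F rule: finite_induct) (simp_all add: taylor_coeff_zero taylor_coeff_add)

lemma cspan_z_monomials_dense: "closure (cspan (range z_monomial)) = UNIV"
proof -
  have "\<exists>g\<in>cspan (range z_monomial). dist g f < e" if "e > 0" for f :: "'d::finite fock" and e
  proof -
    let ?h = "\<lambda>n. weight n * (cmod (taylor_coeff f n))\<^sup>2"
    have sm: "?h summable_on UNIV"
      using square_summable_taylor_coeff[of f] by (simp add: square_summable_def)
    from infsum_finite_approximation[OF sm, of "(e / 2)\<^sup>2"] \<open>e > 0\<close>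
    obtain F where F: "finite F" "dist (sum ?h F) (infsum ?h UNIV) \<le> (e / 2)\<^sup>2"
      by auto
    define g where "g = (\<Sum>n\<in>F. taylor_coeff f n *\<^sub>C z_monomial n)"
    have g: "taylor_coeff g n = (if n \<in> F then taylor_coeff f n else 0)" for n
      using F(1) by (simp add: g_def taylor_coeff_sum taylor_coeff_scaleC taylor_coeff_z_monomial
          if_distrib cong: if_cong)
    have "(norm (g - f))\<^sup>2 = infsum ?h (UNIV - F)"
      unfolding norm_fock by (rule infsum_cong_neutral) (auto simp: taylor_coeff_diff g)
    also have "\<dots> = infsum ?h UNIV - sum ?h F"
      using infsum_Diff[OF sm, of F] F(1) by simp
    also have "\<dots> \<le> (e / 2)\<^sup>2"
      using F(2) by (simp add: dist_real_def)
    finally have "norm (g - f) \<le> e / 2"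
      by (rule power2_le_imp_le) (use \<open>e > 0\<close> in simp)
    moreover have "g \<in> cspan (range z_monomial)"
      unfolding g_def
      by (intro complex_vector.span_sum complex_vector.span_scale complex_vector.span_base) auto
    ultimately show ?thesis
      using \<open>e > 0\<close> by (auto simp: dist_norm intro!: bexI[of _ g])
  qed
  then show ?thesis
    by (auto simp: closure_approachable)
qed

lift_definition coord_mult :: "'d::finite \<Rightarrow> 'd fock \<Rightarrow> 'd fock" is "\<lambda>k f z. z $ k * f z"
proof (intro conjI allI impI; elim conjE exE)
  fix k :: 'd and f :: "complex ^ 'd \<Rightarrow> complex" and a
  assume a: "square_summable a" "power_series_on_ball a f"
  define b where "b n = (if n k = 0 then 0 else a (n(k := n k - 1)))" for n
  define up where "up n = n(k := Suc (n k))" for n :: "'d \<Rightarrow> nat"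
  have inj: "inj up"
  proof (rule injI, rule ext)
    fix n n' i assume "up n = up n'"
    then have "up n i = up n' i" by simp
    then show "n i = n' i" by (simp add: up_def split: if_splits)
  qed
  have b_up: "b (up n) = a n" for n by (simp add: b_def up_def)
  have z_up: "zpow z (up n) = z $ k * zpow z n" for z n by (simp add: up_def zpow_fun_upd_Suc)
  have b_0: "b n = 0" if "n \<notin> range up" for n
  proof (rule ccontr)
    assume "b n \<noteq> 0"
    then have "up (n(k := n k - 1)) = n" by (auto simp: b_def up_def split: if_splits)
    with that show False by (metis rangeI)
  qed
  have "(\<lambda>n. weight (up n) * (cmod (a n))\<^sup>2) summable_on UNIV"
  proof (rule summable_on_comparison_test)
    show "(\<lambda>n. weight n * (cmod (a n))\<^sup>2) summable_on UNIV"
      using a(1) by (simp add: square_summable_def)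
    fix n :: "'d \<Rightarrow> nat"
    have "n k \<le> (\<Sum>k\<in>UNIV. n k)" by (rule member_le_sum) auto
    then have "real (Suc (n k)) / real (Suc (\<Sum>k\<in>UNIV. n k)) \<le> 1"
      by (simp only: divide_le_eq_1 of_nat_le_iff of_nat_0_less_iff) simp
    then have "real (Suc (n k)) / real (Suc (\<Sum>k\<in>UNIV. n k)) * weight n \<le> 1 * weight n"
      by (rule mult_right_mono) simp
    then have "weight (up n) \<le> weight n"
      unfolding up_def weight_fun_upd_Suc by simp
    then show "weight (up n) * (cmod (a n))\<^sup>2 \<le> weight n * (cmod (a n))\<^sup>2"
      by (intro mult_right_mono) auto
  qed simp
  then have "(\<lambda>n. weight n * (cmod (b n))\<^sup>2) summable_on range up"
    by (subst summable_on_reindex[OF inj]) (simp add: o_def b_up)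
  then have "square_summable b"
    unfolding square_summable_def by (rule summable_on_cong_neutral[THEN iffD1, rotated -1]) (auto simp: b_0)
  moreover have "power_series_on_ball b (\<lambda>z. z $ k * f z)"
    unfolding power_series_on_ball_def
  proof
    fix z :: "complex ^ 'd" assume "z \<in> ball 0 1"
    then have "((\<lambda>n. z $ k * (a n * zpow z n)) has_sum z $ k * f z) UNIV"
      using a(2) by (intro has_sum_cmult_right) (auto simp: power_series_on_ball_def)
    then have "((\<lambda>n. b n * zpow z n) has_sum z $ k * f z) (range up)"
      by (subst has_sum_reindex[OF inj]) (simp add: o_def b_up z_up mult_ac)
    then show "((\<lambda>n. b n * zpow z n) has_sum z $ k * f z) UNIV"
      by (rule has_sum_cong_neutral[THEN iffD1, rotated -1]) (auto simp: b_0)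
  qed
  ultimately show "\<exists>a. square_summable a \<and> power_series_on_ball a (\<lambda>z. z $ k * f z)" by blast
qed auto

text \<open>\<open>H\<^sup>2 \<otimes> \<complex>\<^sup>r\<close> is the type \<open>'d fock ^ 'r\<close> with \<open>r = CARD('r)\<close>.\<close>

definition simple_tensor :: "'a::complex_inner \<Rightarrow> complex ^ 'r::finite \<Rightarrow> 'a ^ 'r"
  where "simple_tensor f \<zeta> = (\<chi> i. \<zeta> $ i *\<^sub>C f)"

lemma cinner_scaleC_right: "cinner x (c *\<^sub>C y) = cnj c * cinner x (y :: 'a::complex_inner)"
  by (metis cinner_commute cinner_scaleC_left complex_cnj_mult)

lemma cinner_simple_tensor:
  "cinner (simple_tensor f \<zeta>) (simple_tensor g \<eta>) = cinner f g * cinner \<zeta> \<eta>"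
  by (simp add: cinner_vec_def simple_tensor_def cinner_complex_def cinner_scaleC_left
      cinner_scaleC_right sum_distrib_left mult_ac)

definition d_shift :: "'d::finite \<Rightarrow> 'd fock ^ 'r::finite \<Rightarrow> 'd fock ^ 'r"
  where "d_shift k F = (\<chi> i. coord_mult k (F $ i))"

lemma d_shift_simple_tensor: "d_shift k (simple_tensor f \<zeta>) = simple_tensor (coord_mult k f) \<zeta>"
proof -
  have "coord_mult k (c *\<^sub>C f) = c *\<^sub>C coord_mult k f" for c
    by transfer (simp add: fun_eq_iff)
  then show ?thesis by (simp add: d_shift_def simple_tensor_def)
qed

definition closed_invariant_subspace :: "('d::finite fock ^ 'r::finite) set \<Rightarrow> bool"
  where "closed_invariant_subspace N \<longleftrightarrow> csubspace N \<and> closed N \<and> (\<forall>k. d_shift k ` N \<subseteq> N)"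

definition monomials :: "('d::finite fock ^ 'r::finite) set"
  where "monomials = {simple_tensor (z_monomial n) \<zeta> | n \<zeta>. True}"

lemma closed_invariant_subspace_hull:
  "closed_invariant_subspace (closed_invariant_subspace hull G)"
proof (rule hull_in)
  fix T :: "('a fock ^ 'b) set set"
  assume T: "Ball T closed_invariant_subspace"
  then show "closed_invariant_subspace (\<Inter>T)"
    unfolding closed_invariant_subspace_def
    by (auto intro!: complex_vector.subspace_Inter closed_Inter) blast
qed


section \<open>Operators on a closed subspace\<close>

text \<open>Operators on a closed complex subspace \<open>K\<close> are functions \<open>K \<rightarrow> K\<close>, represented
  extensionally (i.e. \<open>undefined\<close> off \<open>K\<close>), so that equal operators are equal functions.\<close>

definition bounded_operator :: "'a::chilbert_space set \<Rightarrow> ('a \<Rightarrow> 'a) \<Rightarrow> bool"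
  where "bounded_operator K A \<longleftrightarrow>
    A \<in> K \<rightarrow>\<^sub>E K \<and>
    (\<forall>x\<in>K. \<forall>y\<in>K. A (x + y) = A x + A y) \<and>
    (\<forall>c. \<forall>x\<in>K. A (c *\<^sub>C x) = c *\<^sub>C A x) \<and>
    (\<exists>C. \<forall>x\<in>K. norm (A x) \<le> C * norm x)"

definition adjoint_on :: "'a::chilbert_space set \<Rightarrow> ('a \<Rightarrow> 'a) \<Rightarrow> 'a \<Rightarrow> 'a"
  where "adjoint_on K A = (\<lambda>y\<in>K. THE z. z \<in> K \<and> (\<forall>x\<in>K. cinner (A x) y = cinner x z))"

definition orth_complement :: "'a::chilbert_space set \<Rightarrow> 'a set"
  where "orth_complement M = {x. \<forall>y\<in>M. cinner x y = 0}"

definition ortho_proj :: "'a::chilbert_space set \<Rightarrow> 'a \<Rightarrow> 'a"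
  where "ortho_proj M x = (THE y. y \<in> M \<and> x - y \<in> orth_complement M)"

definition finite_dimensional :: "'a::complex_inner set \<Rightarrow> bool"
  where "finite_dimensional V \<longleftrightarrow> (\<exists>B. finite B \<and> V \<subseteq> cspan B)"

definition compact_operator :: "'a::chilbert_space set \<Rightarrow> ('a \<Rightarrow> 'a) \<Rightarrow> bool"
  where "compact_operator K A \<longleftrightarrow> bounded_operator K A \<and> compact (closure (A ` (K \<inter> cball 0 1)))"

text \<open>The number of times \<open>s > 0\<close> occurs in the singular value list of \<open>A\<close>: its multiplicity as an
  eigenvalue of \<open>(A\<^sup>*A)\<^sup>1\<^sup>/\<^sup>2\<close>. The value is \<open>0\<close> if \<open>s\<close> is not a singular value; it is meaningful for
  compact \<open>A\<close>, where the eigenspace is finite-dimensional.\<close>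

definition singular_value_multiplicity :: "'a::chilbert_space set \<Rightarrow> ('a \<Rightarrow> 'a) \<Rightarrow> real \<Rightarrow> nat"
  where "singular_value_multiplicity K A s =
    cdim {x \<in> K. adjoint_on K A (A x) = complex_of_real (s\<^sup>2) *\<^sub>C x}"

definition schatten_class :: "real \<Rightarrow> 'a::chilbert_space set \<Rightarrow> ('a \<Rightarrow> 'a) set"
  where "schatten_class p K = {A. compact_operator K A \<and>
    (\<lambda>s. real (singular_value_multiplicity K A s) * s powr p) summable_on {0<..}}"

inductive_set star_algebra :: "'a::chilbert_space set \<Rightarrow> ('a \<Rightarrow> 'a) set \<Rightarrow> ('a \<Rightarrow> 'a) set"
  for K :: "'a set" and G :: "('a \<Rightarrow> 'a) set"
  where
    generator: "A \<in> G \<Longrightarrow> A \<in> star_algebra K G"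
  | identity: "(\<lambda>x\<in>K. x) \<in> star_algebra K G"
  | add: "A \<in> star_algebra K G \<Longrightarrow> B \<in> star_algebra K G \<Longrightarrow> (\<lambda>x\<in>K. A x + B x) \<in> star_algebra K G"
  | scale: "A \<in> star_algebra K G \<Longrightarrow> (\<lambda>x\<in>K. c *\<^sub>C A x) \<in> star_algebra K G"
  | mult: "A \<in> star_algebra K G \<Longrightarrow> B \<in> star_algebra K G \<Longrightarrow> compose K A B \<in> star_algebra K G"
  | adjoint: "A \<in> star_algebra K G \<Longrightarrow> adjoint_on K A \<in> star_algebra K G"

inductive_set commutator_ideal :: "'a::chilbert_space set \<Rightarrow> ('a \<Rightarrow> 'a) set \<Rightarrow> ('a \<Rightarrow> 'a) set"
  for K :: "'a set" and \<A> :: "('a \<Rightarrow> 'a) set"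
  where
    commutator: "A \<in> \<A> \<Longrightarrow> B \<in> \<A> \<Longrightarrow> (\<lambda>x\<in>K. A (B x) - B (A x)) \<in> commutator_ideal K \<A>"
  | add: "X \<in> commutator_ideal K \<A> \<Longrightarrow> Y \<in> commutator_ideal K \<A> \<Longrightarrow>
      (\<lambda>x\<in>K. X x + Y x) \<in> commutator_ideal K \<A>"
  | scale: "X \<in> commutator_ideal K \<A> \<Longrightarrow> (\<lambda>x\<in>K. c *\<^sub>C X x) \<in> commutator_ideal K \<A>"
  | mult_left: "A \<in> \<A> \<Longrightarrow> X \<in> commutator_ideal K \<A> \<Longrightarrow> compose K A X \<in> commutator_ideal K \<A>"
  | mult_right: "A \<in> \<A> \<Longrightarrow> X \<in> commutator_ideal K \<A> \<Longrightarrow> compose K X A \<in> commutator_ideal K \<A>"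

definition multioperator :: "'a::chilbert_space set \<Rightarrow> ('d \<Rightarrow> 'a \<Rightarrow> 'a) \<Rightarrow> bool"
  where "multioperator K T \<longleftrightarrow>
    (\<forall>k. bounded_operator K (T k)) \<and> (\<forall>j k. compose K (T j) (T k) = compose K (T k) (T j))"

definition compressed_shift :: "('d::finite fock ^ 'r::finite) set \<Rightarrow> 'd \<Rightarrow> 'd fock ^ 'r \<Rightarrow> 'd fock ^ 'r"
  where "compressed_shift M k = (\<lambda>x\<in>orth_complement M. d_shift k x - ortho_proj M (d_shift k x))"


section \<open>The Dirac operator\<close>

text \<open>\<open>\<Lambda>Z\<close> is the space \<open>complex ^ 'd set\<close> of coordinate vectors with respect to the basis
  \<open>e\<^sub>S = e\<^bsub>i\<^sub>1\<^esub> \<and> \<dots> \<and> e\<^bsub>i\<^sub>k\<^esub>\<close>, \<open>S = {i\<^sub>1 < \<dots> < i\<^sub>k}\<close>, which is orthonormal for the determinant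
  inner product.\<close>

type_synonym 'd exterior = "complex ^ 'd set"

definition ext_basis :: "'d::finite set \<Rightarrow> 'd exterior"
  where "ext_basis S = axis S 1"

definition wedge_sign :: "'d::linorder set \<Rightarrow> 'd set \<Rightarrow> complex"
  where "wedge_sign A B = (-1) ^ card {(a, b) \<in> A \<times> B. b < a}"

definition wedge :: "'d::{finite, linorder} exterior \<Rightarrow> 'd exterior \<Rightarrow> 'd exterior"
  where "wedge \<omega> \<eta> = (\<chi> S. \<Sum>A\<in>Pow S. wedge_sign A (S - A) * \<omega> $ A * \<eta> $ (S - A))"

definition creation :: "'d::{finite, linorder} \<Rightarrow> 'd exterior \<Rightarrow> 'd exterior"
  where "creation i \<omega> = wedge (ext_basis {i}) \<omega>"

lemma creation_nth:
  "creation i \<omega> $ S = (if i \<in> S then (-1) ^ card {j \<in> S. j < i} * \<omega> $ (S - {i}) else 0)"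
proof -
  have "creation i \<omega> $ S = (\<Sum>A\<in>Pow S. if A = {i} then wedge_sign A (S - A) * \<omega> $ (S - A) else 0)"
    unfolding creation_def wedge_def ext_basis_def vec_lambda_beta
    by (intro sum.cong) (auto simp: axis_def)
  also have "\<dots> = (if i \<in> S then wedge_sign {i} (S - {i}) * \<omega> $ (S - {i}) else 0)"
    by simp
  also have "{(a, b) \<in> {i} \<times> (S - {i}). b < a} = Pair i ` {j \<in> S. j < i}"
    by auto
  then have "wedge_sign {i} (S - {i}) = (-1) ^ card {j \<in> S. j < i}"
    unfolding wedge_sign_def by (simp add: card_image inj_on_def)
  finally show ?thesis .
qed

lemma creation_ext_basis_less:
  assumes "\<forall>j\<in>S. i < j" shows "creation i (ext_basis S) = ext_basis (insert i S)"
proof -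
  have "creation i (ext_basis S) $ R = ext_basis (insert i S) $ R" for R
  proof (cases "R = insert i S")
    case True
    have "{j \<in> R. j < i} = {}" "R - {i} = S" "i \<in> R"
      using assms True by (auto dest: order.asym)
    with True show ?thesis
      unfolding creation_nth ext_basis_def by (simp only: card.empty) (simp add: axis_def)
  next
    case False
    then show ?thesis
      unfolding creation_nth ext_basis_def by (auto simp: axis_def)
  qed
  then show ?thesis by (simp add: vec_eq_iff)
qed

lemma creation_anticommute: "creation i (creation j \<omega>) = - creation j (creation i \<omega>)"
proof -
  have *: "creation i (creation j \<omega>) $ S = - (creation j (creation i \<omega>) $ S)" if "i < j" for i j S
  proof (cases "i \<in> S \<and> j \<in> S")
    case True
    have "{l \<in> S. l < j} = insert i {l \<in> S - {i}. l < j}" "{l \<in> S - {j}. l < i} = {l \<in> S. l < i}"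
      using that True by auto
    moreover have "card (insert i {l \<in> S - {i}. l < j}) = Suc (card {l \<in> S - {i}. l < j})"
      by (rule card_insert_disjoint) auto
    moreover have "S - {i} - {j} = S - {j} - {i}" by auto
    ultimately show ?thesis
      using True that by (simp add: creation_nth)
  qed (auto simp: creation_nth)
  have "creation i (creation j \<omega>) $ S = - (creation j (creation i \<omega>) $ S)" for S
  proof (cases i j rule: linorder_cases)
    case equal
    then show ?thesis by (simp add: creation_nth)
  qed (use *[of i j S] *[of j i S] in auto)
  then show ?thesis by (simp add: vec_eq_iff)
qed

text \<open>For \<open>K\<close> a closed subspace of \<open>'a\<close>, \<open>K \<otimes> \<Lambda>Z\<close> consists of the elements
  \<open>\<Sum>\<^sub>S F\<^sub>S \<otimes> e\<^sub>S\<close> with all \<open>F\<^sub>S \<in> K\<close>.\<close>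

definition tensor_exterior :: "'a::chilbert_space set \<Rightarrow> ('a ^ 'd::finite set) set"
  where "tensor_exterior K = {F. \<forall>S. F $ S \<in> K}"

definition tensor_op :: "'a::chilbert_space set \<Rightarrow> ('a \<Rightarrow> 'a) \<Rightarrow> ('d::finite exterior \<Rightarrow> 'd exterior) \<Rightarrow>
    'a ^ 'd set \<Rightarrow> 'a ^ 'd set"
  where "tensor_op K A C = (\<lambda>F\<in>tensor_exterior K. \<chi> S. \<Sum>R\<in>UNIV. C (ext_basis R) $ S *\<^sub>C A (F $ R))"

lemma tensor_op_simple_tensor:
  assumes "csubspace K" "bounded_operator K A" "Vector_Spaces.linear scaleC scaleC C" "h \<in> K"
  shows "tensor_op K A C (simple_tensor h \<omega>) = simple_tensor (A h) (C \<omega>)"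
proof -
  interpret C: Vector_Spaces.linear scaleC scaleC C by fact
  have mem: "simple_tensor h \<omega> \<in> tensor_exterior K"
    using assms by (simp add: tensor_exterior_def simple_tensor_def complex_vector.subspace_scale)
  have A: "A (c *\<^sub>C h) = c *\<^sub>C A h" for c
    using assms by (simp add: bounded_operator_def)
  have "\<omega> = (\<Sum>R\<in>UNIV. \<omega> $ R *\<^sub>C ext_basis R)"
    by (simp add: vec_eq_iff ext_basis_def scaleC_vec_def scaleC_complex_def axis_def if_distrib
        cong: if_cong)
  then have "C \<omega> = C (\<Sum>R\<in>UNIV. \<omega> $ R *\<^sub>C ext_basis R)"
    by (rule arg_cong)
  then have "C \<omega> = (\<Sum>R\<in>UNIV. \<omega> $ R *\<^sub>C C (ext_basis R))"
    by (simp only: C.sum C.scale)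
  then have "C \<omega> $ S = (\<Sum>R\<in>UNIV. \<omega> $ R * C (ext_basis R) $ S)" for S
    by (simp add: scaleC_vec_def scaleC_complex_def)
  then show ?thesis
    using mem by (simp add: tensor_op_def simple_tensor_def vec_eq_iff A scaleC_scaleC
        complex_vector.scale_sum_left mult.commute)
qed

definition dirac_B :: "'a::chilbert_space set \<Rightarrow> ('d::{finite, linorder} \<Rightarrow> 'a \<Rightarrow> 'a) \<Rightarrow> 'a ^ 'd set \<Rightarrow> 'a ^ 'd set"
  where "dirac_B K T = (\<lambda>F\<in>tensor_exterior K. \<Sum>i\<in>UNIV. tensor_op K (T i) (creation i) F)"

definition dirac :: "'a::chilbert_space set \<Rightarrow> ('d::{finite, linorder} \<Rightarrow> 'a \<Rightarrow> 'a) \<Rightarrow> 'a ^ 'd set \<Rightarrow> 'a ^ 'd set"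
  where "dirac K T = (\<lambda>F\<in>tensor_exterior K. dirac_B K T F + adjoint_on (tensor_exterior K) (dirac_B K T) F)"

text \<open>Since the Dirac operator is self-adjoint, its cokernel is isomorphic to its kernel once its
  range is closed.\<close>

definition fredholm_multioperator :: "'a::chilbert_space set \<Rightarrow> ('d::{finite, linorder} \<Rightarrow> 'a \<Rightarrow> 'a) \<Rightarrow> bool"
  where "fredholm_multioperator K T \<longleftrightarrow> multioperator K T \<and>
    closed (dirac K T ` tensor_exterior K) \<and>
    finite_dimensional {F \<in> tensor_exterior K. dirac K T F = 0}"

end

theory Submission
  imports Defs
begin

text \<open>
  Everything on \<open>K = M\<^sup>\<bottom>\<close> is compared with the seminorm
  \<open>\<delta> x = \<parallel>(N + 1)\<^sup>-\<^sup>1 x\<parallel>\<close>, where \<open>N\<close> is the number operator (polynomial degree). Since the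
  components of degree \<open>m\<close> span a space of dimension \<open>O(m\<^sup>d\<^sup>-\<^sup>1)\<close>, an operator \<open>X\<close> with
  \<open>\<parallel>X x\<parallel> \<le> C \<delta> x\<close> has at most \<open>O(t\<^sup>-\<^sup>d)\<close> singular values \<open>\<ge> t\<close>, hence lies in the Schatten class
  for every \<open>p > d\<close>. Operators that satisfy this bound together with their adjoints are stable under
  multiplication by operators that preserve \<open>\<delta>\<close>-bounds, so by the Leibniz rule it suffices to
  estimate the commutators of the generators.

  A subspace generated by monomials is graded by multi-indices: \<open>M\<close> is given by an increasing
  family of subspaces \<open>M\<^sub>n \<subseteq> \<complex>\<^sup>r\<close>. By a Dickson-type argument there is \<open>n\<^sub>0\<close> such that \<open>M\<^sub>n = M\<^sub>n\<^sub>+\<^sub>e\<^sub>k\<close> as soon as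
  \<open>n\<^sub>k \<ge> n\<^sub>0\<close>. The contribution of the projections to \<open>[T\<^sub>j\<^sup>*, T\<^sub>k]\<close> therefore lives only on
  multi-indices with both \<open>n\<^sub>j\<close> and \<open>n\<^sub>k\<close> bounded by \<open>n\<^sub>0\<close>, where the weights are \<open>O(1/\<bar>n\<bar>)\<close>.

  For the Fredholm property, \<open>D\<^sup>2 = B\<^sup>* B + B B\<^sup>*\<close> equals \<open>\<Sum>T\<^sub>k T\<^sub>k\<^sup>* \<otimes> 1\<close> up to cross commutators, and
  \<open>\<Sum>T\<^sub>k T\<^sub>k\<^sup>*\<close> differs from the identity only in degree \<open>0\<close>. So \<open>D\<^sup>2 - 1\<close> is dominated by \<open>\<delta>\<close>, and \<open>D\<close> is
  bounded below on a closed subspace of finite codimension.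
\<close>

section \<open>Closed subspaces of a Hilbert space\<close>

text \<open>Comparing with \<open>\<delta>\<close> replaces the ideal calculus of Schatten classes.
  A bound of \<open>norm (X x)\<close> by a multiple of \<open>\<delta> x\<close> survives sums and
  left multiplication by any bounded operator, but right multiplication by \<open>A\<close> only if
  \<open>A\<close> is bounded for \<open>\<delta>\<close> too. Adjoints exchange left and right, so
  every condition is imposed on an operator and on its adjoint. The exponent \<open>d\<close>
  instead of \<open>d - 1\<close> arises because the spectral count uses all degrees below
  \<open>m\<close> at once. The obstacle is that the projection onto \<open>M\<close> does not
  commute with the shifts: on coefficients it is a projection in \<open>\<complex>^r\<close> that
  varies with the multi-index. In \<open>[T_j*, T_k]\<close> one product sees the projection at
  \<open>n + e_j\<close>, the other the one at \<open>n\<close>. Where both act alike, their scalar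
  factors nearly cancel; where they differ there is no cancellation, and each factor must be small
  on its own. For this the mere existence of a threshold suffices, with no bound on its size. For
  the Dirac operator, \<open>B^2 = 0\<close> makes the ranges of \<open>B\<close> and
  \<open>B*\<close> orthogonal, so a lower bound for \<open>D\<close> can be read off from the
  quadratic form of \<open>B* B + B B*\<close>.\<close>

lemma cinner_add_right: "cinner x (y + z) = cinner x y + cinner x (z :: 'a::complex_inner)"
  by (metis cinner_commute cinner_add_left complex_cnj_add)

lemma cinner_zero_left [simp]: "cinner 0 (x :: 'a::complex_inner) = 0"
  using cinner_add_left[of 0 0 x] by simp

lemma cinner_zero_right [simp]: "cinner (x :: 'a::complex_inner) 0 = 0"
  using cinner_add_right[of x 0 0] by simp

lemma cinner_diff_left: "cinner (x - y) z = cinner x z - cinner y (z :: 'a::complex_inner)"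
  using cinner_add_left[of "x - y" y z] by simp

lemma cinner_diff_right: "cinner x (y - z) = cinner x y - cinner x (z :: 'a::complex_inner)"
  using cinner_add_right[of x "y - z" z] by simp

lemma cinner_sum_left: "cinner (\<Sum>i\<in>I. f i) z = (\<Sum>i\<in>I. cinner (f i) (z :: 'a::complex_inner))"
  by (induction I rule: infinite_finite_induct) (simp_all add: cinner_add_left)

lemma cinner_sum_right: "cinner z (\<Sum>i\<in>I. f i) = (\<Sum>i\<in>I. cinner (z :: 'a::complex_inner) (f i))"
  by (induction I rule: infinite_finite_induct) (simp_all add: cinner_add_right)

lemma cinner_self: "cinner x x = complex_of_real ((norm (x :: 'a::complex_inner))\<^sup>2)"
  using cinner_commute[of x x] by (simp add: complex_eq_iff power2_norm_eq_inner inner_cinner)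

lemma cinner_self_eq_0 [simp]: "cinner x x = 0 \<longleftrightarrow> x = (0 :: 'a::complex_inner)"
  by (simp add: cinner_self)

lemma cinner_eq_0_commute: "cinner x y = 0 \<longleftrightarrow> cinner y (x :: 'a::complex_inner) = 0"
  by (metis cinner_commute complex_cnj_zero_iff)

text \<open>The phase \<open>u\<close> turns \<open>cinner x y\<close> into its modulus, so the real
  Cauchy-Schwarz inequality applies to \<open>u *\<^sub>C x\<close> and \<open>y\<close>.\<close>

lemma norm_cinner_le: "cmod (cinner x y) \<le> norm x * norm (y :: 'a::complex_inner)"
proof (cases "cinner x y = 0")
  case False
  define u where "u = cnj (cinner x y) / cmod (cinner x y)"
  have u: "cmod u = 1" using False by (simp add: u_def norm_divide)
  have "cinner (u *\<^sub>C x) y = complex_of_real (cmod (cinner x y))"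
    using False complex_norm_square[of "cinner x y"]
    by (simp add: cinner_scaleC_left u_def field_simps power2_eq_square)
  then have "cmod (cinner x y) = inner (u *\<^sub>C x) y"
    by (simp add: inner_cinner)
  also have "\<dots> \<le> norm (u *\<^sub>C x) * norm y" by (rule norm_cauchy_schwarz)
  finally show ?thesis by (simp add: norm_scaleC u)
qed simp

lemma bounded_linear_cinner_left: "bounded_linear (\<lambda>x. cinner x (y :: 'a::complex_inner))"
  by (rule bounded_linear_intro[of _ "norm y"])
    (simp_all add: cinner_add_left scaleR_scaleC[where 'a='a] cinner_scaleC_left norm_cinner_le scaleR_conv_of_real)

lemma bounded_linear_scaleC_left: "bounded_linear (\<lambda>c. c *\<^sub>C (x :: 'a::complex_inner))"
  by (rule bounded_linear_intro[of _ "norm x"])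
    (simp_all add: scaleC_add_left scaleR_scaleC[where 'a='a] scaleC_scaleC norm_scaleC scaleR_conv_of_real)

lemmas csubspace_0 = complex_vector.subspace_0
  and csubspace_add = complex_vector.subspace_add
  and csubspace_diff = complex_vector.subspace_diff
  and csubspace_scale = complex_vector.subspace_scale
  and csubspace_sum = complex_vector.subspace_sum

lemma csubspace_imp_subspace: "csubspace V \<Longrightarrow> subspace V"
  by (auto simp: subspace_def csubspace_0 csubspace_add csubspace_scale scaleR_scaleC)

lemma csubspace_orth_complement: "csubspace (orth_complement M)"
  by (auto intro!: complex_vector.subspaceI simp: orth_complement_def cinner_add_left cinner_scaleC_left)

lemma closed_orth_complement: "closed (orth_complement (M :: 'a::chilbert_space set))"
proof -
  have "orth_complement M = (\<Inter>y\<in>M. (\<lambda>x. cinner x y) -` {0})"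
    by (auto simp: orth_complement_def)
  then show ?thesis
    by (auto intro!: closed_INT continuous_closed_vimage linear_continuous_at bounded_linear_cinner_left)
qed

lemma orth_complement_antimono: "M \<subseteq> N \<Longrightarrow> orth_complement N \<subseteq> orth_complement M"
  by (auto simp: orth_complement_def)

lemma norm_add_orth:
  fixes x y :: "'a::complex_inner"
  assumes "cinner x y = 0" shows "(norm (x + y))\<^sup>2 = (norm x)\<^sup>2 + (norm y)\<^sup>2"
  using assms by (simp add: power2_norm_eq_inner inner_add_left inner_add_right inner_commute[of y x] inner_cinner[of x y])

section \<open>Nearest points, orthogonal projections and the Riesz representation\<close>

lemma dist_minimizing_sequence_Cauchy:
  fixes x :: "'a::real_inner"
  assumes V: "subspace V" and X: "\<And>i. X i \<in> V"
    and le: "\<And>y. y \<in> V \<Longrightarrow> m \<le> (norm (x - y))\<^sup>2"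
    and lim: "(\<lambda>i. (norm (x - X i))\<^sup>2) \<longlonglongrightarrow> m"
  shows "Cauchy X"
proof (rule metric_CauchyI)
  fix e :: real assume "e > 0"
  then have "\<forall>\<^sub>F i in sequentially. (norm (x - X i))\<^sup>2 < m + e\<^sup>2 / 4"
    by (intro order_tendstoD(2)[OF lim]) simp
  then obtain n where n: "\<And>i. i \<ge> n \<Longrightarrow> (norm (x - X i))\<^sup>2 < m + e\<^sup>2 / 4"
    by (auto simp: eventually_sequentially)
  have "dist (X i) (X j) < e" if "i \<ge> n" "j \<ge> n" for i j
  proof -
    let ?a = "x - X i" and ?b = "x - X j"
    \<comment> \<open>The midpoint lies in \<open>V\<close>, so its squared distance to
      \<open>x\<close> is at least \<open>m\<close>; the parallelogram law then forces
      \<open>X i\<close> and \<open>X j\<close> together.\<close>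
    have "(1/2) *\<^sub>R (X i + X j) \<in> V"
      using V X by (intro subspace_scale subspace_add)
    from le[OF this] have "4 * m \<le> 4 * (norm (x - (1/2) *\<^sub>R (X i + X j)))\<^sup>2" by simp
    also have "\<dots> = (norm (2 *\<^sub>R (x - (1/2) *\<^sub>R (X i + X j))))\<^sup>2"
      by (simp add: power_mult_distrib)
    also have "2 *\<^sub>R (x - (1/2) *\<^sub>R (X i + X j)) = ?a + ?b"
      by (simp add: algebra_simps scaleR_2)
    finally have "4 * m \<le> (norm (?a + ?b))\<^sup>2" .
    moreover have "(norm (?a + ?b))\<^sup>2 + (norm (?a - ?b))\<^sup>2 = 2 * (norm ?a)\<^sup>2 + 2 * (norm ?b)\<^sup>2"
      unfolding power2_norm_eq_inner inner_add_left inner_add_right inner_diff_left inner_diff_right by simp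
    ultimately have "(norm (?a - ?b))\<^sup>2 < e\<^sup>2"
      using n[OF that(1)] n[OF that(2)] by linarith
    then have "norm (?a - ?b) < e"
      using \<open>e > 0\<close> by (simp add: power2_less_imp_less)
    then show ?thesis by (simp add: dist_norm norm_minus_commute)
  qed
  then show "\<exists>M. \<forall>i\<ge>M. \<forall>j\<ge>M. dist (X i) (X j) < e" by blast
qed

lemma ex_closest_point:
  fixes V :: "'a::chilbert_space set"
  assumes V: "subspace V" "closed V"
  shows "\<exists>y\<in>V. \<forall>z\<in>V. norm (x - y) \<le> norm (x - z)"
proof -
  define m where "m = (INF y\<in>V. (norm (x - y))\<^sup>2)"
  have bdd: "bdd_below ((\<lambda>y. (norm (x - y))\<^sup>2) ` V)" by (rule bdd_belowI[of _ 0]) auto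
  have le: "m \<le> (norm (x - y))\<^sup>2" if "y \<in> V" for y
    unfolding m_def by (rule cINF_lower[OF bdd that])
  have "\<exists>y\<in>V. (norm (x - y))\<^sup>2 < m + inverse (real (Suc i))" for i
    using cINF_less_iff[of V "\<lambda>y. (norm (x - y))\<^sup>2" "m + inverse (real (Suc i))", OF _ bdd] subspace_0[OF V(1)]
    unfolding m_def[symmetric] by auto
  then obtain X where X: "\<And>i. X i \<in> V" "\<And>i. (norm (x - X i))\<^sup>2 < m + inverse (real (Suc i))" by metis
  have lim: "(\<lambda>i. (norm (x - X i))\<^sup>2) \<longlonglongrightarrow> m"
  proof (rule real_tendsto_sandwich[where f = "\<lambda>_. m" and h = "\<lambda>i. m + inverse (real (Suc i))"])
    show "(\<lambda>i. m + inverse (real (Suc i))) \<longlonglongrightarrow> m"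
      using tendsto_add[OF tendsto_const LIMSEQ_inverse_real_of_nat, of m] by simp
    show "\<forall>\<^sub>F i in sequentially. m \<le> (norm (x - X i))\<^sup>2" using le X(1) by simp
    show "\<forall>\<^sub>F i in sequentially. (norm (x - X i))\<^sup>2 \<le> m + inverse (real (Suc i))"
      by (intro always_eventually allI less_imp_le X(2))
  qed simp
  have "Cauchy X"
    by (rule dist_minimizing_sequence_Cauchy[OF V(1) X(1) le lim])
  then obtain y where y: "X \<longlonglongrightarrow> y" by (auto simp: Cauchy_convergent_iff convergent_def)
  have "y \<in> V" using closed_sequentially[OF V(2)] X(1) y by blast
  moreover have "(\<lambda>i. (norm (x - X i))\<^sup>2) \<longlonglongrightarrow> (norm (x - y))\<^sup>2"
    by (intro tendsto_intros y)
  then have "(norm (x - y))\<^sup>2 = m" using lim by (rule LIMSEQ_unique)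
  then have "norm (x - y) \<le> norm (x - z)" if "z \<in> V" for z
    using le[OF that] by (auto intro: power2_le_imp_le[OF _ norm_ge_zero])
  ultimately show ?thesis by blast
qed

text \<open>Subtracting from \<open>x - y\<close> its component along \<open>v\<close>, with
  coefficient \<open>c\<close>, would shorten it by Pythagoras; minimality forces
  \<open>c = 0\<close>.\<close>

lemma closest_point_orth:
  fixes V :: "'a::chilbert_space set"
  assumes V: "csubspace V" and y: "y \<in> V" "\<And>z. z \<in> V \<Longrightarrow> norm (x - y) \<le> norm (x - z)"
  shows "x - y \<in> orth_complement V"
proof -
  have "cinner (x - y) v = 0" if v: "v \<in> V" for v
  proof (cases "v = 0")
    case False
    define c where "c = cinner (x - y) v / complex_of_real ((norm v)\<^sup>2)"
    have "cinner (x - y - c *\<^sub>C v) (c *\<^sub>C v) = 0"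
      using False by (simp add: cinner_diff_left cinner_scaleC_left cinner_scaleC_right cinner_self c_def)
    from norm_add_orth[OF this] have "(norm (x - y))\<^sup>2 = (norm (x - y - c *\<^sub>C v))\<^sup>2 + (norm (c *\<^sub>C v))\<^sup>2"
      by simp
    moreover have "norm (x - y) \<le> norm (x - (y + c *\<^sub>C v))"
      using V y(1) v by (intro y(2) csubspace_add csubspace_scale)
    then have "(norm (x - y))\<^sup>2 \<le> (norm (x - y - c *\<^sub>C v))\<^sup>2"
      by (intro power_mono) (auto simp: algebra_simps)
    ultimately have "norm (c *\<^sub>C v) = 0" by simp
    then show ?thesis using False by (simp add: norm_scaleC c_def)
  qed simp
  then show ?thesis by (simp add: orth_complement_def)
qed

lemma ortho_proj_unique:
  fixes V :: "'a::chilbert_space set"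
  assumes "csubspace V" "y \<in> V" "x - y \<in> orth_complement V"
  shows "ortho_proj V x = y"
  unfolding ortho_proj_def
proof (rule the_equality)
  fix z assume z: "z \<in> V \<and> x - z \<in> orth_complement V"
  then have "z - y \<in> V" using assms by (blast intro: csubspace_diff)
  moreover have "z - y \<in> orth_complement V"
    using z assms csubspace_diff[OF csubspace_orth_complement, of "x - y" V "x - z"] by auto
  ultimately have "cinner (z - y) (z - y) = 0" by (auto simp: orth_complement_def)
  then show "z = y" by simp
qed (use assms in auto)

lemma ortho_proj:
  fixes V :: "'a::chilbert_space set"
  assumes "csubspace V" "closed V"
  shows ortho_proj_in: "ortho_proj V x \<in> V"
    and diff_ortho_proj_in: "x - ortho_proj V x \<in> orth_complement V"
proof -
  obtain y where y: "y \<in> V" "\<And>z. z \<in> V \<Longrightarrow> norm (x - y) \<le> norm (x - z)"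
    using ex_closest_point[OF csubspace_imp_subspace] assms by blast
  have "ortho_proj V x = y"
    using assms y by (intro ortho_proj_unique closest_point_orth) auto
  with closest_point_orth[OF assms(1) y] y(1)
  show "ortho_proj V x \<in> V" "x - ortho_proj V x \<in> orth_complement V" by auto
qed

lemma ortho_proj_linear:
  fixes V :: "'a::chilbert_space set"
  assumes "csubspace V" "closed V"
  shows ortho_proj_add: "ortho_proj V (x + y) = ortho_proj V x + ortho_proj V y"
    and ortho_proj_scaleC: "ortho_proj V (c *\<^sub>C x) = c *\<^sub>C ortho_proj V x"
proof -
  show "ortho_proj V (x + y) = ortho_proj V x + ortho_proj V y"
    using csubspace_add[OF csubspace_orth_complement diff_ortho_proj_in[OF assms, of x] diff_ortho_proj_in[OF assms, of y]]
    by (intro ortho_proj_unique assms csubspace_add ortho_proj_in) (simp add: algebra_simps)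
  show "ortho_proj V (c *\<^sub>C x) = c *\<^sub>C ortho_proj V x"
    using csubspace_scale[OF csubspace_orth_complement diff_ortho_proj_in[OF assms, of x], of c]
    by (intro ortho_proj_unique assms csubspace_scale ortho_proj_in)
      (simp add: complex_vector.scale_right_diff_distrib)
qed

lemma norm_diff_ortho_proj_le:
  fixes V :: "'a::chilbert_space set"
  assumes "csubspace V" "closed V"
  shows "norm (x - ortho_proj V x) \<le> norm x"
proof -
  have "cinner (x - ortho_proj V x) (ortho_proj V x) = 0"
    using ortho_proj[OF assms, of x] by (auto simp: orth_complement_def)
  from norm_add_orth[OF this] show ?thesis
    by (auto intro: power2_le_imp_le[OF _ norm_ge_zero])
qed

lemma ortho_proj_orth_complement:
  fixes V :: "'a::chilbert_space set"
  assumes "csubspace V" "x \<in> orth_complement V"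
  shows "ortho_proj V x = 0"
proof (rule ortho_proj_unique)
  show "0 \<in> V" by (rule csubspace_0[OF assms(1)])
qed (use assms in simp_all)

text \<open>The orthogonal complement of the kernel inside \<open>V\<close> is a line, spanned by
  \<open>w\<close>. Linearity and the bound are asked only on \<open>V\<close>, since an operator on
  \<open>K\<close> has no usable values elsewhere.\<close>

lemma riesz_representation:
  fixes V :: "'a::chilbert_space set"
  assumes V: "csubspace V" "closed V"
    and add: "\<And>x y. x \<in> V \<Longrightarrow> y \<in> V \<Longrightarrow> f (x + y) = f x + f y"
    and scale: "\<And>c x. x \<in> V \<Longrightarrow> f (c *\<^sub>C x) = c * f x"
    and bound: "\<And>x. x \<in> V \<Longrightarrow> cmod (f x) \<le> C * norm x"
  shows "\<exists>z\<in>V. \<forall>x\<in>V. f x = cinner x z"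
proof -
  define N where "N = {x \<in> V. f x = 0}"
  have f0: "f 0 = 0" using add[of 0 0] csubspace_0[OF V(1)] by simp
  have diff: "f (x - y) = f x - f y" if "x \<in> V" "y \<in> V" for x y
    using add[of "x - y" y] csubspace_diff[OF V(1) that] that by simp
  have N: "csubspace N"
    using V(1) by (intro complex_vector.subspaceI)
      (auto simp: N_def f0 add scale csubspace_0 csubspace_add csubspace_scale)
  have "continuous_on V f"
  proof (rule continuous_on_iff[THEN iffD2], intro ballI allI impI)
    fix x and e :: real assume x: "x \<in> V" "e > 0"
    have "dist (f y) (f x) < e" if "y \<in> V" "dist y x < e / (\<bar>C\<bar> + 1)" for y
    proof -
      have "dist (f y) (f x) \<le> C * norm (y - x)"
        using bound[of "y - x"] that x V(1) by (simp add: dist_norm diff csubspace_diff)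
      also have "\<dots> \<le> (\<bar>C\<bar> + 1) * dist y x"
        unfolding dist_norm by (intro mult_right_mono) auto
      also have "\<dots> < e" using that by (simp add: field_simps)
      finally show ?thesis .
    qed
    then show "\<exists>d>0. \<forall>y\<in>V. dist y x < d \<longrightarrow> dist (f y) (f x) < e"
      using x by (intro exI[of _ "e / (\<bar>C\<bar> + 1)"]) auto
  qed
  then have "closed N"
    using continuous_closed_preimage_constant[of V f 0] V(2) by (simp add: N_def)
  note P = ortho_proj[OF N this]
  show ?thesis
  proof (cases "N = V")
    case True
    then have "\<forall>x\<in>V. f x = cinner x 0" by (auto simp: N_def)
    then show ?thesis using csubspace_0[OF V(1)] by blast
  next
    case False
    then obtain x0 where x0: "x0 \<in> V" "f x0 \<noteq> 0" by (auto simp: N_def)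
    define w where "w = x0 - ortho_proj N x0"
    have w: "w \<in> V" "f w \<noteq> 0"
      using P(1)[of x0] x0 V(1) by (auto simp: w_def N_def diff csubspace_diff)
    have "w \<noteq> 0" using w f0 by auto
    \<comment> \<open>The scalar is forced by the case \<open>x = w\<close>, where the right-hand
      side must be \<open>f w\<close>.\<close>
    have "f x = cinner x ((cnj (f w) / complex_of_real ((norm w)\<^sup>2)) *\<^sub>C w)" if x: "x \<in> V" for x
    proof -
      have "x - (f x / f w) *\<^sub>C w \<in> N"
        using w x V(1) by (auto simp: N_def diff scale csubspace_diff csubspace_scale)
      then have "cinner w (x - (f x / f w) *\<^sub>C w) = 0"
        using P(2)[of x0] by (auto simp: orth_complement_def w_def)
      then have "cinner (x - (f x / f w) *\<^sub>C w) w = 0"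
        by (simp add: cinner_eq_0_commute)
      then have "cinner x w = (f x / f w) * complex_of_real ((norm w)\<^sup>2)"
        by (simp add: cinner_diff_left cinner_scaleC_left cinner_self)
      then show ?thesis
        using w \<open>w \<noteq> 0\<close> by (simp add: cinner_scaleC_right)
    qed
    then show ?thesis using w V(1) by (blast intro: csubspace_scale)
  qed
qed


section \<open>Adjoints\<close>

lemma bounded_operatorI:
  assumes "\<And>x. x \<in> K \<Longrightarrow> A x \<in> K" "\<And>x. x \<notin> K \<Longrightarrow> A x = undefined"
    "\<And>x y. x \<in> K \<Longrightarrow> y \<in> K \<Longrightarrow> A (x + y) = A x + A y"
    "\<And>c x. x \<in> K \<Longrightarrow> A (c *\<^sub>C x) = c *\<^sub>C A x"
    "\<And>x. x \<in> K \<Longrightarrow> norm (A x) \<le> C * norm x"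
  shows "bounded_operator K A"
  unfolding bounded_operator_def
proof (intro conjI ballI allI)
  show "A \<in> K \<rightarrow>\<^sub>E K" by (rule PiE_I) (rule assms, assumption)+
  show "\<exists>C. \<forall>x\<in>K. norm (A x) \<le> C * norm x" using assms(5) by blast
qed (rule assms; assumption)+

lemma bounded_operatorD:
  assumes "bounded_operator K A"
  shows bounded_operator_in: "x \<in> K \<Longrightarrow> A x \<in> K"
    and bounded_operator_outside: "x \<notin> K \<Longrightarrow> A x = undefined"
    and bounded_operator_add: "x \<in> K \<Longrightarrow> y \<in> K \<Longrightarrow> A (x + y) = A x + A y"
    and bounded_operator_scaleC: "x \<in> K \<Longrightarrow> A (c *\<^sub>C x) = c *\<^sub>C A x"
proof -
  show "x \<in> K \<Longrightarrow> A x \<in> K" "x \<notin> K \<Longrightarrow> A x = undefined"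
    using assms PiE_arb[of A K "\<lambda>_. K" x] unfolding bounded_operator_def by blast+
  show "x \<in> K \<Longrightarrow> y \<in> K \<Longrightarrow> A (x + y) = A x + A y" "x \<in> K \<Longrightarrow> A (c *\<^sub>C x) = c *\<^sub>C A x"
    using assms unfolding bounded_operator_def by blast+
qed

lemma bounded_operator_bound:
  assumes "bounded_operator K A" obtains C where "C \<ge> 0" "\<And>x. x \<in> K \<Longrightarrow> norm (A x) \<le> C * norm x"
proof -
  obtain C where C: "\<And>x. x \<in> K \<Longrightarrow> norm (A x) \<le> C * norm x"
    using assms unfolding bounded_operator_def by blast
  have "norm (A x) \<le> \<bar>C\<bar> * norm x" if "x \<in> K" for x
    using C[OF that] mult_right_mono[OF abs_ge_self, of "norm x" C] by simp
  then show thesis by (intro that[of "\<bar>C\<bar>"]) auto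
qed

lemma bounded_operator_ext:
  assumes "bounded_operator K A" "bounded_operator K B" "\<And>x. x \<in> K \<Longrightarrow> A x = B x"
  shows "A = B"
  using assms by (intro ext) (metis bounded_operator_outside)

context
  fixes K :: "'a::chilbert_space set"
  assumes K: "csubspace K" "closed K"
begin

lemma bounded_operator_diff:
  assumes "bounded_operator K A" "x \<in> K" "y \<in> K" shows "A (x - y) = A x - A y"
  using bounded_operator_add[OF assms(1), of "x - y" y] assms csubspace_diff[OF K(1)] by simp

lemma bounded_operator_zero: "bounded_operator K A \<Longrightarrow> A 0 = 0"
  using bounded_operator_diff[of A 0 0] csubspace_0[OF K(1)] by simp

lemma bounded_operator_sum:
  "bounded_operator K A \<Longrightarrow> (\<And>i. i \<in> I \<Longrightarrow> f i \<in> K) \<Longrightarrow> A (\<Sum>i\<in>I. f i) = (\<Sum>i\<in>I. A (f i))"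
proof (induction I rule: infinite_finite_induct)
  case (insert i I)
  then show ?case
    using bounded_operator_add[of K A "f i" "sum f I"] csubspace_sum[OF K(1), of I f] by simp
qed (simp_all add: bounded_operator_zero)

text \<open>Justifies the \<open>THE\<close> in \<open>adjoint_on\<close>: Riesz gives existence,
  and two candidates are compared by testing against their own difference.\<close>

lemma adjoint_ex1:
  assumes A: "bounded_operator K A" and y: "y \<in> K"
  shows "\<exists>!z. z \<in> K \<and> (\<forall>x\<in>K. cinner (A x) y = cinner x z)"
proof (rule ex_ex1I)
  obtain C where C: "\<And>x. x \<in> K \<Longrightarrow> norm (A x) \<le> C * norm x"
    using bounded_operator_bound[OF A] by blast
  have "cmod (cinner (A x) y) \<le> (C * norm y) * norm x" if "x \<in> K" for x
    using norm_cinner_le[of "A x" y] mult_right_mono[OF C[OF that], of "norm y"] by (simp add: mult_ac)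
  then show "\<exists>z. z \<in> K \<and> (\<forall>x\<in>K. cinner (A x) y = cinner x z)"
    using riesz_representation[OF K, of "\<lambda>x. cinner (A x) y"] bounded_operatorD[OF A]
    by (auto simp: cinner_add_left cinner_scaleC_left Bex_def)
  fix z z' assume *: "z \<in> K \<and> (\<forall>x\<in>K. cinner (A x) y = cinner x z)" "z' \<in> K \<and> (\<forall>x\<in>K. cinner (A x) y = cinner x z')"
  then have "z - z' \<in> K" using csubspace_diff[OF K(1)] by blast
  with * have "cinner (z - z') (z - z') = 0" by (simp add: cinner_diff_right)
  then show "z = z'" by simp
qed

lemma adjoint_on_in: "bounded_operator K A \<Longrightarrow> y \<in> K \<Longrightarrow> adjoint_on K A y \<in> K"
  and cinner_adjoint_on: "bounded_operator K A \<Longrightarrow> x \<in> K \<Longrightarrow> y \<in> K \<Longrightarrow> cinner x (adjoint_on K A y) = cinner (A x) y"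
proof -
  have *: "adjoint_on K A y \<in> K \<and> (\<forall>x\<in>K. cinner (A x) y = cinner x (adjoint_on K A y))"
    if "bounded_operator K A" "y \<in> K" for y
    using theI'[OF adjoint_ex1[OF that]] unfolding adjoint_on_def restrict_apply'[OF that(2)] .
  show "bounded_operator K A \<Longrightarrow> y \<in> K \<Longrightarrow> adjoint_on K A y \<in> K"
    using * by blast
  show "cinner x (adjoint_on K A y) = cinner (A x) y" if "bounded_operator K A" "x \<in> K" "y \<in> K"
    using *[OF that(1,3)] that(2) by metis
qed

lemma cinner_adjoint_on_left:
  "bounded_operator K A \<Longrightarrow> x \<in> K \<Longrightarrow> y \<in> K \<Longrightarrow> cinner (adjoint_on K A y) x = cinner y (A x)"
  by (subst (1 2) cinner_commute) (simp only: cinner_adjoint_on)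

lemma adjoint_on_eqI:
  assumes "bounded_operator K A" "y \<in> K" "z \<in> K" "\<And>x. x \<in> K \<Longrightarrow> cinner (A x) y = cinner x z"
  shows "adjoint_on K A y = z"
proof -
  have "cinner (adjoint_on K A y - z) (adjoint_on K A y - z) = 0"
    using csubspace_diff[OF K(1) adjoint_on_in[OF assms(1,2)] assms(3)]
    by (simp add: cinner_diff_right[of _ _ z] cinner_adjoint_on[OF assms(1) _ assms(2)] assms(4))
  then show ?thesis by simp
qed

lemma bounded_operator_adjoint_on:
  assumes A: "bounded_operator K A" shows "bounded_operator K (adjoint_on K A)"
proof -
  obtain C where C: "C \<ge> 0" "\<And>x. x \<in> K \<Longrightarrow> norm (A x) \<le> C * norm x"
    using bounded_operator_bound[OF A] by blast
  show ?thesis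
  proof (rule bounded_operatorI)
    fix x y c assume x: "x \<in> K"
    show "adjoint_on K A x \<in> K" by (rule adjoint_on_in[OF A x])
    show "adjoint_on K A (x + y) = adjoint_on K A x + adjoint_on K A y" if "y \<in> K"
      using x that by (intro adjoint_on_eqI A csubspace_add[OF K(1)] adjoint_on_in)
        (simp_all add: cinner_add_right cinner_adjoint_on[OF A])
    show "adjoint_on K A (c *\<^sub>C x) = c *\<^sub>C adjoint_on K A x"
      using x by (intro adjoint_on_eqI A csubspace_scale[OF K(1)] adjoint_on_in)
        (simp_all add: cinner_scaleC_right cinner_adjoint_on[OF A])
    let ?z = "adjoint_on K A x"
    have z: "?z \<in> K" by (rule adjoint_on_in[OF A x])
    have "(norm ?z)\<^sup>2 = cmod (cinner ?z ?z)"
      unfolding cinner_self by (simp add: power2_eq_square norm_mult)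
    also have "cinner ?z ?z = cinner (A ?z) x" by (rule cinner_adjoint_on[OF A z x])
    also have "cmod \<dots> \<le> C * norm ?z * norm x"
      using norm_cinner_le[of "A ?z" x] mult_right_mono[OF C(2)[OF z], of "norm x"] by simp
    finally have "norm ?z * norm ?z \<le> norm ?z * (C * norm x)" by (simp add: power2_eq_square mult_ac)
    then show "norm ?z \<le> C * norm x"
      using C(1) by (cases "norm ?z = 0") (auto simp: mult_le_cancel_left)
  qed (simp add: adjoint_on_def)
qed

lemma adjoint_on_adjoint_on:
  assumes A: "bounded_operator K A" shows "adjoint_on K (adjoint_on K A) = A"
proof (rule bounded_operator_ext)
  show "bounded_operator K (adjoint_on K (adjoint_on K A))"
    by (intro bounded_operator_adjoint_on A)
  fix x assume "x \<in> K"
  then show "adjoint_on K (adjoint_on K A) x = A x"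
    by (intro adjoint_on_eqI bounded_operator_adjoint_on A)
      (simp_all add: bounded_operator_in[OF A] cinner_adjoint_on_left[OF A])
qed (rule A)

lemma bounded_operator_id: "bounded_operator K (\<lambda>x\<in>K. x)"
  using csubspace_add[OF K(1)] csubspace_scale[OF K(1)] by (intro bounded_operatorI[where C = 1]) auto

lemma adjoint_on_id: "adjoint_on K (\<lambda>x\<in>K. x) = (\<lambda>x\<in>K. x)"
proof (rule bounded_operator_ext)
  show "adjoint_on K (\<lambda>x\<in>K. x) x = (\<lambda>x\<in>K. x) x" if "x \<in> K" for x
    using that by (intro adjoint_on_eqI bounded_operator_id) auto
qed (intro bounded_operator_adjoint_on bounded_operator_id)+

lemma bounded_operator_plus:
  assumes A: "bounded_operator K A" and B: "bounded_operator K B"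
  shows "bounded_operator K (\<lambda>x\<in>K. A x + B x)"
proof -
  obtain C where C: "C \<ge> 0" "\<And>x. x \<in> K \<Longrightarrow> norm (A x) \<le> C * norm x"
    using bounded_operator_bound[OF A] by blast
  obtain D where D: "D \<ge> 0" "\<And>x. x \<in> K \<Longrightarrow> norm (B x) \<le> D * norm x"
    using bounded_operator_bound[OF B] by blast
  show ?thesis
  proof (rule bounded_operatorI[where C = "C + D"])
    show "norm ((\<lambda>x\<in>K. A x + B x) x) \<le> (C + D) * norm x" if "x \<in> K" for x
      using norm_triangle_ineq[of "A x" "B x"] C(2)[OF that] D(2)[OF that] that by (simp add: distrib_right)
  qed (use bounded_operatorD[OF A] bounded_operatorD[OF B] K(1) in
      \<open>auto simp: csubspace_add csubspace_scale scaleC_add_right\<close>)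
qed

lemma adjoint_on_plus:
  assumes A: "bounded_operator K A" and B: "bounded_operator K B"
  shows "adjoint_on K (\<lambda>x\<in>K. A x + B x) = (\<lambda>x\<in>K. adjoint_on K A x + adjoint_on K B x)"
proof (rule bounded_operator_ext)
  show "adjoint_on K (\<lambda>x\<in>K. A x + B x) x = (\<lambda>x\<in>K. adjoint_on K A x + adjoint_on K B x) x" if "x \<in> K" for x
    using that by (intro adjoint_on_eqI bounded_operator_plus A B)
      (auto simp: cinner_add_left cinner_add_right cinner_adjoint_on A B adjoint_on_in csubspace_add[OF K(1)])
qed (intro bounded_operator_adjoint_on bounded_operator_plus A B)+

lemma bounded_operator_scale:
  assumes A: "bounded_operator K A"
  shows "bounded_operator K (\<lambda>x\<in>K. c *\<^sub>C A x)"
proof -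
  obtain C where C: "C \<ge> 0" "\<And>x. x \<in> K \<Longrightarrow> norm (A x) \<le> C * norm x"
    using bounded_operator_bound[OF A] by blast
  show ?thesis
  proof (rule bounded_operatorI[where C = "cmod c * C"])
    show "norm ((\<lambda>x\<in>K. c *\<^sub>C A x) x) \<le> cmod c * C * norm x" if "x \<in> K" for x
      using mult_left_mono[OF C(2)[OF that], of "cmod c"] that by (simp add: norm_scaleC mult.assoc)
  qed (use bounded_operatorD[OF A] K(1) in
      \<open>auto simp: csubspace_add csubspace_scale scaleC_add_right scaleC_scaleC mult.commute\<close>)
qed

lemma adjoint_on_scale:
  assumes A: "bounded_operator K A"
  shows "adjoint_on K (\<lambda>x\<in>K. c *\<^sub>C A x) = (\<lambda>x\<in>K. cnj c *\<^sub>C adjoint_on K A x)"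
proof (rule bounded_operator_ext)
  show "adjoint_on K (\<lambda>x\<in>K. c *\<^sub>C A x) x = (\<lambda>x\<in>K. cnj c *\<^sub>C adjoint_on K A x) x" if "x \<in> K" for x
    using that by (intro adjoint_on_eqI bounded_operator_scale A)
      (auto simp: cinner_scaleC_left cinner_scaleC_right cinner_adjoint_on A adjoint_on_in csubspace_scale[OF K(1)])
qed (intro bounded_operator_adjoint_on bounded_operator_scale A)+

lemma bounded_operator_compose:
  assumes A: "bounded_operator K A" and B: "bounded_operator K B"
  shows "bounded_operator K (compose K A B)"
proof -
  obtain C where C: "C \<ge> 0" "\<And>x. x \<in> K \<Longrightarrow> norm (A x) \<le> C * norm x"
    using bounded_operator_bound[OF A] by blast
  obtain D where D: "D \<ge> 0" "\<And>x. x \<in> K \<Longrightarrow> norm (B x) \<le> D * norm x"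
    using bounded_operator_bound[OF B] by blast
  show ?thesis
  proof (rule bounded_operatorI[where C = "C * D"])
    show "norm (compose K A B x) \<le> (C * D) * norm x" if "x \<in> K" for x
      using C(2)[OF bounded_operator_in[OF B that]] mult_left_mono[OF D(2)[OF that] C(1)] that
      by (simp add: compose_def mult.assoc)
  qed (use bounded_operatorD[OF A] bounded_operatorD[OF B] K(1) in
      \<open>auto simp: csubspace_add csubspace_scale compose_def\<close>)
qed

lemma adjoint_on_compose:
  assumes A: "bounded_operator K A" and B: "bounded_operator K B"
  shows "adjoint_on K (compose K A B) = compose K (adjoint_on K B) (adjoint_on K A)"
proof (rule bounded_operator_ext)
  show "adjoint_on K (compose K A B) x = compose K (adjoint_on K B) (adjoint_on K A) x" if "x \<in> K" for x
    using that by (intro adjoint_on_eqI bounded_operator_compose A B)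
      (auto simp: compose_def cinner_adjoint_on A B adjoint_on_in bounded_operator_in[OF B])
qed (intro bounded_operator_adjoint_on bounded_operator_compose A B)+

end


section \<open>Operators dominated by a seminorm\<close>

definition op_commutator :: "'a::chilbert_space set \<Rightarrow> ('a \<Rightarrow> 'a) \<Rightarrow> ('a \<Rightarrow> 'a) \<Rightarrow> 'a \<Rightarrow> 'a"
  where "op_commutator K A B = (\<lambda>x\<in>K. A (B x) - B (A x))"

locale seminormed_subspace =
  fixes K :: "'a::chilbert_space set" and \<delta> :: "'a \<Rightarrow> real"
  assumes csubspace_K: "csubspace K" and closed_K: "closed K"
    and seminorm_triangle: "\<delta> (x + y) \<le> \<delta> x + \<delta> y"
    and seminorm_scaleC: "\<delta> (c *\<^sub>C x) = cmod c * \<delta> x"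
    and seminorm_le_norm: "\<delta> x \<le> norm x"
begin

lemmas K = csubspace_K closed_K

text \<open>Follows from the axioms, as \<open>0 = \<delta> (x - x)\<close> is at most
  \<open>2 * \<delta> x\<close>.\<close>

lemma seminorm_nonneg: "\<delta> x \<ge> 0"
  using seminorm_triangle[of x "-1 *\<^sub>C x"] seminorm_scaleC[of "-1" x] seminorm_scaleC[of 0 0] by simp

definition controlled :: "('a \<Rightarrow> 'a) \<Rightarrow> bool"
  where "controlled A \<longleftrightarrow> bounded_operator K A \<and> (\<exists>C\<ge>0. \<forall>x\<in>K. \<delta> (A x) \<le> C * \<delta> x)"

definition dominated :: "('a \<Rightarrow> 'a) \<Rightarrow> bool"
  where "dominated X \<longleftrightarrow> bounded_operator K X \<and> (\<exists>C\<ge>0. \<forall>x\<in>K. norm (X x) \<le> C * \<delta> x)"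

text \<open>These operators play the role of the algebra and the \<open>smoothing\<close> ones that
  of the ideal. Asking for the adjoint as well makes both classes closed under adjoints by
  definition.\<close>

definition preserving :: "('a \<Rightarrow> 'a) \<Rightarrow> bool"
  where "preserving A \<longleftrightarrow> controlled A \<and> controlled (adjoint_on K A)"

definition smoothing :: "('a \<Rightarrow> 'a) \<Rightarrow> bool"
  where "smoothing X \<longleftrightarrow> dominated X \<and> dominated (adjoint_on K X)"

lemma controlledI:
  assumes "bounded_operator K A" "C \<ge> 0" "\<And>x. x \<in> K \<Longrightarrow> \<delta> (A x) \<le> C * \<delta> x"
  shows "controlled A"
  using assms by (auto simp: controlled_def)

lemma dominatedI:
  assumes "bounded_operator K X" "C \<ge> 0" "\<And>x. x \<in> K \<Longrightarrow> norm (X x) \<le> C * \<delta> x"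
  shows "dominated X"
  using assms by (auto simp: dominated_def)

lemma controlled_id: "controlled (\<lambda>x\<in>K. x)"
  by (rule controlledI[where C = 1]) (auto simp: bounded_operator_id[OF K])

lemma controlled_plus:
  assumes "controlled A" "controlled B" shows "controlled (\<lambda>x\<in>K. A x + B x)"
proof -
  obtain C D where *: "C \<ge> 0" "D \<ge> 0" "\<And>x. x \<in> K \<Longrightarrow> \<delta> (A x) \<le> C * \<delta> x" "\<And>x. x \<in> K \<Longrightarrow> \<delta> (B x) \<le> D * \<delta> x"
    using assms unfolding controlled_def by blast
  show ?thesis
  proof (rule controlledI[where C = "C + D"])
    show "\<delta> ((\<lambda>x\<in>K. A x + B x) x) \<le> (C + D) * \<delta> x" if "x \<in> K" for x
      using seminorm_triangle[of "A x" "B x"] *(3,4)[OF that] that by (simp add: distrib_right)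
  qed (use assms * in \<open>auto simp: controlled_def bounded_operator_plus[OF K]\<close>)
qed

lemma controlled_scale:
  assumes "controlled A" shows "controlled (\<lambda>x\<in>K. c *\<^sub>C A x)"
proof -
  obtain C where *: "C \<ge> 0" "\<And>x. x \<in> K \<Longrightarrow> \<delta> (A x) \<le> C * \<delta> x"
    using assms unfolding controlled_def by blast
  show ?thesis
  proof (rule controlledI[where C = "cmod c * C"])
    show "\<delta> ((\<lambda>x\<in>K. c *\<^sub>C A x) x) \<le> cmod c * C * \<delta> x" if "x \<in> K" for x
      using mult_left_mono[OF *(2)[OF that], of "cmod c"] that by (simp add: seminorm_scaleC mult.assoc)
  qed (use assms * in \<open>auto simp: controlled_def bounded_operator_scale[OF K]\<close>)
qed

lemma controlled_compose:
  assumes "controlled A" "controlled B" shows "controlled (compose K A B)"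
proof -
  obtain C D where *: "C \<ge> 0" "D \<ge> 0" "\<And>x. x \<in> K \<Longrightarrow> \<delta> (A x) \<le> C * \<delta> x" "\<And>x. x \<in> K \<Longrightarrow> \<delta> (B x) \<le> D * \<delta> x"
    using assms unfolding controlled_def by blast
  show ?thesis
  proof (rule controlledI[where C = "C * D"])
    show "\<delta> (compose K A B x) \<le> C * D * \<delta> x" if "x \<in> K" for x
    proof -
      have "B x \<in> K" using assms that by (auto simp: controlled_def bounded_operator_in)
      from *(3)[OF this] mult_left_mono[OF *(4)[OF that] *(1)] show ?thesis
        using that by (simp add: compose_def mult.assoc)
    qed
  qed (use assms * in \<open>auto simp: controlled_def bounded_operator_compose[OF K]\<close>)
qed

lemma dominated_plus:
  assumes "dominated A" "dominated B" shows "dominated (\<lambda>x\<in>K. A x + B x)"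
proof -
  obtain C D where *: "C \<ge> 0" "D \<ge> 0" "\<And>x. x \<in> K \<Longrightarrow> norm (A x) \<le> C * \<delta> x" "\<And>x. x \<in> K \<Longrightarrow> norm (B x) \<le> D * \<delta> x"
    using assms unfolding dominated_def by blast
  show ?thesis
  proof (rule dominatedI[where C = "C + D"])
    show "norm ((\<lambda>x\<in>K. A x + B x) x) \<le> (C + D) * \<delta> x" if "x \<in> K" for x
      using norm_triangle_ineq[of "A x" "B x"] *(3,4)[OF that] that by (simp add: distrib_right)
  qed (use assms * in \<open>auto simp: dominated_def bounded_operator_plus[OF K]\<close>)
qed

lemma dominated_scale:
  assumes "dominated A" shows "dominated (\<lambda>x\<in>K. c *\<^sub>C A x)"
proof -
  obtain C where *: "C \<ge> 0" "\<And>x. x \<in> K \<Longrightarrow> norm (A x) \<le> C * \<delta> x"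
    using assms unfolding dominated_def by blast
  show ?thesis
  proof (rule dominatedI[where C = "cmod c * C"])
    show "norm ((\<lambda>x\<in>K. c *\<^sub>C A x) x) \<le> cmod c * C * \<delta> x" if "x \<in> K" for x
      using mult_left_mono[OF *(2)[OF that], of "cmod c"] that by (simp add: norm_scaleC mult.assoc)
  qed (use assms * in \<open>auto simp: dominated_def bounded_operator_scale[OF K]\<close>)
qed

lemma dominated_compose_bounded:
  assumes A: "bounded_operator K A" and X: "dominated X" shows "dominated (compose K A X)"
proof -
  obtain C where C: "C \<ge> 0" "\<And>x. x \<in> K \<Longrightarrow> norm (A x) \<le> C * norm x"
    using bounded_operator_bound[OF A] by blast
  obtain D where D: "D \<ge> 0" "\<And>x. x \<in> K \<Longrightarrow> norm (X x) \<le> D * \<delta> x"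
    using X unfolding dominated_def by blast
  show ?thesis
  proof (rule dominatedI[where C = "C * D"])
    show "norm (compose K A X x) \<le> C * D * \<delta> x" if "x \<in> K" for x
    proof -
      have "X x \<in> K" using X that by (auto simp: dominated_def bounded_operator_in)
      from C(2)[OF this] mult_left_mono[OF D(2)[OF that] C(1)] show ?thesis
        using that by (simp add: compose_def mult.assoc)
    qed
  qed (use A X C D in \<open>auto simp: dominated_def bounded_operator_compose[OF K]\<close>)
qed

lemma dominated_compose_controlled:
  assumes X: "dominated X" and A: "controlled A" shows "dominated (compose K X A)"
proof -
  obtain C where C: "C \<ge> 0" "\<And>x. x \<in> K \<Longrightarrow> \<delta> (A x) \<le> C * \<delta> x"
    using A unfolding controlled_def by blast
  obtain D where D: "D \<ge> 0" "\<And>x. x \<in> K \<Longrightarrow> norm (X x) \<le> D * \<delta> x"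
    using X unfolding dominated_def by blast
  show ?thesis
  proof (rule dominatedI[where C = "D * C"])
    show "norm (compose K X A x) \<le> D * C * \<delta> x" if "x \<in> K" for x
    proof -
      have "A x \<in> K" using A that by (auto simp: controlled_def bounded_operator_in)
      from D(2)[OF this] mult_left_mono[OF C(2)[OF that] D(1)] show ?thesis
        using that by (simp add: compose_def mult.assoc)
    qed
  qed (use A X C D in \<open>auto simp: dominated_def controlled_def bounded_operator_compose[OF K]\<close>)
qed

lemma preserving_bounded: "preserving A \<Longrightarrow> bounded_operator K A"
  by (simp add: preserving_def controlled_def)

lemma smoothing_bounded: "smoothing X \<Longrightarrow> bounded_operator K X"
  by (simp add: smoothing_def dominated_def)

lemma preserving_id: "preserving (\<lambda>x\<in>K. x)"
  by (simp add: preserving_def controlled_id adjoint_on_id[OF K])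

lemma preserving_plus: "preserving A \<Longrightarrow> preserving B \<Longrightarrow> preserving (\<lambda>x\<in>K. A x + B x)"
  using adjoint_on_plus[OF K preserving_bounded preserving_bounded, of A B]
  by (simp add: preserving_def controlled_plus)

lemma preserving_scale: "preserving A \<Longrightarrow> preserving (\<lambda>x\<in>K. c *\<^sub>C A x)"
  using adjoint_on_scale[OF K preserving_bounded, of A c]
  by (simp add: preserving_def controlled_scale)

lemma preserving_compose: "preserving A \<Longrightarrow> preserving B \<Longrightarrow> preserving (compose K A B)"
  using adjoint_on_compose[OF K preserving_bounded preserving_bounded, of A B]
  by (simp add: preserving_def controlled_compose)

lemma preserving_adjoint: "preserving A \<Longrightarrow> preserving (adjoint_on K A)"
  using adjoint_on_adjoint_on[OF K preserving_bounded, of A]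
  by (simp add: preserving_def)

lemma smoothing_plus: "smoothing A \<Longrightarrow> smoothing B \<Longrightarrow> smoothing (\<lambda>x\<in>K. A x + B x)"
  using adjoint_on_plus[OF K smoothing_bounded smoothing_bounded, of A B]
  by (simp add: smoothing_def dominated_plus)

lemma smoothing_scale: "smoothing A \<Longrightarrow> smoothing (\<lambda>x\<in>K. c *\<^sub>C A x)"
  using adjoint_on_scale[OF K smoothing_bounded, of A c]
  by (simp add: smoothing_def dominated_scale)

lemma smoothing_adjoint: "smoothing A \<Longrightarrow> smoothing (adjoint_on K A)"
  using adjoint_on_adjoint_on[OF K smoothing_bounded, of A]
  by (simp add: smoothing_def)

text \<open>\<open>A X\<close> needs only boundedness of \<open>A\<close>, but its adjoint
  \<open>X* A*\<close> needs \<open>A*\<close> to be bounded for \<open>\<delta>\<close>. The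
  mirrored rule below uses the other half of \<open>preserving\<close>.\<close>

lemma smoothing_compose_left:
  assumes A: "preserving A" and X: "smoothing X" shows "smoothing (compose K A X)"
  using A X adjoint_on_compose[OF K preserving_bounded[OF A] smoothing_bounded[OF X]]
  by (simp add: smoothing_def preserving_def preserving_bounded[OF A] dominated_compose_bounded
      dominated_compose_controlled)

lemma smoothing_compose_right:
  assumes A: "preserving A" and X: "smoothing X" shows "smoothing (compose K X A)"
  using A X adjoint_on_compose[OF K smoothing_bounded[OF X] preserving_bounded[OF A]]
  by (simp add: smoothing_def preserving_def preserving_bounded[OF preserving_adjoint[OF A]]
      dominated_compose_bounded dominated_compose_controlled)

lemma op_commutator_eq:
  "op_commutator K A B = (\<lambda>x\<in>K. compose K A B x + (\<lambda>x\<in>K. -1 *\<^sub>C compose K B A x) x)"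
  by (auto simp: op_commutator_def compose_def fun_eq_iff)

lemma bounded_operator_op_commutator:
  "bounded_operator K A \<Longrightarrow> bounded_operator K B \<Longrightarrow> bounded_operator K (op_commutator K A B)"
  unfolding op_commutator_eq
  by (intro bounded_operator_plus bounded_operator_scale bounded_operator_compose K)

lemma adjoint_on_op_commutator:
  assumes "bounded_operator K A" "bounded_operator K B"
  shows "adjoint_on K (op_commutator K A B) = op_commutator K (adjoint_on K B) (adjoint_on K A)"
  unfolding op_commutator_eq using assms
  by (simp only: adjoint_on_plus[OF K] adjoint_on_scale[OF K] adjoint_on_compose[OF K]
      bounded_operator_plus[OF K] bounded_operator_scale[OF K] bounded_operator_compose[OF K]
      complex_cnj_minus complex_cnj_one)

lemma smoothing_op_commutator_swap:
  assumes "smoothing (op_commutator K A B)" shows "smoothing (op_commutator K B A)"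
proof -
  have "op_commutator K B A = (\<lambda>x\<in>K. -1 *\<^sub>C op_commutator K A B x)"
    by (auto simp: op_commutator_def fun_eq_iff)
  then show ?thesis using smoothing_scale[OF assms, of "-1"] by simp
qed

text \<open>\<open>[A, B]* = [B*, A*]\<close>, and exchanging the two entries costs only a
  sign.\<close>

lemma smoothing_op_commutator_adjoint:
  assumes "bounded_operator K A" "bounded_operator K B" "smoothing (op_commutator K A B)"
  shows "smoothing (op_commutator K (adjoint_on K A) (adjoint_on K B))"
  using smoothing_adjoint[OF assms(3)]
  by (intro smoothing_op_commutator_swap[of "adjoint_on K B"])
    (simp add: adjoint_on_op_commutator[OF assms(1,2)])

lemma smoothing_zero: "smoothing (\<lambda>x\<in>K. 0)"
proof -
  have b: "bounded_operator K (\<lambda>x\<in>K. 0)"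
    using bounded_operator_scale[OF K bounded_operator_id[OF K], of 0]
    by (simp add: restrict_def cong: if_cong)
  have "adjoint_on K (\<lambda>x\<in>K. 0) x = 0" if "x \<in> K" for x
    using that by (intro adjoint_on_eqI[OF K b]) (auto simp: csubspace_0[OF csubspace_K])
  then show ?thesis
    unfolding smoothing_def
    by (intro conjI dominatedI[where C = 0] b bounded_operator_adjoint_on[OF K]) auto
qed

lemma smoothing_op_commutator_id:
  assumes "bounded_operator K B" shows "smoothing (op_commutator K (\<lambda>x\<in>K. x) B)"
proof -
  have "op_commutator K (\<lambda>x\<in>K. x) B = (\<lambda>x\<in>K. 0)"
    using bounded_operator_in[OF assms] by (auto simp: op_commutator_def fun_eq_iff)
  then show ?thesis by (simp add: smoothing_zero)
qed

lemma smoothing_op_commutator_plus: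
  assumes "smoothing (op_commutator K A B)" "smoothing (op_commutator K A' B)"
    and b: "bounded_operator K A" "bounded_operator K A'" "bounded_operator K B"
  shows "smoothing (op_commutator K (\<lambda>x\<in>K. A x + A' x) B)"
proof -
  have "op_commutator K (\<lambda>x\<in>K. A x + A' x) B = (\<lambda>x\<in>K. op_commutator K A B x + op_commutator K A' B x)"
    using b by (auto simp: op_commutator_def fun_eq_iff bounded_operator_in bounded_operator_add)
  then show ?thesis using smoothing_plus[OF assms(1,2)] by simp
qed

lemma smoothing_op_commutator_scale:
  assumes "smoothing (op_commutator K A B)" and b: "bounded_operator K A" "bounded_operator K B"
  shows "smoothing (op_commutator K (\<lambda>x\<in>K. c *\<^sub>C A x) B)"
proof -
  have "op_commutator K (\<lambda>x\<in>K. c *\<^sub>C A x) B = (\<lambda>x\<in>K. c *\<^sub>C op_commutator K A B x)"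
    using b by (auto simp: op_commutator_def fun_eq_iff bounded_operator_in bounded_operator_scaleC
        complex_vector.scale_right_diff_distrib)
  then show ?thesis using smoothing_scale[OF assms(1)] by simp
qed

text \<open>Leibniz rule \<open>[A A', B] = A [A', B] + [A, B] A'\<close>. The factors
  \<open>A\<close> and \<open>A'\<close> end up next to a smoothing commutator, hence must be
  preserving; \<open>B\<close> occurs only inside commutators.\<close>

lemma smoothing_op_commutator_compose:
  assumes "smoothing (op_commutator K A B)" "smoothing (op_commutator K A' B)"
    and p: "preserving A" "preserving A'" "bounded_operator K B"
  shows "smoothing (op_commutator K (compose K A A') B)"
proof -
  note b = preserving_bounded[OF p(1)] preserving_bounded[OF p(2)] p(3)
  have "op_commutator K (compose K A A') B =
      (\<lambda>x\<in>K. compose K A (op_commutator K A' B) x + compose K (op_commutator K A B) A' x)"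
    using b by (auto simp: op_commutator_def compose_def fun_eq_iff bounded_operator_in bounded_operator_diff[OF K])
  then show ?thesis
    using smoothing_plus[OF smoothing_compose_left[OF p(1) assms(2)] smoothing_compose_right[OF p(2) assms(1)]]
    by simp
qed

section \<open>Commutators in a star-algebra whose generators commute up to smoothing
  operators\<close>

context
  fixes G :: "('a \<Rightarrow> 'a) set"
  assumes G: "\<And>A. A \<in> G \<Longrightarrow> preserving A"
    and comm: "\<And>A B. A \<in> G \<Longrightarrow> B \<in> G \<Longrightarrow> smoothing (op_commutator K A B)"
    and cross_comm: "\<And>A B. A \<in> G \<Longrightarrow> B \<in> G \<Longrightarrow> smoothing (op_commutator K (adjoint_on K A) B)"
begin

lemma preserving_star_algebra: "A \<in> star_algebra K G \<Longrightarrow> preserving A"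
  by (induction rule: star_algebra.induct)
    (rule G preserving_id preserving_plus preserving_scale preserving_compose preserving_adjoint; assumption)+

lemma bounded_star_algebra: "A \<in> star_algebra K G \<Longrightarrow> bounded_operator K A"
  by (intro preserving_bounded preserving_star_algebra)

text \<open>Both claims go through the induction together, because the adjoint case exchanges them.
  The second entry remains a generator here and is freed by the next induction.\<close>

lemma smoothing_op_commutator_generator:
  assumes "A \<in> star_algebra K G" "B \<in> G"
  shows "smoothing (op_commutator K A B) \<and> smoothing (op_commutator K (adjoint_on K A) B)"
  using assms(1)
proof (induction rule: star_algebra.induct)
  case (generator A)
  then show ?case using assms comm cross_comm by blast
next
  case identity
  show ?case
    unfolding adjoint_on_id[OF K]
    by (intro conjI smoothing_op_commutator_id preserving_bounded[OF G[OF assms(2)]])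
next
  case (add A A')
  note b = bounded_star_algebra[OF add.hyps(1)] bounded_star_algebra[OF add.hyps(2)] preserving_bounded[OF G[OF assms(2)]]
  show ?case
    unfolding adjoint_on_plus[OF K b(1,2)]
    by (intro conjI smoothing_op_commutator_plus b bounded_operator_adjoint_on[OF K]) (use add.IH in auto)
next
  case (scale A c)
  note b = bounded_star_algebra[OF scale.hyps] preserving_bounded[OF G[OF assms(2)]]
  show ?case
    unfolding adjoint_on_scale[OF K b(1)]
    by (intro conjI smoothing_op_commutator_scale b bounded_operator_adjoint_on[OF K]) (use scale.IH in auto)
next
  case (mult A A')
  note p = preserving_star_algebra[OF mult.hyps(1)] preserving_star_algebra[OF mult.hyps(2)]
  show ?case
    unfolding adjoint_on_compose[OF K preserving_bounded[OF p(1)] preserving_bounded[OF p(2)]]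
    by (intro conjI smoothing_op_commutator_compose preserving_adjoint p preserving_bounded[OF G[OF assms(2)]])
      (use mult.IH in auto)
next
  case (adjoint A)
  then show ?case by (simp add: adjoint_on_adjoint_on[OF K bounded_star_algebra])
qed

lemma smoothing_op_commutator_star_algebra:
  assumes "B \<in> star_algebra K G" "A \<in> star_algebra K G"
  shows "smoothing (op_commutator K A B)"
  using assms
proof (induction arbitrary: A rule: star_algebra.induct)
  case (generator B)
  then show ?case using smoothing_op_commutator_generator by blast
next
  case identity
  then show ?case
    by (rule smoothing_op_commutator_swap[OF smoothing_op_commutator_id[OF bounded_star_algebra]])
next
  case (add B B')
  then show ?case
    by (intro smoothing_op_commutator_swap[OF smoothing_op_commutator_plus] smoothing_op_commutator_swap[of A]
        bounded_star_algebra) auto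
next
  case (scale B c)
  then show ?case
    by (intro smoothing_op_commutator_swap[OF smoothing_op_commutator_scale] smoothing_op_commutator_swap[of A]
        bounded_star_algebra) auto
next
  case (mult B B')
  then show ?case
    by (intro smoothing_op_commutator_swap[OF smoothing_op_commutator_compose] smoothing_op_commutator_swap[of A]
        bounded_star_algebra preserving_star_algebra) auto
next
  case (adjoint B)
  \<comment> \<open>The induction hypothesis is used for \<open>A*\<close> in place of
    \<open>A\<close>: taking adjoints in \<open>[A*, B]\<close> produces \<open>[A**, B*]\<close>,
    which is \<open>[A, B*]\<close>.\<close>
  have "smoothing (op_commutator K (adjoint_on K (adjoint_on K A)) (adjoint_on K B))"
    by (intro smoothing_op_commutator_adjoint adjoint.IH star_algebra.adjoint adjoint.prems
        bounded_star_algebra adjoint.hyps)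
  then show ?case by (simp add: adjoint_on_adjoint_on[OF K bounded_star_algebra[OF adjoint.prems]])
qed

theorem smoothing_commutator_ideal:
  assumes "X \<in> commutator_ideal K (star_algebra K G)" shows "smoothing X"
  using assms
proof (induction rule: commutator_ideal.induct)
  case (commutator A B)
  show ?case
    by (rule smoothing_op_commutator_star_algebra[OF commutator(2,1), unfolded op_commutator_def])
next
  case (add X Y)
  then show ?case by (intro smoothing_plus)
next
  case (scale X c)
  then show ?case by (intro smoothing_scale)
next
  case (mult_left A X)
  then show ?case by (intro smoothing_compose_left preserving_star_algebra)
next
  case (mult_right A X)
  then show ?case by (intro smoothing_compose_right preserving_star_algebra)
qed

end

end


section \<open>Finite orthonormal families\<close>

definition orthonormal :: "'a::complex_inner set \<Rightarrow> bool"
  where "orthonormal B \<longleftrightarrow> (\<forall>b\<in>B. \<forall>b'\<in>B. cinner b b' = (if b = b' then 1 else 0))"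

definition fourier_sum :: "'a::complex_inner set \<Rightarrow> 'a \<Rightarrow> 'a"
  where "fourier_sum B x = (\<Sum>b\<in>B. cinner x b *\<^sub>C b)"

lemma linear_fourier_sum: "Vector_Spaces.linear scaleC scaleC (fourier_sum (B :: 'a::complex_inner set))"
  by (intro Vector_Spaces.linear.intro complex_vector.vector_space_axioms module_hom.intro
      complex_vector.module_axioms module_hom_axioms.intro)
    (simp_all add: fourier_sum_def cinner_add_left cinner_scaleC_left scaleC_add_left sum.distrib
      complex_vector.scale_sum_right scaleC_scaleC)

lemma cinner_fourier_sum:
  assumes "finite B" "orthonormal B" "b \<in> B"
  shows "cinner (fourier_sum B x) b = cinner x b"
proof -
  have "cinner (fourier_sum B x) b = (\<Sum>b'\<in>B. if b' = b then cinner x b' else 0)"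
    unfolding fourier_sum_def cinner_sum_left cinner_scaleC_left
    using assms by (intro sum.cong) (auto simp: orthonormal_def)
  then show ?thesis using assms by simp
qed

lemma cinner_diff_fourier_sum:
  "finite B \<Longrightarrow> orthonormal B \<Longrightarrow> b \<in> B \<Longrightarrow> cinner (x - fourier_sum B x) b = 0"
  by (simp add: cinner_diff_left cinner_fourier_sum)

lemma fourier_sum_in_span: "fourier_sum B x \<in> cspan B"
  unfolding fourier_sum_def
  by (intro complex_vector.span_sum complex_vector.span_scale complex_vector.span_base)

lemma cinner_fourier_sum_orth: "\<forall>b\<in>B. cinner y b = 0 \<Longrightarrow> cinner (fourier_sum B x) y = 0"
  unfolding fourier_sum_def cinner_sum_left cinner_scaleC_left
  by (intro sum.neutral ballI) (simp add: cinner_eq_0_commute[of _ y])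

lemma orthonormal_norm: "orthonormal B \<Longrightarrow> b \<in> B \<Longrightarrow> norm b = 1"
  using cinner_self[of b] by (auto simp: orthonormal_def power2_eq_1_iff simp flip: of_real_power)
    (smt (verit) norm_ge_zero)

text \<open>If only the trivial combination of \<open>U\<close> is orthogonal to \<open>B\<close>,
  then \<open>U\<close> is independent and the projection onto the span of \<open>B\<close> is
  injective on the span of \<open>U\<close>. Both the count of singular values and the finiteness of
  the kernel of \<open>D\<close> rest on this.\<close>

lemma card_le_orthonormal:
  assumes U: "finite U" and B: "finite B" "orthonormal B"
    and inj: "\<And>u v. \<forall>b\<in>B. cinner (\<Sum>v\<in>U. u v *\<^sub>C v) b = 0 \<Longrightarrow> v \<in> U \<Longrightarrow> u v = 0"
  shows "card U \<le> card B"
proof -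
  interpret P: Vector_Spaces.linear scaleC scaleC "fourier_sum B"
    by (rule linear_fourier_sum)
  have indep: "\<not> complex_vector.dependent U"
    unfolding complex_vector.dependent_finite[OF U]
  proof safe
    fix u v assume "(\<Sum>v\<in>U. u v *\<^sub>C v) = 0" "v \<in> U" "u v \<noteq> 0"
    then show False using inj[of u v] by simp
  qed
  have "x = 0" if "x \<in> cspan U" "fourier_sum B x = 0" for x
  proof -
    obtain u where u: "x = (\<Sum>v\<in>U. u v *\<^sub>C v)"
      using \<open>x \<in> cspan U\<close> complex_vector.span_finite[OF U] by auto
    have "cinner x b = 0" if "b \<in> B" for b
      using cinner_fourier_sum[OF B that, of x] \<open>fourier_sum B x = 0\<close> by simp
    then have "u v = 0" if "v \<in> U" for v
      using inj[of u, OF _ that] u by blast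
    then show "x = 0" by (simp add: u)
  qed
  then have inj_on: "inj_on (fourier_sum B) (cspan U)"
    using P.inj_on_iff_eq_0[folded csubspace_def, OF complex_vector.subspace_span, of U] by blast
  have "\<not> complex_vector.dependent (fourier_sum B ` U)"
    by (rule P.independent_injective_image[folded cspan_def, OF indep inj_on])
  then have "card (fourier_sum B ` U) \<le> card B"
    using fourier_sum_in_span by (intro conjunct2[OF complex_vector.independent_span_bound[OF B(1)]]) auto
  moreover have "inj_on (fourier_sum B) U"
    using inj_on by (rule inj_on_subset) (auto intro: complex_vector.span_base)
  ultimately show ?thesis by (simp add: card_image)
qed

text \<open>By induction the set is a Minkowski sum of compact discs \<open>{c b}\<close>; it
  supplies the finite nets for total boundedness.\<close>

lemma compact_bounded_combinations:
  assumes "finite B"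
  shows "compact ((\<lambda>u. \<Sum>b\<in>B. u b *\<^sub>C b) ` {u. \<forall>b\<in>B. cmod (u b) \<le> R} :: 'a::complex_inner set)"
  using assms
proof (induction B)
  case (insert b B)
  let ?S = "\<lambda>B. (\<lambda>u. \<Sum>b\<in>B. u b *\<^sub>C b) ` {u. \<forall>b\<in>B. cmod (u b) \<le> R}"
  have "?S (insert b B) = {x + y |x y. x \<in> (\<lambda>c. c *\<^sub>C b) ` cball 0 R \<and> y \<in> ?S B}" (is "_ = ?T")
  proof
    show "?S (insert b B) \<subseteq> ?T" using insert.hyps by fastforce
    show "?T \<subseteq> ?S (insert b B)"
    proof clarify
      fix c :: complex and u :: "'a \<Rightarrow> complex" assume *: "c \<in> cball 0 R" "\<forall>b\<in>B. cmod (u b) \<le> R"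
      have "c *\<^sub>C b + (\<Sum>b\<in>B. u b *\<^sub>C b) = (\<Sum>b'\<in>insert b B. (u(b := c)) b' *\<^sub>C b')"
      proof -
        have "(\<Sum>b'\<in>B. (u(b := c)) b' *\<^sub>C b') = (\<Sum>b\<in>B. u b *\<^sub>C b)"
          using insert.hyps by (intro sum.cong) auto
        then show ?thesis using insert.hyps by simp
      qed
      then show "c *\<^sub>C b + (\<Sum>b\<in>B. u b *\<^sub>C b) \<in> ?S (insert b B)"
        using * by (intro image_eqI[of _ _ "u(b := c)"]) auto
    qed
  qed
  moreover have "compact ((\<lambda>c. c *\<^sub>C b) ` cball 0 R)"
    by (intro compact_continuous_image linear_continuous_on bounded_linear_scaleC_left) simp
  ultimately show ?case using compact_sums[OF _ insert.IH] by simp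
qed simp

lemma sum_orthogonal:
  fixes v :: "'i \<Rightarrow> 'a::complex_inner"
  assumes "\<And>s t. s \<in> F \<Longrightarrow> t \<in> F \<Longrightarrow> s \<noteq> t \<Longrightarrow> cinner (v s) (v t) = 0"
  shows "cinner (\<Sum>s\<in>F. a s *\<^sub>C v s) (\<Sum>s\<in>F. v s) = (\<Sum>s\<in>F. a s * complex_of_real ((norm (v s))\<^sup>2))"
proof (cases "finite F")
  case True
  have "cinner (\<Sum>s\<in>F. a s *\<^sub>C v s) (\<Sum>s\<in>F. v s) = (\<Sum>s\<in>F. \<Sum>t\<in>F. if t = s then a s * complex_of_real ((norm (v s))\<^sup>2) else 0)"
    unfolding cinner_sum_left cinner_sum_right
    by (intro sum.cong refl) (simp add: cinner_scaleC_left cinner_self assms)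
  then show ?thesis using True by simp
qed simp


section \<open>Schatten classes\<close>

text \<open>\<open>\<B> m\<close> need not lie in \<open>K\<close>; only the projection onto its
  span has to map \<open>K\<close> into itself. So one family, a basis of the polynomials of degree
  below \<open>m\<close>, can serve for every \<open>M\<close>.\<close>

locale filtered_subspace = seminormed_subspace K \<delta>
  for K :: "'a::chilbert_space set" and \<delta> +
  fixes \<B> :: "nat \<Rightarrow> 'a set" and c :: real and d :: nat
  assumes finite_basis: "finite (\<B> m)"
    and orthonormal_basis: "orthonormal (\<B> m)"
    and fourier_sum_in: "x \<in> K \<Longrightarrow> fourier_sum (\<B> m) x \<in> K"
    and seminorm_decay: "x \<in> K \<Longrightarrow> \<forall>b\<in>\<B> m. cinner x b = 0 \<Longrightarrow> \<delta> x \<le> norm x / real (Suc m)"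
    and card_basis: "real (card (\<B> m)) \<le> c * real (Suc m) ^ d"
begin

lemma dominated_decay:
  assumes "\<And>x. x \<in> K \<Longrightarrow> norm (X x) \<le> C * \<delta> x" "C \<ge> 0" "x \<in> K" "\<forall>b\<in>\<B> m. cinner x b = 0"
  shows "norm (X x) \<le> C / real (Suc m) * norm x"
  using assms(1)[OF assms(3)] mult_left_mono[OF seminorm_decay[OF assms(3,4)] assms(2)] by simp

text \<open>Up to \<open>C / (m + 1)\<close> the image of the unit ball lies in a bounded part of
  the span of \<open>\<B> m\<close>, hence is totally bounded. The three errors \<open>e / 3\<close>
  come from the closure, from the projection and from the finite net.\<close>

lemma compact_operator_smoothing:
  assumes "smoothing X" shows "compact_operator K X"
proof -
  let ?S = "X ` (K \<inter> cball 0 1)"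
  have X: "bounded_operator K X" using smoothing_bounded[OF assms] .
  obtain C where C: "C \<ge> 0" "\<And>x. x \<in> K \<Longrightarrow> norm (adjoint_on K X x) \<le> C * \<delta> x"
    using assms unfolding smoothing_def dominated_def by blast
  obtain R where R: "R \<ge> 0" "\<And>x. x \<in> K \<Longrightarrow> norm (X x) \<le> R * norm x"
    using bounded_operator_bound[OF X] by blast
  \<comment> \<open>the bound for \<open>X\<^sup>*\<close> controls the part of the range of \<open>X\<close> that is orthogonal to \<open>\<B> m\<close>\<close>
  have tail: "norm (X x - fourier_sum (\<B> m) (X x)) \<le> C / real (Suc m)" if x: "x \<in> K" "norm x \<le> 1" for x m
  proof -
    define w where "w = X x - fourier_sum (\<B> m) (X x)"
    have Xx: "X x \<in> K" using bounded_operator_in[OF X x(1)] .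
    have w: "w \<in> K" unfolding w_def by (intro csubspace_diff csubspace_K fourier_sum_in Xx)
    have orth: "\<forall>b\<in>\<B> m. cinner w b = 0"
      by (auto simp: w_def cinner_diff_fourier_sum finite_basis orthonormal_basis)
    have "(norm w)\<^sup>2 = cmod (cinner w w)"
      unfolding cinner_self by (simp add: norm_power)
    also have "cinner w w = cinner (X x) w"
      using cinner_fourier_sum_orth[OF orth, of "X x"] by (subst (1) w_def) (simp add: cinner_diff_left)
    also have "\<dots> = cinner x (adjoint_on K X w)"
      by (rule cinner_adjoint_on[OF K X x(1) w, symmetric])
    also have "cmod \<dots> \<le> norm x * norm (adjoint_on K X w)" by (rule norm_cinner_le)
    also have "\<dots> \<le> 1 * (C / real (Suc m) * norm w)"
      using x(2) C(1) by (intro mult_mono dominated_decay[OF C(2,1) w orth]) auto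
    finally have "norm w * norm w \<le> C / real (Suc m) * norm w" by (simp add: power2_eq_square)
    then show ?thesis
      using C(1) unfolding w_def[symmetric] mult_le_cancel_right by (cases "w = 0") auto
  qed
  have "\<exists>k. finite k \<and> closure ?S \<subseteq> (\<Union>x\<in>k. ball x e)" if "e > 0" for e
  proof -
    obtain m where m: "C / real (Suc m) < e / 3"
    proof -
      obtain m where "3 * C / e < real m" using reals_Archimedean2 by blast
      also have "real m < real (Suc m)" by simp
      finally have "C / real (Suc m) < e / 3"
        using \<open>e > 0\<close> by (simp add: field_simps del: of_nat_Suc)
      then show thesis by (rule that)
    qed
    let ?D = "(\<lambda>u. \<Sum>b\<in>\<B> m. u b *\<^sub>C b) ` {u. \<forall>b\<in>\<B> m. cmod (u b) \<le> R}"
    have "compact ?D" by (rule compact_bounded_combinations[OF finite_basis])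
    then have "\<forall>\<epsilon>>0. \<exists>k. finite k \<and> ?D \<subseteq> (\<Union>x\<in>k. ball x \<epsilon>)"
      by (rule conjunct2[OF compact_eq_totally_bounded[THEN iffD1]])
    moreover have "e / 3 > 0" using that by simp
    ultimately obtain k where k: "finite k" "?D \<subseteq> (\<Union>x\<in>k. ball x (e / 3))" by blast
    have "closure ?S \<subseteq> (\<Union>x\<in>k. ball x e)"
    proof
      fix y assume "y \<in> closure ?S"
      then obtain x where x: "x \<in> K" "norm x \<le> 1" "dist (X x) y < e / 3"
        unfolding closure_approachable using \<open>e / 3 > 0\<close> by (auto dest!: spec[of _ "e / 3"])
      have "cmod (cinner (X x) b) \<le> R" if "b \<in> \<B> m" for b
        using norm_cinner_le[of "X x" b] R(2)[OF x(1)] mult_left_mono[OF x(2) R(1)]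
          orthonormal_norm[OF orthonormal_basis that] by simp
      then have "fourier_sum (\<B> m) (X x) \<in> ?D"
        unfolding fourier_sum_def by (intro image_eqI[of _ _ "\<lambda>b. cinner (X x) b"]) auto
      then obtain z where z: "z \<in> k" "dist z (fourier_sum (\<B> m) (X x)) < e / 3"
        using k(2) by auto
      have "dist (fourier_sum (\<B> m) (X x)) (X x) < e / 3"
        using le_less_trans[OF tail[OF x(1,2)] m] by (simp add: dist_norm norm_minus_commute)
      then have "dist z y < e"
        using z(2) x(3) dist_triangle[of z y "X x"] dist_triangle[of z "X x" "fourier_sum (\<B> m) (X x)"] by linarith
      then show "y \<in> (\<Union>x\<in>k. ball x e)" using z(1) by auto
    qed
    with k(1) show ?thesis by blast
  qed
  then have "compact (closure ?S)"
    by (simp add: compact_eq_totally_bounded complete_eq_closed)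
  then show ?thesis using X by (simp add: compact_operator_def)
qed

section \<open>Counting the singular values of a dominated operator\<close>

context
  fixes X :: "'a \<Rightarrow> 'a" and C :: real
  assumes X: "bounded_operator K X" and C: "C \<ge> 0"
    and X_le: "\<And>x. x \<in> K \<Longrightarrow> norm (X x) \<le> C * \<delta> x"
begin

definition singular_space :: "real \<Rightarrow> 'a set"
  where "singular_space s = {x \<in> K. adjoint_on K X (X x) = complex_of_real (s\<^sup>2) *\<^sub>C x}"

lemma csubspace_singular_space: "csubspace (singular_space s)"
proof -
  note b = X bounded_operator_adjoint_on[OF K X]
  show ?thesis
    by (rule complex_vector.subspaceI)
      (auto simp: singular_space_def csubspace_0 csubspace_add csubspace_scale csubspace_K
        bounded_operator_zero[OF K] b bounded_operator_add[OF b(1)] bounded_operator_add[OF b(2)]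
        bounded_operator_scaleC[OF b(1)] bounded_operator_scaleC[OF b(2)]
        bounded_operator_in[OF b(1)] scaleC_add_right scaleC_scaleC mult.commute)
qed

lemma singular_space_in: "x \<in> singular_space s \<Longrightarrow> x \<in> K"
  by (simp add: singular_space_def)

text \<open>Moving \<open>X\<close> across the form leaves \<open>X* X x\<close>. That
  \<open>y\<close> is arbitrary in \<open>K\<close> allows it to be a sum of vectors from several
  eigenspaces.\<close>

lemma cinner_singular:
  assumes "x \<in> singular_space s" "y \<in> K"
  shows "cinner (X x) (X y) = complex_of_real (s\<^sup>2) * cinner x y"
proof -
  have "x \<in> K" using assms by (simp add: singular_space_def)
  then have "cinner (X x) (X y) = cinner (adjoint_on K X (X x)) y"
    by (intro cinner_adjoint_on_left[OF K X, symmetric] bounded_operator_in[OF X] assms(2))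
  then show ?thesis using assms(1) by (simp add: singular_space_def cinner_scaleC_left)
qed

lemma singular_space_orthogonal:
  assumes "x \<in> singular_space s" "y \<in> singular_space t" "s > 0" "t > 0" "s \<noteq> t"
  shows "cinner x y = 0"
proof -
  have "complex_of_real (s\<^sup>2) * cinner x y = cinner (X x) (X y)"
    using assms by (intro cinner_singular[symmetric]) (auto simp: singular_space_def)
  also have "\<dots> = cnj (complex_of_real (t\<^sup>2) * cinner y x)"
    using assms by (subst cinner_commute, subst cinner_singular) (auto simp: singular_space_def)
  also have "\<dots> = complex_of_real (t\<^sup>2) * cinner x y"
    by (simp add: cinner_commute[of x y])
  finally have "complex_of_real (s\<^sup>2 - t\<^sup>2) * cinner x y = 0" by (simp add: algebra_simps)
  \<comment> \<open>Positivity of \<open>s\<close> and \<open>t\<close> matters here: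
    \<open>t = - s\<close> would have the same square.\<close>
  moreover have "s\<^sup>2 - t\<^sup>2 \<noteq> 0" using assms(3-5) by (simp add: power2_eq_iff)
  ultimately show ?thesis by (simp del: of_real_diff)
qed

text \<open>On sums of eigenvectors with \<open>s > C / (m + 1)\<close> the operator stretches by more than \<open>C / (m + 1)\<close>,
  on vectors orthogonal to \<open>\<B> m\<close> by at most that; this bounds the number of such eigenvalues.\<close>

lemma singular_sum_zero:
  assumes F: "finite F" "\<And>s. s \<in> F \<Longrightarrow> C / real (Suc m) < s"
    and v: "\<And>s. s \<in> F \<Longrightarrow> v s \<in> singular_space s"
    and orth: "\<forall>b\<in>\<B> m. cinner (\<Sum>s\<in>F. v s) b = 0" and s: "s \<in> F"
  shows "v s = 0"
proof -
  have pos: "s > 0" if "s \<in> F" for s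
    using F(2)[OF that] C by (intro le_less_trans[of 0 "C / real (Suc m)"]) auto
  let ?x = "\<Sum>s\<in>F. v s"
  have vK: "v s \<in> K" if "s \<in> F" for s using v[OF that] by (rule singular_space_in)
  have x: "?x \<in> K" by (intro csubspace_sum csubspace_K vK)
  have o: "cinner (v s) (v t) = 0" if "s \<in> F" "t \<in> F" "s \<noteq> t" for s t
    by (rule singular_space_orthogonal[OF v v pos pos]) (use that in auto)
  have "complex_of_real ((norm ?x)\<^sup>2) = cinner (\<Sum>s\<in>F. 1 *\<^sub>C v s) ?x"
    by (simp add: cinner_self)
  also have "\<dots> = complex_of_real (\<Sum>s\<in>F. (norm (v s))\<^sup>2)"
    by (subst sum_orthogonal[OF o]) simp_all
  finally have norm_x: "(norm ?x)\<^sup>2 = (\<Sum>s\<in>F. (norm (v s))\<^sup>2)"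
    by (simp only: of_real_eq_iff)
  have "complex_of_real ((norm (X ?x))\<^sup>2) = cinner (X ?x) (X ?x)"
    by (simp add: cinner_self)
  also have "\<dots> = (\<Sum>s\<in>F. cinner (X (v s)) (X ?x))"
    by (subst (1) bounded_operator_sum[OF K X vK]) (simp_all add: cinner_sum_left)
  also have "\<dots> = cinner (\<Sum>s\<in>F. complex_of_real (s\<^sup>2) *\<^sub>C v s) ?x"
    unfolding cinner_sum_left[of _ F] cinner_scaleC_left
    by (intro sum.cong refl cinner_singular v x)
  also have "\<dots> = complex_of_real (\<Sum>s\<in>F. s\<^sup>2 * (norm (v s))\<^sup>2)"
    by (subst sum_orthogonal[OF o]) simp_all
  finally have norm_Xx: "(norm (X ?x))\<^sup>2 = (\<Sum>s\<in>F. s\<^sup>2 * (norm (v s))\<^sup>2)"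
    by (simp only: of_real_eq_iff)
  have "(norm (X ?x))\<^sup>2 \<le> (C / real (Suc m) * norm ?x)\<^sup>2"
    by (intro power_mono dominated_decay[OF X_le C x orth]) auto
  then have "(\<Sum>s\<in>F. s\<^sup>2 * (norm (v s))\<^sup>2) \<le> (\<Sum>s\<in>F. (C / real (Suc m))\<^sup>2 * (norm (v s))\<^sup>2)"
    unfolding norm_Xx power_mult_distrib norm_x sum_distrib_left .
  \<comment> \<open>Every factor \<open>s^2 - (C / (m + 1))^2\<close> is positive, so a sum of
    nonnegative terms is at most \<open>0\<close> and each \<open>v s\<close> must vanish.\<close>
  then have le: "(\<Sum>s\<in>F. (s\<^sup>2 - (C / real (Suc m))\<^sup>2) * (norm (v s))\<^sup>2) \<le> 0"
    by (simp add: left_diff_distrib sum_subtractf)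
  have gt: "s\<^sup>2 - (C / real (Suc m))\<^sup>2 > 0" if "s \<in> F" for s
    using power_strict_mono[OF F(2)[OF that], of 2] C by simp
  have nonneg: "(s\<^sup>2 - (C / real (Suc m))\<^sup>2) * (norm (v s))\<^sup>2 \<ge> 0" if "s \<in> F" for s
    by (intro mult_nonneg_nonneg less_imp_le[OF gt[OF that]]) simp
  have "(s\<^sup>2 - (C / real (Suc m))\<^sup>2) * (norm (v s))\<^sup>2 = 0"
  proof -
    have "(\<Sum>s\<in>F. (s\<^sup>2 - (C / real (Suc m))\<^sup>2) * (norm (v s))\<^sup>2) = 0"
      by (rule antisym[OF le sum_nonneg[OF nonneg]])
    then show ?thesis
      using sum_nonneg_eq_0_iff[of F "\<lambda>s. (s\<^sup>2 - (C / real (Suc m))\<^sup>2) * (norm (v s))\<^sup>2", OF F(1) nonneg] s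
      by blast
  qed
  then show ?thesis using gt[OF s] by simp
qed

text \<open>An infinite basis has \<open>card\<close> equal to \<open>0\<close>, so an
  infinite-dimensional eigenspace has multiplicity \<open>0\<close> and the empty family serves.
  This avoids showing beforehand that the eigenspaces are finite-dimensional.\<close>

lemma singular_value_multiplicity_basis:
  obtains W where "finite W" "\<not> complex_vector.dependent W" "W \<subseteq> singular_space s"
    "card W = singular_value_multiplicity K X s"
proof -
  obtain W where W: "W \<subseteq> singular_space s" "\<not> complex_vector.dependent W"
      "card W = cdim (singular_space s)"
    by (rule complex_vector.basis_exists)
  have mult: "singular_value_multiplicity K X s = cdim (singular_space s)"
    by (simp add: singular_value_multiplicity_def singular_space_def)
  show thesis
  proof (cases "finite W")
    case True
    with W mult that show ?thesis by metis
  next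
    case False
    then have "card {} = singular_value_multiplicity K X s" using W mult by simp
    then show ?thesis using that[of "{}"] complex_vector.independent_empty by blast
  qed
qed

text \<open>Eigenbases for different \<open>s\<close> are disjoint, and by
  \<open>singular_sum_zero\<close> no nontrivial combination of their union is orthogonal to
  \<open>\<B> m\<close>. Hence the union has at most as many elements as
  \<open>\<B> m\<close>.\<close>

lemma sum_multiplicity_le:
  assumes F: "finite F" "\<And>s. s \<in> F \<Longrightarrow> C / real (Suc m) < s"
  shows "(\<Sum>s\<in>F. singular_value_multiplicity K X s) \<le> card (\<B> m)"
proof -
  obtain W where W: "\<And>s. finite (W s)" "\<And>s. \<not> complex_vector.dependent (W s)"
      "\<And>s. W s \<subseteq> singular_space s" "\<And>s. card (W s) = singular_value_multiplicity K X s"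
  proof -
    have "\<forall>s. \<exists>W. finite W \<and> \<not> complex_vector.dependent W \<and> W \<subseteq> singular_space s \<and>
        card W = singular_value_multiplicity K X s"
      using singular_value_multiplicity_basis by blast
    then show thesis using that by metis
  qed
  have pos: "s > 0" if "s \<in> F" for s
    using F(2)[OF that] C by (intro le_less_trans[of 0 "C / real (Suc m)"]) auto
  have disj: "W s \<inter> W t = {}" if "s \<in> F" "t \<in> F" "s \<noteq> t" for s t
  proof -
    have "w = 0" if "w \<in> W s" "w \<in> W t" for w
      using singular_space_orthogonal[of w s w t] W(3) that pos \<open>s \<in> F\<close> \<open>t \<in> F\<close> \<open>s \<noteq> t\<close> by auto
    then show ?thesis using complex_vector.dependent_zero[of "W s"] W(2) by blast
  qed
  have "card (\<Union>s\<in>F. W s) \<le> card (\<B> m)"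
  proof (rule card_le_orthonormal)
    fix u w assume orth: "\<forall>b\<in>\<B> m. cinner (\<Sum>w\<in>(\<Union>s\<in>F. W s). u w *\<^sub>C w) b = 0" and "w \<in> (\<Union>s\<in>F. W s)"
    then obtain s where s: "s \<in> F" "w \<in> W s" by auto
    have "(\<Sum>w\<in>(\<Union>s\<in>F. W s). u w *\<^sub>C w) = (\<Sum>s\<in>F. \<Sum>w\<in>W s. u w *\<^sub>C w)"
      using W(1) F(1) disj by (intro sum.UNION_disjoint) auto
    then have "(\<Sum>w\<in>W s. u w *\<^sub>C w) = 0"
      using orth W(3) by (intro singular_sum_zero[OF F, where v = "\<lambda>s. \<Sum>w\<in>W s. u w *\<^sub>C w"] s)
        (auto intro!: csubspace_sum csubspace_scale csubspace_singular_space)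
    then show "u w = 0"
      using W(2)[of s] s(2) unfolding complex_vector.dependent_finite[OF W(1)] by blast
  qed (use F(1) W(1) in \<open>auto simp: finite_basis orthonormal_basis\<close>)
  moreover have "card (\<Union>s\<in>F. W s) = (\<Sum>s\<in>F. singular_value_multiplicity K X s)"
    using W(1,4) F(1) disj by (subst card_UN_disjoint) auto
  ultimately show ?thesis by simp
qed

text \<open>As \<open>\<delta>\<close> is at most the norm, \<open>C\<close> bounds the operator
  norm of \<open>X\<close> on \<open>K\<close>; an eigenvector for \<open>s > C\<close> would be
  stretched too much. The dyadic blocks can therefore start at \<open>C\<close>.\<close>

lemma singular_value_multiplicity_eq_0:
  assumes "s > C" shows "singular_value_multiplicity K X s = 0"
proof -
  have "singular_space s \<subseteq> {0}"
  proof
    fix x assume x: "x \<in> singular_space s"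
    then have xK: "x \<in> K" by (rule singular_space_in)
    have "complex_of_real ((norm (X x))\<^sup>2) = complex_of_real ((s * norm x)\<^sup>2)"
      using cinner_singular[OF x xK] by (simp add: cinner_self power_mult_distrib)
    then have "s * norm x = norm (X x)"
      using assms C by (simp only: of_real_eq_iff) (simp add: power2_eq_iff_nonneg)
    also have "norm (X x) \<le> C * norm x"
      using X_le[OF xK] mult_left_mono[OF seminorm_le_norm C, of x] by linarith
    finally have "s * norm x \<le> C * norm x" .
    then show "x \<in> {0}" using assms by (auto simp: mult_le_cancel_right)
  qed
  then have "cdim (singular_space s) \<le> card ({} :: 'a set)"
    by (intro complex_vector.dim_le_card) auto
  then show ?thesis by (simp add: singular_value_multiplicity_def singular_space_def)
qed

end

text \<open>Block \<open>j\<close> holds at most \<open>c * 2 ^ ((j + 1) * d)\<close> singular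
  values, none above \<open>C / 2 ^ j\<close>. Its contribution is a constant times
  \<open>(2 powr (d - p)) ^ j\<close>, and \<open>p > d\<close> makes the series geometric with
  ratio below \<open>1\<close>.\<close>

theorem smoothing_in_schatten_class:
  assumes smooth: "smoothing X" and p: "p > real d"
  shows "X \<in> schatten_class p K"
proof -
  have X: "bounded_operator K X" using smoothing_bounded[OF smooth] .
  obtain C0 where C0: "C0 \<ge> 0" "\<And>x. x \<in> K \<Longrightarrow> norm (X x) \<le> C0 * \<delta> x"
    using smooth unfolding smoothing_def dominated_def by blast
  \<comment> \<open>Adding \<open>1\<close> makes the constant positive, so that the logarithm of
    \<open>C / s\<close> makes sense even for \<open>X = 0\<close>.\<close>
  define C where "C = C0 + 1"
  have C: "C > 0" "C \<ge> 0" using C0 by (auto simp: C_def)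
  have X_le: "norm (X x) \<le> C * \<delta> x" if "x \<in> K" for x
    using C0(2)[OF that] seminorm_nonneg[of x] by (simp add: C_def distrib_right)
  let ?m = "singular_value_multiplicity K X"
  define q where "q = 2 powr (real d - p)"
  have q: "0 < q" "q < 1" using p by (auto simp: q_def powr_less_one)
  \<comment> \<open>The factor \<open>2 ^ d\<close> pays for counting down to the lower end
    \<open>C / 2 ^ (j + 1)\<close> of a block while bounding its values by the upper end.\<close>
  define A where "A = C powr p * (c * 2 ^ d)"
  have c: "c \<ge> 0" using card_basis[of 0] of_nat_0_le_iff[of "card (\<B> 0)", where 'a = real] by (simp del: of_nat_0_le_iff)
  have A: "A \<ge> 0" using c by (simp add: A_def)
  \<comment> \<open>dyadic blocks: \<open>J s = j\<close> iff \<open>C / 2\<^bsup>j + 1\<^esup> < s \<le> C / 2\<^bsup>j\<^esup>\<close>\<close>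
  define J where "J s = nat \<lfloor>log 2 (C / s)\<rfloor>" for s
  have J: "C / 2 ^ Suc (J s) < s" "s \<le> C / 2 ^ J s" if s: "0 < s" "s \<le> C" for s
  proof -
    have "log 2 (C / s) \<ge> 0" using s by simp
    then have "real (J s) \<le> log 2 (C / s)" "log 2 (C / s) < real (Suc (J s))"
      by (auto simp: J_def) linarith
    then have "2 powr real (J s) \<le> C / s" "C / s < 2 powr real (Suc (J s))"
      using s by (auto simp: le_log_iff log_less_iff)
    then have "2 ^ J s \<le> C / s" "C / s < 2 ^ Suc (J s)"
      by (auto simp: powr_realpow simp del: power_Suc of_nat_Suc)
    then show "C / 2 ^ Suc (J s) < s" "s \<le> C / 2 ^ J s"
      using s by (auto simp: field_simps simp del: power_Suc) 
  qed
  have block: "(\<Sum>s\<in>F. real (?m s) * s powr p) \<le> A * q ^ j"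
    if F: "finite F" "\<And>s. s \<in> F \<Longrightarrow> 0 < s \<and> s \<le> C \<and> J s = j" for F j
  proof -
    \<comment> \<open>With \<open>m = 2 ^ (j + 1) - 1\<close> the counting threshold
      \<open>C / (m + 1)\<close> is exactly the lower end of block \<open>j\<close>.\<close>
    have m: "Suc (2 ^ Suc j - 1) = 2 ^ Suc j" by simp
    have "(\<Sum>s\<in>F. real (?m s) * s powr p) \<le> (\<Sum>s\<in>F. real (?m s) * (C / 2 ^ j) powr p)"
      using F(2) J(2) p by (intro sum_mono mult_left_mono powr_mono2) (auto intro: less_imp_le)
    also have "\<dots> = real (\<Sum>s\<in>F. ?m s) * (C / 2 ^ j) powr p"
      by (simp add: sum_distrib_right)
    also have "\<dots> \<le> (c * (2 ^ Suc j) ^ d) * (C / 2 ^ j) powr p"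
    proof (rule mult_right_mono)
      have "(\<Sum>s\<in>F. ?m s) \<le> card (\<B> (2 ^ Suc j - 1))"
        using F J(1) by (intro sum_multiplicity_le[OF X C(2) X_le]) (auto simp: m simp del: power_Suc)
      then have "real (\<Sum>s\<in>F. ?m s) \<le> real (card (\<B> (2 ^ Suc j - 1)))" by (simp only: of_nat_le_iff)
      also have "\<dots> \<le> c * real (Suc (2 ^ Suc j - 1)) ^ d" by (rule card_basis)
      finally show "real (\<Sum>s\<in>F. ?m s) \<le> c * (2 ^ Suc j) ^ d" unfolding m of_nat_power of_nat_numeral .
    qed simp
    also have "\<dots> = A * q ^ j"
    proof -
      have "(C / 2 ^ j) powr p = C powr p / 2 powr (real j * p)"
        using C by (simp add: powr_divide powr_powr flip: powr_realpow)
      moreover have "q ^ j = 2 ^ (d * j) / 2 powr (real j * p)"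
      proof -
        have "q ^ j = q powr real j" using q by (simp add: powr_realpow)
        also have "\<dots> = 2 powr (real (d * j) - real j * p)"
          by (simp add: q_def powr_powr algebra_simps)
        finally show ?thesis by (simp only: powr_diff powr_realpow zero_less_numeral)
      qed
      moreover have "((2::real) ^ Suc j) ^ d = 2 ^ d * 2 ^ (d * j)"
        by (simp add: power_mult_distrib power_mult[symmetric] mult.commute)
      ultimately show ?thesis by (simp add: A_def)
    qed
    finally show ?thesis .
  qed
  have "(\<lambda>s. real (?m s) * s powr p) summable_on {0<..}"
  proof (rule nonneg_bounded_partial_sums_imp_summable_on)
    show "\<forall>\<^sub>F F in finite_subsets_at_top {0<..}. (\<Sum>s\<in>F. real (?m s) * s powr p) \<le> A * (1 / (1 - q))"
    proof (rule eventually_finite_subsets_at_top_weakI)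
      fix F :: "real set" assume F: "finite F" "F \<subseteq> {0<..}"
      let ?F = "{s \<in> F. s \<le> C}"
      have "(\<Sum>s\<in>F. real (?m s) * s powr p) = (\<Sum>s\<in>?F. real (?m s) * s powr p)"
      proof (rule sum.mono_neutral_right[OF F(1)])
        have "?m s = 0" if "\<not> s \<le> C" for s
          using singular_value_multiplicity_eq_0[OF X C(2) X_le] that by simp
        then show "\<forall>s\<in>F - ?F. real (?m s) * s powr p = 0" by auto
      qed auto
      also have "\<dots> = (\<Sum>j\<in>J ` ?F. \<Sum>s | s \<in> ?F \<and> J s = j. real (?m s) * s powr p)"
        using F(1) by (intro sum.image_gen) auto
      also have "\<dots> \<le> (\<Sum>j\<in>J ` ?F. A * q ^ j)"
        using F by (intro sum_mono block) auto
      also have "\<dots> = A * (\<Sum>j\<in>J ` ?F. q ^ j)" by (simp add: sum_distrib_left)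
      also have "(\<Sum>j\<in>J ` ?F. q ^ j) \<le> (\<Sum>j. q ^ j)"
        using F(1) q by (intro sum_le_suminf summable_geometric) auto
      also have "(\<Sum>j. q ^ j) = 1 / (1 - q)" using q by (intro suminf_geometric) auto
      finally show "(\<Sum>s\<in>F. real (?m s) * s powr p) \<le> A * (1 / (1 - q))"
        using A by (simp add: mult_left_mono)
    qed
  qed auto
  then show ?thesis
    using compact_operator_smoothing[OF smooth] by (simp add: schatten_class_def)
qed

end


section \<open>Operators that are bounded below off a finite-dimensional subspace\<close>

text \<open>Replacing \<open>b\<close> by its component \<open>w\<close> orthogonal to
  \<open>V\<close> leaves the span unchanged. If \<open>w\<close> is nonzero, the coefficient of
  \<open>w\<close> is a continuous functional of the vector, so the two parts of a convergent
  sequence converge separately.\<close>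

lemma closed_span_insert:
  fixes V :: "'a::chilbert_space set"
  assumes V: "csubspace V" "closed V" shows "closed (cspan (insert b V))"
proof -
  define w where "w = b - ortho_proj V b"
  have w: "w \<in> orth_complement V" unfolding w_def by (rule diff_ortho_proj_in[OF V])
  have span: "cspan (insert b V) = {v + c *\<^sub>C w |v c. v \<in> V}"
  proof -
    have spanV: "cspan V = V" using V(1) by (rule complex_vector.span_eq_iff[THEN iffD2])
    show ?thesis
      unfolding complex_vector.span_insert spanV
    proof safe
      fix x c assume x: "x - c *\<^sub>C b \<in> V"
      have "x = (x - c *\<^sub>C b + c *\<^sub>C ortho_proj V b) + c *\<^sub>C w"
        by (simp add: w_def complex_vector.scale_right_diff_distrib)
      moreover have "x - c *\<^sub>C b + c *\<^sub>C ortho_proj V b \<in> V"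
        by (intro csubspace_add csubspace_scale ortho_proj_in V x)
      ultimately show "\<exists>v c. x = v + c *\<^sub>C w \<and> v \<in> V" by blast
    next
      fix v c assume v: "v \<in> V"
      have "v - c *\<^sub>C ortho_proj V b \<in> V"
        by (intro csubspace_diff csubspace_scale ortho_proj_in V v)
      then show "\<exists>k. v + c *\<^sub>C w - k *\<^sub>C b \<in> V"
        by (intro exI[of _ c]) (simp add: w_def complex_vector.scale_right_diff_distrib)
    qed
  qed
  show ?thesis
  proof (cases "w = 0")
    case True
    then have "cspan (insert b V) = V" unfolding span by simp
    then show ?thesis using V by simp
  next
    case False
    show ?thesis
      unfolding closed_sequential_limits span
    proof safe
      fix X l assume X: "\<forall>n. X n \<in> {v + c *\<^sub>C w |v c. v \<in> V}" and l: "X \<longlonglongrightarrow> l"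
      then obtain v c where vc: "\<And>n. X n = v n + c n *\<^sub>C w" "\<And>n. v n \<in> V" by simp metis
      define k where "k x = cinner x w / cinner w w" for x
      have "bounded_linear k"
        unfolding k_def by (rule bounded_linear_compose[OF bounded_linear_divide bounded_linear_cinner_left])
      have "k (X n) = c n" for n
      proof -
        have "cinner (v n) w = 0"
          using w vc(2)[of n] cinner_eq_0_commute by (auto simp: orth_complement_def)
        then show ?thesis using False by (simp add: k_def vc(1) cinner_add_left cinner_scaleC_left)
      qed
      then have "c \<longlonglongrightarrow> k l"
        using bounded_linear.tendsto[OF \<open>bounded_linear k\<close> l] by simp
      then have "(\<lambda>n. X n - c n *\<^sub>C w) \<longlonglongrightarrow> l - k l *\<^sub>C w"
        by (intro tendsto_diff l bounded_linear.tendsto[OF bounded_linear_scaleC_left])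
      then have "l - k l *\<^sub>C w \<in> V"
        using closed_sequentially[OF V(2), of "\<lambda>n. X n - c n *\<^sub>C w"] vc by simp
      then show "\<exists>v c. l = v + c *\<^sub>C w \<and> v \<in> V"
        by (intro exI[of _ "l - k l *\<^sub>C w"] exI[of _ "k l"]) simp
    qed
  qed
qed

lemma closed_span_Un_finite:
  fixes V :: "'a::chilbert_space set"
  assumes V: "csubspace V" "closed V" and W: "finite W" shows "closed (cspan (V \<union> W))"
  using W
proof induction
  case empty
  show ?case
    unfolding Un_empty_right complex_vector.span_eq_iff[THEN iffD2, OF V(1)] by (rule V(2))
next
  case (insert b W)
  have "cspan (V \<union> insert b W) = cspan (insert b (cspan (V \<union> W)))"
  proof (rule antisym)
    show "cspan (V \<union> insert b W) \<subseteq> cspan (insert b (cspan (V \<union> W)))"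
      by (rule complex_vector.span_mono) (auto intro: complex_vector.span_base)
    have "cspan (V \<union> W) \<subseteq> cspan (V \<union> insert b W)"
      by (rule complex_vector.span_mono) auto
    then show "cspan (insert b (cspan (V \<union> W))) \<subseteq> cspan (V \<union> insert b W)"
      by (intro complex_vector.span_minimal complex_vector.subspace_span) (auto intro: complex_vector.span_base)
  qed
  then show ?case
    using closed_span_insert[OF complex_vector.subspace_span insert.IH] by simp
qed

context
  fixes K :: "'a::chilbert_space set" and L :: "'a \<Rightarrow> 'a" and B :: "'a set" and C :: real
  assumes K: "csubspace K" "closed K" and L: "bounded_operator K L"
    and B: "finite B" "orthonormal B" and in_K: "\<And>x. x \<in> K \<Longrightarrow> fourier_sum B x \<in> K"
    and below: "\<And>x. x \<in> K \<Longrightarrow> \<forall>b\<in>B. cinner x b = 0 \<Longrightarrow> norm x \<le> C * norm (L x)"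
begin

text \<open>A kernel vector orthogonal to \<open>B\<close> is zero by the lower bound, so
  independent sets in the kernel have at most \<open>card B\<close> elements. The count is done for
  finite subsets of a basis, which is not yet known to be finite.\<close>

lemma finite_dimensional_kernel: "finite_dimensional {x \<in> K. L x = 0}"
proof -
  have sub: "csubspace {x \<in> K. L x = 0}"
    by (rule complex_vector.subspaceI)
      (auto simp: csubspace_0 csubspace_add csubspace_scale K bounded_operator_zero[OF K L]
        bounded_operator_add[OF L] bounded_operator_scaleC[OF L])
  obtain W where W: "W \<subseteq> {x \<in> K. L x = 0}" "\<not> complex_vector.dependent W" "{x \<in> K. L x = 0} \<subseteq> cspan W"
    "card W = cdim {x \<in> K. L x = 0}"
    by (rule complex_vector.basis_exists)
  have card_le: "card U \<le> card B" if U: "finite U" "U \<subseteq> W" for U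
  proof (rule card_le_orthonormal[OF U(1) B])
    fix u v assume orth: "\<forall>b\<in>B. cinner (\<Sum>v\<in>U. u v *\<^sub>C v) b = 0" and v: "v \<in> U"
    have "(\<Sum>v\<in>U. u v *\<^sub>C v) \<in> {x \<in> K. L x = 0}"
      using U W(1) by (intro csubspace_sum csubspace_scale sub) auto
    then have "(\<Sum>v\<in>U. u v *\<^sub>C v) = 0" using below[OF _ orth] by simp
    moreover have "\<not> complex_vector.dependent U"
      using complex_vector.independent_mono[OF W(2) U(2)] .
    ultimately show "u v = 0" using v unfolding complex_vector.dependent_finite[OF U(1)] by blast
  qed
  have "finite W"
  proof (rule ccontr)
    assume "infinite W"
    then obtain U where "finite U" "card U = Suc (card B)" "U \<subseteq> W"
      using infinite_arbitrarily_large by blast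
    then show False using card_le[of U] by simp
  qed
  with W(3) show ?thesis by (auto simp: finite_dimensional_def)
qed

lemma closed_range: "closed (L ` K)"
proof -
  obtain R where R: "R \<ge> 0" "\<And>x. x \<in> K \<Longrightarrow> norm (L x) \<le> R * norm x"
    using bounded_operator_bound[OF L] by blast
  have sub_image: "csubspace (L ` V)" if V: "csubspace V" "V \<subseteq> K" for V
  proof (rule complex_vector.subspaceI)
    show "0 \<in> L ` V"
      using csubspace_0[OF V(1)] bounded_operator_zero[OF K L] by (intro image_eqI[of _ _ 0]) auto
    fix x y c assume "x \<in> L ` V"
    then obtain x' where x': "x = L x'" "x' \<in> V" by auto
    then show "c *\<^sub>C x \<in> L ` V"
      using subsetD[OF V(2) x'(2)] csubspace_scale[OF V(1) x'(2)] bounded_operator_scaleC[OF L, of x' c]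
      by (intro image_eqI[of _ _ "c *\<^sub>C x'"]) auto
    assume "y \<in> L ` V"
    then obtain y' where y': "y = L y'" "y' \<in> V" by auto
    then show "x + y \<in> L ` V"
      using subsetD[OF V(2) x'(2)] subsetD[OF V(2) y'(2)] x' csubspace_add[OF V(1) x'(2) y'(2)]
        bounded_operator_add[OF L, of x' y']
      by (intro image_eqI[of _ _ "x' + y'"]) auto
  qed
  define K0 where "K0 = {x \<in> K. \<forall>b\<in>B. cinner x b = 0}"
  have K0_eq: "K0 = K \<inter> orth_complement B" by (auto simp: K0_def orth_complement_def)
  have K0: "csubspace K0" "closed K0" "K0 \<subseteq> K"
    unfolding K0_eq using K csubspace_orth_complement closed_orth_complement
    by (auto intro: complex_vector.subspace_inter)
  have below0: "norm x \<le> C * norm (L x)" if "x \<in> K0" for x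
    using that below by (auto simp: K0_def)
  have closed0: "closed (L ` K0)"
    unfolding closed_sequential_limits
  proof safe
    fix Y l assume Y: "\<forall>n. Y n \<in> L ` K0" and l: "Y \<longlonglongrightarrow> l"
    then have "\<forall>n. \<exists>x. x \<in> K0 \<and> Y n = L x" by auto
    then obtain X where X: "\<And>n. X n \<in> K0" "\<And>n. Y n = L (X n)" by metis
    have "Cauchy X"
    proof (rule metric_CauchyI)
      fix e :: real assume e: "e > 0"
      then obtain N where N: "\<And>m n. m \<ge> N \<Longrightarrow> n \<ge> N \<Longrightarrow> dist (Y m) (Y n) < e / (\<bar>C\<bar> + 1)"
        using metric_CauchyD[OF LIMSEQ_imp_Cauchy[OF l], of "e / (\<bar>C\<bar> + 1)"] by auto
      have "dist (X m) (X n) < e" if "m \<ge> N" "n \<ge> N" for m n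
      proof -
        have d: "X m - X n \<in> K0" by (intro csubspace_diff K0 X)
        have "L (X m - X n) = Y m - Y n"
          using X K0(3) by (simp add: bounded_operator_diff[OF K L] subsetD)
        then have "dist (X m) (X n) \<le> C * dist (Y m) (Y n)"
          using below0[OF d] by (simp add: dist_norm)
        also have "\<dots> \<le> (\<bar>C\<bar> + 1) * dist (Y m) (Y n)" by (intro mult_right_mono) auto
        also have "\<dots> < e" using N[OF that] by (simp add: field_simps)
        finally show ?thesis .
      qed
      then show "\<exists>M. \<forall>m\<ge>M. \<forall>n\<ge>M. dist (X m) (X n) < e" by blast
    qed
    then obtain x where x: "X \<longlonglongrightarrow> x" by (auto simp: Cauchy_convergent_iff convergent_def)
    have xK: "x \<in> K0" using closed_sequentially[OF K0(2)] X(1) x by blast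
    have "(\<lambda>n. R * norm (X n - x)) \<longlonglongrightarrow> R * norm (x - x)" by (intro tendsto_intros x)
    then have "(\<lambda>n. R * norm (X n - x)) \<longlonglongrightarrow> 0" by simp
    moreover have "norm (Y n - L x) \<le> R * norm (X n - x)" for n
      using R(2)[of "X n - x"] X xK K0(3) csubspace_diff[OF K(1)]
      by (simp add: bounded_operator_diff[OF K L, symmetric] subsetD)
    ultimately have "(\<lambda>n. Y n - L x) \<longlonglongrightarrow> 0"
      by (rule Lim_null_comparison[OF always_eventually, OF allI, rotated])
    then have "Y \<longlonglongrightarrow> L x" by (simp add: LIM_zero_iff)
    then have "l = L x" using l by (blast intro: LIMSEQ_unique)
    then show "l \<in> L ` K0" using xK by blast
  qed
  \<comment> \<open>The projection of \<open>K\<close> is used instead of the whole span of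
    \<open>B\<close>, which need not be contained in \<open>K\<close>, where \<open>L\<close> is
    defined.\<close>
  define V where "V = fourier_sum B ` K"
  obtain W where W: "W \<subseteq> V" "\<not> complex_vector.dependent W" "V \<subseteq> cspan W" "card W = cdim V"
    by (rule complex_vector.basis_exists)
  have VB: "V \<subseteq> cspan B" "V \<subseteq> K" using fourier_sum_in_span in_K by (auto simp: V_def)
  then have finW: "finite W"
    using complex_vector.independent_span_bound[OF B(1) W(2)] W(1) by blast
  have "L ` K = cspan (L ` K0 \<union> L ` W)"
  proof
    show "cspan (L ` K0 \<union> L ` W) \<subseteq> L ` K"
      using K0(3) W(1) VB by (intro complex_vector.span_minimal sub_image K order_refl) auto
    show "L ` K \<subseteq> cspan (L ` K0 \<union> L ` W)"
    proof
      fix y assume "y \<in> L ` K"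
      then obtain x where x: "x \<in> K" "y = L x" by auto
      let ?v = "fourier_sum B x"
      have "?v \<in> cspan W" using W(3) x(1) by (auto simp: V_def)
      then obtain u where u: "?v = (\<Sum>w\<in>W. u w *\<^sub>C w)"
        using complex_vector.span_finite[OF finW] by auto
      have WK: "w \<in> K" if "w \<in> W" for w using that W(1) VB by auto
      have "L ?v = (\<Sum>w\<in>W. u w *\<^sub>C L w)"
        unfolding u using WK
        by (simp add: bounded_operator_sum[OF K L] csubspace_scale[OF K(1)] bounded_operator_scaleC[OF L])
      then have 1: "L ?v \<in> cspan (L ` K0 \<union> L ` W)"
        by (auto intro!: complex_vector.span_sum complex_vector.span_scale intro: complex_vector.span_base)
      have "x - ?v \<in> K0"
        using x(1) in_K csubspace_diff[OF K(1)] by (auto simp: K0_def cinner_diff_fourier_sum B)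
      then have 2: "L (x - ?v) \<in> cspan (L ` K0 \<union> L ` W)" by (auto intro: complex_vector.span_base)
      have "y = L (x - ?v) + L ?v"
        using x in_K by (simp add: bounded_operator_diff[OF K L])
      then show "y \<in> cspan (L ` K0 \<union> L ` W)"
        using complex_vector.span_add[OF 2 1] by simp
    qed
  qed
  then show ?thesis
    using closed_span_Un_finite[OF sub_image[OF K0(1,3)] closed0 finite_imageI[OF finW]] by simp
qed

end


section \<open>The Dirac operator\<close>

definition ext_sign :: "'d::linorder \<Rightarrow> 'd set \<Rightarrow> complex"
  where "ext_sign i S = (-1) ^ card {j \<in> S. j < i}"

lemma ext_sign_square [simp]: "ext_sign i S * ext_sign i S = 1"
  by (simp add: ext_sign_def flip: power_mult_distrib)

lemma norm_ext_sign [simp]: "cmod (ext_sign i S) = 1"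
  by (simp add: ext_sign_def norm_power)

lemma cnj_ext_sign [simp]: "cnj (ext_sign i S) = ext_sign i S"
  by (simp add: ext_sign_def)

lemma ext_sign_insert:
  fixes R :: "'d::{finite, linorder} set"
  assumes "i \<notin> R"
  shows "ext_sign j (insert i R) = (if i < j then - ext_sign j R else ext_sign j R)"
proof (cases "i < j")
  case True
  then have "{l \<in> insert i R. l < j} = insert i {l \<in> R. l < j}" by auto
  with True assms show ?thesis by (simp add: ext_sign_def)
next
  case False
  then have "{l \<in> insert i R. l < j} = {l \<in> R. l < j}" by auto
  with False show ?thesis by (simp add: ext_sign_def)
qed

lemma ext_sign_remove:
  fixes S :: "'d::{finite, linorder} set"
  assumes "i \<in> S"
  shows "ext_sign j (S - {i}) = (if i < j then - ext_sign j S else ext_sign j S)"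
  using ext_sign_insert[of i "S - {i}" j] assms by (auto simp: insert_absorb)

lemma norm_vec_le_sum: "norm F \<le> (\<Sum>S\<in>UNIV. norm (F $ S))"
  unfolding norm_vec_def by (rule L2_set_le_sum) simp

lemma csubspace_tensor_exterior: "csubspace K \<Longrightarrow> csubspace (tensor_exterior K)"
  by (auto intro!: complex_vector.subspaceI
      simp: tensor_exterior_def csubspace_0 csubspace_add csubspace_scale scaleC_vec_def)

lemma closed_tensor_exterior:
  assumes "closed K" shows "closed (tensor_exterior K :: ('a::chilbert_space ^ 'd::finite set) set)"
proof -
  have "(tensor_exterior K :: ('a ^ 'd set) set) = (\<Inter>S. (\<lambda>F. F $ S) -` K)"
    by (auto simp: tensor_exterior_def)
  moreover have "closed ((\<lambda>F :: 'a ^ 'd set. F $ S) -` K)" for S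
    using assms by (intro continuous_closed_vimage continuous_intros)
  ultimately show ?thesis by (simp add: closed_INT)
qed

lemma cinner_axis: "cinner F (axis S b) = cinner (F $ S) b"
  by (simp add: cinner_vec_def axis_def if_distrib cong: if_cong)


section \<open>The Laplacian of the Dirac operator and a Fredholm criterion\<close>

context filtered_subspace
begin

context
  fixes T :: "'d::{finite, linorder} \<Rightarrow> 'a \<Rightarrow> 'a"
  assumes T: "\<And>i. bounded_operator K (T i)"
    and T_commute: "\<And>i j x. x \<in> K \<Longrightarrow> T i (T j x) = T j (T i x)"
    and cross_comm: "\<And>i j. dominated (op_commutator K (adjoint_on K (T i)) (T j))"
    and sum_T: "\<exists>C\<ge>0. \<forall>x\<in>K. norm ((\<Sum>i\<in>UNIV. T i (adjoint_on K (T i) x)) - x) \<le> C * \<delta> x"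
begin

abbreviation (input) "Ts i \<equiv> adjoint_on K (T i)"
abbreviation (input) "E \<equiv> tensor_exterior K :: ('a ^ 'd set) set"

lemmas E = csubspace_tensor_exterior[OF csubspace_K] closed_tensor_exterior[OF closed_K]
lemmas Ts = bounded_operator_adjoint_on[OF K T]

lemma tensor_exterior_nth: "F \<in> E \<Longrightarrow> F $ S \<in> K"
  by (simp add: tensor_exterior_def)

lemma dirac_B_nth:
  assumes "F \<in> E"
  shows "dirac_B K T F $ S = (\<Sum>i\<in>S. ext_sign i S *\<^sub>C T i (F $ (S - {i})))"
proof -
  have "tensor_op K (T i) (creation i) F $ S = (if i \<in> S then ext_sign i S *\<^sub>C T i (F $ (S - {i})) else 0)" for i
  proof -
    have "creation i (ext_basis R) $ S *\<^sub>C T i (F $ R) =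
        (if R = S - {i} then if i \<in> S then ext_sign i S *\<^sub>C T i (F $ (S - {i})) else 0 else 0)" for R
      by (auto simp: creation_nth ext_basis_def axis_def ext_sign_def)
    then show ?thesis using assms by (simp add: tensor_op_def)
  qed
  then show ?thesis
    using assms by (simp add: dirac_B_def sum.If_cases)
qed

lemma dirac_B_in: "F \<in> E \<Longrightarrow> dirac_B K T F \<in> E"
  using bounded_operator_in[OF T] csubspace_K
  by (auto simp: tensor_exterior_def[of K, THEN eq_reflection] dirac_B_nth intro!: csubspace_sum csubspace_scale)

lemma bounded_dirac_B: "bounded_operator E (dirac_B K T)"
proof -
  have "\<exists>C. \<forall>i. C i \<ge> 0 \<and> (\<forall>x\<in>K. norm (T i x) \<le> C i * norm x)"
    by (rule choice) (metis bounded_operator_bound[OF T])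
  then obtain C where C: "\<And>i. C i \<ge> 0" "\<And>i x. x \<in> K \<Longrightarrow> norm (T i x) \<le> C i * norm x" by blast
  show ?thesis
  proof (rule bounded_operatorI)
    fix F G c assume F: "F \<in> E"
    show "dirac_B K T F \<in> E" by (rule dirac_B_in[OF F])
    show "dirac_B K T (c *\<^sub>C F) = c *\<^sub>C dirac_B K T F"
      using F csubspace_scale[OF E(1) F, of c]
      by (simp add: vec_eq_iff dirac_B_nth scaleC_vec_def tensor_exterior_nth bounded_operator_scaleC[OF T]
          complex_vector.scale_sum_right scaleC_scaleC mult.commute)
    show "dirac_B K T (F + G) = dirac_B K T F + dirac_B K T G" if G: "G \<in> E"
      using F G csubspace_add[OF E(1) F G]
      by (simp add: vec_eq_iff dirac_B_nth tensor_exterior_nth bounded_operator_add[OF T]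
          scaleC_add_right sum.distrib)
    have "norm (dirac_B K T F) \<le> (\<Sum>S\<in>UNIV. norm (dirac_B K T F $ S))" by (rule norm_vec_le_sum)
    also have "\<dots> \<le> (\<Sum>S\<in>(UNIV :: 'd set set). \<Sum>i\<in>S. C i * norm F)"
    proof (rule sum_mono)
      fix S :: "'d set"
      have "norm (T i (F $ (S - {i}))) \<le> C i * norm F" for i
        using C(2)[OF tensor_exterior_nth[OF F]] mult_left_mono[OF Finite_Cartesian_Product.norm_nth_le C(1)] by (rule order_trans)
      then show "norm (dirac_B K T F $ S) \<le> (\<Sum>i\<in>S. C i * norm F)"
        unfolding dirac_B_nth[OF F] by (intro sum_norm_le) (simp add: norm_scaleC)
    qed
    finally show "norm (dirac_B K T F) \<le> (\<Sum>S\<in>(UNIV :: 'd set set). \<Sum>i\<in>S. C i) * norm F"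
      by (simp add: sum_distrib_right)
  qed (simp add: dirac_B_def)
qed

text \<open>The adjoint of creation is annihilation: pairs \<open>(S, i)\<close> with
  \<open>i\<close> in \<open>S\<close> are reindexed by \<open>(S - {i}, i)\<close>. The sign is
  unchanged, since \<open>ext_sign i\<close> counts only elements strictly below
  \<open>i\<close>.\<close>

lemma adjoint_dirac_B_nth:
  assumes G: "G \<in> E"
  shows "adjoint_on E (dirac_B K T) G $ R = (\<Sum>i\<in>- R. ext_sign i R *\<^sub>C Ts i (G $ insert i R))"
proof -
  let ?H = "(\<chi> R. \<Sum>i\<in>- R. ext_sign i R *\<^sub>C Ts i (G $ insert i R)) :: 'a ^ 'd set"
  have "adjoint_on E (dirac_B K T) G = ?H"
  proof (rule adjoint_on_eqI[OF E bounded_dirac_B G])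
    show "?H \<in> E"
      unfolding tensor_exterior_def using adjoint_on_in[OF K T] tensor_exterior_nth[OF G] csubspace_K
      by (auto intro!: csubspace_sum csubspace_scale)
    fix F assume F: "F \<in> E"
    have "cinner (dirac_B K T F) G = (\<Sum>S\<in>UNIV. \<Sum>i\<in>S. ext_sign i S * cinner (T i (F $ (S - {i}))) (G $ S))"
      by (simp add: cinner_vec_def dirac_B_nth F cinner_sum_left cinner_scaleC_left)
    also have "\<dots> = (\<Sum>(S, i)\<in>(SIGMA S:UNIV. S). ext_sign i S * cinner (T i (F $ (S - {i}))) (G $ S))"
      by (rule sum.Sigma) auto
    also have "\<dots> = (\<Sum>(R, i)\<in>(SIGMA R:UNIV. - R). ext_sign i R * cinner (F $ R) (Ts i (G $ insert i R)))"
    proof (rule sum.reindex_bij_witness[where i = "\<lambda>(R, i). (insert i R, i)" and j = "\<lambda>(S, i). (S - {i}, i)"])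
      fix p :: "'d set \<times> 'd" assume "p \<in> (SIGMA S:UNIV. S)"
      then obtain S i where p: "p = (S, i)" "i \<in> S" by auto
      then show "(case case p of (S, i) \<Rightarrow> (S - {i}, i) of (R, i) \<Rightarrow> ext_sign i R * cinner (F $ R) (Ts i (G $ insert i R))) =
          (case p of (S, i) \<Rightarrow> ext_sign i S * cinner (T i (F $ (S - {i}))) (G $ S))"
        by (simp add: ext_sign_remove insert_absorb cinner_adjoint_on[OF K T] tensor_exterior_nth F G)
    qed (auto simp: insert_absorb)
    also have "\<dots> = (\<Sum>R\<in>UNIV. \<Sum>i\<in>- R. ext_sign i R * cinner (F $ R) (Ts i (G $ insert i R)))"
      by (rule sum.Sigma[symmetric]) auto
    also have "\<dots> = cinner F ?H"
      by (simp add: cinner_vec_def cinner_sum_right cinner_scaleC_right)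
    finally show "cinner (dirac_B K T F) G = cinner F ?H" .
  qed
  then show ?thesis by simp
qed

abbreviation (input) "D\<^sub>B \<equiv> dirac_B K T :: 'a ^ 'd set \<Rightarrow> _"
abbreviation (input) "D\<^sub>B' \<equiv> adjoint_on E (dirac_B K T)"

lemmas bounded_adjoint_dirac_B = bounded_operator_adjoint_on[OF E bounded_dirac_B]

text \<open>Exchanging \<open>i\<close> and \<open>j\<close> flips the exterior sign but leaves
  \<open>T i (T j x)\<close> alone, so the double sum equals its own negative.\<close>

lemma dirac_B_dirac_B:
  assumes F: "F \<in> E" shows "dirac_B K T (dirac_B K T F) = 0"
proof -
  have "dirac_B K T (dirac_B K T F) $ S = 0" for S
  proof -
    define f where "f i j = (ext_sign i S * ext_sign j (S - {i})) *\<^sub>C T i (T j (F $ (S - {i} - {j})))" for i j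
    have anti: "f i j = - f j i" if "i \<in> S" "j \<in> S" "i \<noteq> j" for i j
    proof -
      have "S - {j} - {i} = S - {i} - {j}" by auto
      moreover have "ext_sign j S * ext_sign i (S - {j}) = - (ext_sign i S * ext_sign j (S - {i}))"
        using that by (auto simp: ext_sign_remove)
      ultimately show ?thesis
        by (simp add: f_def T_commute[OF tensor_exterior_nth[OF F], of j i])
    qed
    have "dirac_B K T (dirac_B K T F) $ S = (\<Sum>i\<in>S. \<Sum>j\<in>S - {i}. f i j)"
      by (simp add: dirac_B_nth dirac_B_in F f_def bounded_operator_sum[OF K T] tensor_exterior_nth
          bounded_operator_scaleC[OF T] bounded_operator_in[OF T] csubspace_scale[OF csubspace_K]
          complex_vector.scale_sum_right scaleC_scaleC)
    also have "\<dots> = (\<Sum>i\<in>S. \<Sum>j\<in>S. if i = j then 0 else f i j)"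
      by (intro sum.cong refl sum.mono_neutral_cong_left) auto
    finally have 1: "dirac_B K T (dirac_B K T F) $ S = (\<Sum>i\<in>S. \<Sum>j\<in>S. if i = j then 0 else f i j)" .
    also have "\<dots> = (\<Sum>j\<in>S. \<Sum>i\<in>S. if i = j then 0 else f i j)" by (rule sum.swap)
    also have "\<dots> = (\<Sum>j\<in>S. \<Sum>i\<in>S. - (if j = i then 0 else f j i))"
    proof (intro sum.cong refl)
      fix i j assume "i \<in> S" "j \<in> S"
      then show "(if i = j then 0 else f i j) = - (if j = i then 0 else f j i)"
        using anti[of i j] by (cases "i = j") simp_all
    qed
    also have "\<dots> = - dirac_B K T (dirac_B K T F) $ S" unfolding 1 by (simp add: sum_negf)
    finally have "2 *\<^sub>R dirac_B K T (dirac_B K T F) $ S = 0"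
      by (simp only: eq_neg_iff_add_eq_0 scaleR_2)
    then show ?thesis by simp
  qed
  then show ?thesis by (simp add: vec_eq_iff)
qed

text \<open>The mixed terms of \<open>B\<^sup>* B\<close> and \<open>B B\<^sup>*\<close> carry opposite signs and combine to cross commutators.\<close>

lemma dirac_laplacian_nth:
  assumes F: "F \<in> E"
  shows "(D\<^sub>B' (D\<^sub>B F) + D\<^sub>B (D\<^sub>B' F)) $ R =
    (\<Sum>i\<in>UNIV. T i (Ts i (F $ R))) + (\<Sum>i\<in>- R. op_commutator K (Ts i) (T i) (F $ R)) +
    (\<Sum>i\<in>- R. \<Sum>j\<in>R. (ext_sign i R * ext_sign j (insert i R)) *\<^sub>C
      op_commutator K (Ts i) (T j) (F $ (insert i R - {j})))"
proof -
  note in_K = tensor_exterior_nth[OF F] bounded_operator_in[OF T] bounded_operator_in[OF Ts]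
  have 1: "D\<^sub>B' (D\<^sub>B F) $ R = (\<Sum>i\<in>- R. Ts i (T i (F $ R)) + (\<Sum>j\<in>R. (ext_sign i R * ext_sign j (insert i R)) *\<^sub>C
      Ts i (T j (F $ (insert i R - {j})))))"
  proof -
    have "ext_sign i R *\<^sub>C Ts i (D\<^sub>B F $ insert i R) = Ts i (T i (F $ R)) +
        (\<Sum>j\<in>R. (ext_sign i R * ext_sign j (insert i R)) *\<^sub>C Ts i (T j (F $ (insert i R - {j}))))" if "i \<in> - R" for i
    proof -
      have "D\<^sub>B F $ insert i R = ext_sign i (insert i R) *\<^sub>C T i (F $ R) +
          (\<Sum>j\<in>R. ext_sign j (insert i R) *\<^sub>C T j (F $ (insert i R - {j})))"
        using that by (simp add: dirac_B_nth[OF F])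
      also have "Ts i \<dots> = ext_sign i (insert i R) *\<^sub>C Ts i (T i (F $ R)) +
          (\<Sum>j\<in>R. ext_sign j (insert i R) *\<^sub>C Ts i (T j (F $ (insert i R - {j}))))"
        by (simp add: bounded_operator_add[OF Ts] bounded_operator_sum[OF K Ts] bounded_operator_scaleC[OF Ts]
            in_K csubspace_scale[OF csubspace_K] csubspace_sum[OF csubspace_K])
      finally show ?thesis
        using that by (simp add: ext_sign_insert scaleC_add_right complex_vector.scale_sum_right scaleC_scaleC)
    qed
    then show ?thesis
      by (simp add: adjoint_dirac_B_nth dirac_B_in F)
  qed
  have 2: "D\<^sub>B (D\<^sub>B' F) $ R = (\<Sum>j\<in>R. T j (Ts j (F $ R)) - (\<Sum>i\<in>- R. (ext_sign i R * ext_sign j (insert i R)) *\<^sub>C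
      T j (Ts i (F $ (insert i R - {j})))))"
  proof -
    have "ext_sign j R *\<^sub>C T j (D\<^sub>B' F $ (R - {j})) = T j (Ts j (F $ R)) -
        (\<Sum>i\<in>- R. (ext_sign i R * ext_sign j (insert i R)) *\<^sub>C T j (Ts i (F $ (insert i R - {j}))))" if j: "j \<in> R" for j
    proof -
      have compl: "- (R - {j}) = insert j (- R)" using j by auto
      have "D\<^sub>B' F $ (R - {j}) = ext_sign j (R - {j}) *\<^sub>C Ts j (F $ R) +
          (\<Sum>i\<in>- R. ext_sign i (R - {j}) *\<^sub>C Ts i (F $ insert i (R - {j})))"
        using j by (simp add: adjoint_dirac_B_nth[OF F] compl insert_absorb)
      also have "T j \<dots> = ext_sign j (R - {j}) *\<^sub>C T j (Ts j (F $ R)) +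
          (\<Sum>i\<in>- R. ext_sign i (R - {j}) *\<^sub>C T j (Ts i (F $ insert i (R - {j}))))"
        by (simp add: bounded_operator_add[OF T] bounded_operator_sum[OF K T] bounded_operator_scaleC[OF T]
            in_K csubspace_scale[OF csubspace_K] csubspace_sum[OF csubspace_K])
      finally have "ext_sign j R *\<^sub>C T j (D\<^sub>B' F $ (R - {j})) = T j (Ts j (F $ R)) +
          (\<Sum>i\<in>- R. (ext_sign j R * ext_sign i (R - {j})) *\<^sub>C T j (Ts i (F $ insert i (R - {j}))))"
        using j by (simp add: ext_sign_remove scaleC_add_right complex_vector.scale_sum_right scaleC_scaleC)
      also have "(\<Sum>i\<in>- R. (ext_sign j R * ext_sign i (R - {j})) *\<^sub>C T j (Ts i (F $ insert i (R - {j})))) =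
          (\<Sum>i\<in>- R. - ((ext_sign i R * ext_sign j (insert i R)) *\<^sub>C T j (Ts i (F $ (insert i R - {j})))))"
      proof (rule sum.cong[OF refl])
        fix i assume i: "i \<in> - R"
        have "insert i (R - {j}) = insert i R - {j}" "i \<noteq> j" using i j by auto
        moreover have "ext_sign j R * ext_sign i (R - {j}) = - (ext_sign i R * ext_sign j (insert i R))"
          using i j by (auto simp: ext_sign_remove ext_sign_insert)
        ultimately show "(ext_sign j R * ext_sign i (R - {j})) *\<^sub>C T j (Ts i (F $ insert i (R - {j}))) =
            - ((ext_sign i R * ext_sign j (insert i R)) *\<^sub>C T j (Ts i (F $ (insert i R - {j}))))"
          by simp
      qed
      finally show ?thesis by (simp add: sum_negf)
    qed
    then show ?thesis
      by (simp add: dirac_B_nth adjoint_on_in[OF E bounded_dirac_B] F)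
  qed
  have "(\<Sum>i\<in>UNIV. T i (Ts i (F $ R))) = (\<Sum>i\<in>R. T i (Ts i (F $ R))) + (\<Sum>i\<in>- R. T i (Ts i (F $ R)))"
    using sum.subset_diff[of R UNIV "\<lambda>i. T i (Ts i (F $ R))"] by (simp add: Compl_eq_Diff_UNIV add.commute)
  moreover have "(\<Sum>j\<in>R. \<Sum>i\<in>- R. (ext_sign i R * ext_sign j (insert i R)) *\<^sub>C T j (Ts i (F $ (insert i R - {j})))) =
      (\<Sum>i\<in>- R. \<Sum>j\<in>R. (ext_sign i R * ext_sign j (insert i R)) *\<^sub>C T j (Ts i (F $ (insert i R - {j}))))"
    by (rule sum.swap)
  ultimately show ?thesis
    unfolding vector_add_component 1 2
    by (simp add: op_commutator_def in_K sum.distrib sum_subtractf complex_vector.scale_right_diff_distrib)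
qed

text \<open>Since \<open>B^2 = 0\<close>, the square of \<open>norm (D F)\<close> is the quadratic
  form of \<open>B* B + B B*\<close> at \<open>F\<close>. Orthogonality to \<open>\<B> m\<close>
  bounds every error term of this operator minus the identity by a multiple of
  \<open>norm F / (m + 1)\<close>.\<close>

lemma dirac_bounded_below:
  "\<exists>m. \<forall>F\<in>E. (\<forall>S. \<forall>b\<in>\<B> m. cinner (F $ S) b = 0) \<longrightarrow> norm F \<le> 2 * norm (dirac K T F)"
proof -
  have "\<exists>C. \<forall>p. \<forall>x\<in>K. C p \<ge> 0 \<and> norm (op_commutator K (Ts (fst p)) (T (snd p)) x) \<le> C p * \<delta> x"
    using cross_comm unfolding dominated_def by (intro choice) blast
  then obtain C' where C': "\<And>p x. x \<in> K \<Longrightarrow> C' p \<ge> 0 \<and> norm (op_commutator K (Ts (fst p)) (T (snd p)) x) \<le> C' p * \<delta> x"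
    by blast
  \<comment> \<open>The sum dominates each single constant and so serves all pairs
    \<open>(i, j)\<close> at once.\<close>
  define C where "C = (\<Sum>p\<in>UNIV. \<bar>C' p\<bar>)"
  have C: "norm (op_commutator K (Ts i) (T j) x) \<le> C * \<delta> x" if "x \<in> K" for i j x
  proof -
    have "C' (i, j) \<le> C" unfolding C_def
      using member_le_sum[of "(i, j)" UNIV "\<lambda>p. \<bar>C' p\<bar>"] by simp
    then show ?thesis
      using C'[OF that, of "(i, j)"] mult_right_mono[OF _ seminorm_nonneg, of "C' (i, j)" C x] by simp
  qed
  have "C \<ge> 0" by (simp add: C_def sum_nonneg)
  obtain C1 where C1: "C1 \<ge> 0" "\<And>x. x \<in> K \<Longrightarrow> norm ((\<Sum>i\<in>UNIV. T i (Ts i x)) - x) \<le> C1 * \<delta> x"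
    using sum_T by blast
  define N where "N = real CARD('d)"
  \<comment> \<open>The three summands bound the error of the sum of the
    \<open>T i (Ts i x)\<close>, the diagonal commutators and the mixed ones, in each of the
    \<open>CARD('d set)\<close> components.\<close>
  define Q where "Q = real CARD('d set) * (C1 + N * C + N * (N * C))"
  have "Q \<ge> 0" using C1 \<open>C \<ge> 0\<close> by (simp add: Q_def N_def)
  \<comment> \<open>Beyond \<open>2 * Q\<close> the total error \<open>Q / (m + 1)\<close> is at
    most one half.\<close>
  obtain m where m: "2 * Q < real m" using reals_Archimedean2 by blast
  have "norm F \<le> 2 * norm (dirac K T F)" if F: "F \<in> E" and orth: "\<And>S. \<forall>b\<in>\<B> m. cinner (F $ S) b = 0" for F
  proof -
    define e where "e = norm F / real (Suc m)"
    have "e \<ge> 0" by (simp add: e_def)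
    have de: "\<delta> (F $ S) \<le> e" for S
    proof -
      have "\<delta> (F $ S) \<le> norm (F $ S) / real (Suc m)"
        by (rule seminorm_decay[OF tensor_exterior_nth[OF F] orth])
      also have "\<dots> \<le> e" unfolding e_def by (intro divide_right_mono Finite_Cartesian_Product.norm_nth_le) simp
      finally show ?thesis .
    qed
    have comm_le: "norm (op_commutator K (Ts i) (T j) (F $ S)) \<le> C * e" for i j S
      using C[OF tensor_exterior_nth[OF F], of i j S] mult_left_mono[OF de \<open>C \<ge> 0\<close>, of S] by linarith
    let ?L = "D\<^sub>B' (D\<^sub>B F) + D\<^sub>B (D\<^sub>B' F)"
    have card_le: "real (card R) \<le> N" for R :: "'d set" unfolding N_def by (simp add: card_mono)
    have comp: "norm ((?L - F) $ R) \<le> (C1 + N * C + N * (N * C)) * e" for R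
    proof -
      let ?a = "(\<Sum>i\<in>UNIV. T i (Ts i (F $ R))) - F $ R"
      let ?b = "\<Sum>i\<in>- R. op_commutator K (Ts i) (T i) (F $ R)"
      let ?c = "\<Sum>i\<in>- R. \<Sum>j\<in>R. (ext_sign i R * ext_sign j (insert i R)) *\<^sub>C
        op_commutator K (Ts i) (T j) (F $ (insert i R - {j}))"
      have "norm ?a \<le> C1 * e"
        using C1(2)[OF tensor_exterior_nth[OF F]] mult_left_mono[OF de C1(1)] by (rule order_trans)
      moreover have "norm ?b \<le> N * (C * e)"
      proof -
        have "norm ?b \<le> (\<Sum>i\<in>- R. C * e)" by (intro sum_norm_le comm_le)
        also have "\<dots> \<le> N * (C * e)"
          using card_le[of "- R"] \<open>C \<ge> 0\<close> \<open>e \<ge> 0\<close> by (simp add: mult_right_mono)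
        finally show ?thesis .
      qed
      moreover have "norm ?c \<le> N * (N * (C * e))"
      proof -
        have "norm ?c \<le> (\<Sum>i\<in>- R. \<Sum>j\<in>R. C * e)"
          by (intro sum_norm_le) (simp add: norm_scaleC norm_mult comm_le)
        also have "\<dots> \<le> (\<Sum>i\<in>- R. N * (C * e))"
          using card_le[of R] \<open>C \<ge> 0\<close> \<open>e \<ge> 0\<close> by (intro sum_mono) (simp add: mult_right_mono)
        also have "\<dots> \<le> N * (N * (C * e))"
          using card_le[of "- R"] \<open>C \<ge> 0\<close> \<open>e \<ge> 0\<close> by (simp add: mult_right_mono N_def)
        finally show ?thesis .
      qed
      moreover have eq: "(?L - F) $ R = ?a + ?b + ?c"
        using dirac_laplacian_nth[OF F, of R] by simp
      have "norm ((?L - F) $ R) \<le> norm ?a + norm ?b + norm ?c"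
        unfolding eq using norm_triangle_ineq[of "?a + ?b" ?c] norm_triangle_ineq[of ?a ?b] by linarith
      ultimately show ?thesis by (simp add: distrib_right mult.assoc)
    qed
    have "norm (?L - F) \<le> (\<Sum>R\<in>(UNIV :: 'd set set). (C1 + N * C + N * (N * C)) * e)"
      by (intro order_trans[OF norm_vec_le_sum] sum_mono comp)
    also have "\<dots> = Q * e" by (simp add: Q_def)
    also have "\<dots> \<le> norm F / 2"
    proof -
      have "2 * Q \<le> real (Suc m)" using m by simp
      then have "2 * Q * norm F \<le> real (Suc m) * norm F" by (intro mult_right_mono) auto
      then show ?thesis by (simp add: e_def field_simps del: of_nat_Suc)
    qed
    finally have L: "norm (?L - F) \<le> norm F / 2" .
    note DF = dirac_B_in[OF F] adjoint_on_in[OF E bounded_dirac_B F]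
    have "cinner (D\<^sub>B F) (D\<^sub>B' F) = 0"
      using cinner_adjoint_on[OF E bounded_dirac_B DF(1) F] by (simp add: dirac_B_dirac_B[OF F])
    then have "(norm (dirac K T F))\<^sup>2 = (norm (D\<^sub>B F))\<^sup>2 + (norm (D\<^sub>B' F))\<^sup>2"
      using F by (simp add: dirac_def norm_add_orth)
    moreover have "cinner ?L F = complex_of_real ((norm (D\<^sub>B F))\<^sup>2 + (norm (D\<^sub>B' F))\<^sup>2)"
    proof -
      have "cinner (D\<^sub>B' (D\<^sub>B F)) F = cinner (D\<^sub>B F) (D\<^sub>B F)"
        by (rule cinner_adjoint_on_left[OF E bounded_dirac_B F DF(1)])
      moreover have "cinner (D\<^sub>B (D\<^sub>B' F)) F = cinner (D\<^sub>B' F) (D\<^sub>B' F)"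
        by (rule cinner_adjoint_on[OF E bounded_dirac_B DF(2) F, symmetric])
      ultimately show ?thesis by (simp add: cinner_add_left cinner_self)
    qed
    ultimately have "(norm (dirac K T F))\<^sup>2 = inner ?L F"
      by (simp add: inner_cinner)
    also have "\<dots> = (norm F)\<^sup>2 + inner (?L - F) F"
      by (simp add: inner_diff_left power2_norm_eq_inner)
    also have "\<dots> \<ge> (norm F)\<^sup>2 - norm F / 2 * norm F"
      using Cauchy_Schwarz_ineq2[of "?L - F" F] mult_right_mono[OF L norm_ge_zero, of F] by linarith
    \<comment> \<open>This yields the factor \<open>sqrt 2\<close>, which is rounded up to
      \<open>2\<close>.\<close>
    finally have "(norm F)\<^sup>2 / 2 \<le> (norm (dirac K T F))\<^sup>2"
      by (simp add: power2_eq_square)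
    then have "(norm F)\<^sup>2 \<le> (2 * norm (dirac K T F))\<^sup>2"
      using zero_le_power2[of "norm (dirac K T F)"] unfolding four_x_squared[symmetric] by linarith
    then show ?thesis by (rule power2_le_imp_le) simp
  qed
  then show ?thesis by blast
qed

text \<open>Copies of \<open>\<B> m\<close> in all exterior components form a finite orthonormal
  family in the product space, and \<open>D\<close> is bounded below on the vectors of the tensor
  product orthogonal to it.\<close>

theorem fredholm_multioperatorI: "fredholm_multioperator K T"
proof -
  obtain m where m: "\<And>F. F \<in> E \<Longrightarrow> (\<forall>S. \<forall>b\<in>\<B> m. cinner (F $ S) b = 0) \<Longrightarrow> norm F \<le> 2 * norm (dirac K T F)"
    using dirac_bounded_below by blast
  define \<B>' where "\<B>' = (\<lambda>(S, b). axis S b :: 'a ^ 'd set) ` (UNIV \<times> \<B> m)"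
  have \<B>': "finite \<B>'" by (simp add: \<B>'_def finite_basis)
  have nz: "b \<noteq> 0" if "b \<in> \<B> m" for b using orthonormal_norm[OF orthonormal_basis that] by auto
  have inj: "inj_on (\<lambda>(S, b). axis S b :: 'a ^ 'd set) (UNIV \<times> \<B> m)"
    using nz by (auto simp: inj_on_def axis_eq_axis)
  have ortho: "orthonormal \<B>'"
    unfolding orthonormal_def
  proof (intro ballI)
    fix x y assume "x \<in> \<B>'" "y \<in> \<B>'"
    then obtain S b S' b' where x: "x = axis S b" "b \<in> \<B> m" and y: "y = axis S' b'" "b' \<in> \<B> m"
      by (auto simp: \<B>'_def)
    have "x = y \<longleftrightarrow> S = S' \<and> b = b'"
      using nz x y by (auto simp: axis_eq_axis)
    moreover have "cinner x y = (if S = S' then cinner b b' else 0)"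
      unfolding x y cinner_axis by (simp add: axis_def)
    ultimately show "cinner x y = (if x = y then 1 else 0)"
      using orthonormal_basis[of m] x y by (auto simp: orthonormal_def)
  qed
  have nth: "fourier_sum \<B>' F $ S = fourier_sum (\<B> m) (F $ S)" for F S
  proof -
    have "fourier_sum \<B>' F $ S = (\<Sum>(R, b)\<in>UNIV \<times> \<B> m. if R = S then cinner (F $ S) b *\<^sub>C b else 0)"
      unfolding fourier_sum_def \<B>'_def sum.reindex[OF inj] sum_component
    proof (intro sum.cong refl)
      fix p :: "'d set \<times> 'a" assume "p \<in> UNIV \<times> \<B> m"
      obtain R b where p: "p = (R, b)" by fastforce
      have "axis R b $ S = (if R = S then b else 0)" by (simp add: axis_def)
      then show "((\<lambda>b. cinner F b *\<^sub>C b) \<circ> (\<lambda>(S, b). axis S b)) p $ S =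
          (case p of (R, b) \<Rightarrow> if R = S then cinner (F $ S) b *\<^sub>C b else 0)"
        by (simp add: p cinner_axis scaleC_vec_def)
    qed
    also have "\<dots> = (\<Sum>R\<in>UNIV. \<Sum>b\<in>\<B> m. if R = S then cinner (F $ S) b *\<^sub>C b else 0)"
      by (rule sum.cartesian_product[symmetric])
    also have "\<dots> = (\<Sum>R\<in>UNIV. if R = S then fourier_sum (\<B> m) (F $ S) else 0)"
      by (intro sum.cong) (auto simp: fourier_sum_def)
    finally show ?thesis by simp
  qed
  have in_E: "fourier_sum \<B>' F \<in> E" if "F \<in> E" for F
    using that by (auto simp: tensor_exterior_def nth fourier_sum_in)
  have D: "bounded_operator E (dirac K T)"
    unfolding dirac_def by (intro bounded_operator_plus E bounded_dirac_B bounded_adjoint_dirac_B)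
  have below: "norm F \<le> 2 * norm (dirac K T F)" if "F \<in> E" "\<forall>b\<in>\<B>'. cinner F b = 0" for F
  proof (rule m[OF that(1)], intro allI ballI)
    fix S b assume "b \<in> \<B> m"
    then have "axis S b \<in> \<B>'" by (auto simp: \<B>'_def)
    then show "cinner (F $ S) b = 0" using that(2) cinner_axis[of F S b] by auto
  qed
  have "multioperator K T"
    unfolding multioperator_def using T T_commute by (auto simp: compose_def fun_eq_iff)
  then show ?thesis
    unfolding fredholm_multioperator_def
    using closed_range[OF E D \<B>' ortho in_E below] finite_dimensional_kernel[OF E D \<B>' ortho in_E below]
    by blast
qed

end

end


section \<open>Normalized Taylor coefficients\<close>

definition total_degree :: "('d::finite \<Rightarrow> nat) \<Rightarrow> nat"
  where "total_degree n = (\<Sum>k\<in>UNIV. n k)"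

definition raise_index :: "'d \<Rightarrow> ('d \<Rightarrow> nat) \<Rightarrow> 'd \<Rightarrow> nat"
  where "raise_index k n = n(k := Suc (n k))"

definition lower_index :: "'d \<Rightarrow> ('d \<Rightarrow> nat) \<Rightarrow> 'd \<Rightarrow> nat"
  where "lower_index k n = n(k := n k - 1)"

lemma raise_index_same [simp]: "raise_index k n k = Suc (n k)"
  and raise_index_other: "j \<noteq> k \<Longrightarrow> raise_index k n j = n j"
  and lower_index_same [simp]: "lower_index k n k = n k - 1"
  and lower_index_other: "j \<noteq> k \<Longrightarrow> lower_index k n j = n j"
  by (simp_all add: raise_index_def lower_index_def)

lemma lower_raise_index [simp]: "lower_index k (raise_index k n) = n"
  by (simp add: raise_index_def lower_index_def)

lemma raise_lower_index: "n k > 0 \<Longrightarrow> raise_index k (lower_index k n) = n"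
  by (auto simp: raise_index_def lower_index_def)

lemma raise_index_commute: "raise_index j (raise_index k n) = raise_index k (raise_index j n)"
  by (auto simp: raise_index_def fun_eq_iff)

lemma lower_raise_index_commute: "j \<noteq> k \<Longrightarrow> lower_index k (raise_index j n) = raise_index j (lower_index k n)"
  by (auto simp: raise_index_def lower_index_def fun_eq_iff)

lemma degree_raise_index [simp]: "total_degree (raise_index k n) = Suc (total_degree n)"
  unfolding total_degree_def raise_index_def by (rule sum_fun_upd_Suc)

lemma degree_lower_index: "n k > 0 \<Longrightarrow> total_degree n = Suc (total_degree (lower_index k n))"
  using degree_raise_index[of k "lower_index k n"] by (simp add: raise_lower_index)

lemma index_le_degree: "n k \<le> total_degree n"
  unfolding total_degree_def by (rule member_le_sum) auto

lemma index_add_le_degree: "j \<noteq> k \<Longrightarrow> n j + n k \<le> total_degree n"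
  unfolding total_degree_def using sum_mono2[of UNIV "{j, k}" n] by simp

lemma weight_raise_index: "weight (raise_index k n) = real (Suc (n k)) / real (Suc (total_degree n)) * weight n"
  unfolding raise_index_def total_degree_def by (rule weight_fun_upd_Suc)

lemma finite_degree_less: "finite {n :: 'd::finite \<Rightarrow> nat. total_degree n < m}"
  and card_degree_less: "card {n :: 'd::finite \<Rightarrow> nat. total_degree n < m} \<le> m ^ CARD('d)"
proof -
  have "{n :: 'd \<Rightarrow> nat. total_degree n < m} \<subseteq> PiE UNIV (\<lambda>_. {..<m})"
    by (auto simp: PiE_def intro: le_less_trans[OF index_le_degree])
  moreover have "finite (PiE (UNIV :: 'd set) (\<lambda>_. {..<m}))" by (intro finite_PiE) auto
  moreover have "card (PiE (UNIV :: 'd set) (\<lambda>_. {..<m})) = m ^ CARD('d)" by (simp add: card_PiE)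
  ultimately show "finite {n :: 'd \<Rightarrow> nat. total_degree n < m}" "card {n :: 'd \<Rightarrow> nat. total_degree n < m} \<le> m ^ CARD('d)"
    using finite_subset card_mono by metis+
qed

lemma has_sum_finite_sum:
  fixes f :: "'i \<Rightarrow> 'n \<Rightarrow> 'b::topological_comm_monoid_add"
  assumes "finite I" "\<And>i. i \<in> I \<Longrightarrow> (f i has_sum s i) A"
  shows "((\<lambda>n. \<Sum>i\<in>I. f i n) has_sum (\<Sum>i\<in>I. s i)) A"
  using assms by (induction I) (auto intro: has_sum_add)

text \<open>Raising an index does not increase the weight, so the shifted coefficients are
  square-summable; uniqueness of the expansion then identifies them.\<close>

lemma taylor_coeff_coord_mult:
  "taylor_coeff (coord_mult k f) n = (if n k = 0 then 0 else taylor_coeff f (lower_index k n))"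
proof -
  define b where "b n = (if n k = 0 then 0 else taylor_coeff f (lower_index k n))" for n
  have bij: "bij_betw (raise_index k) UNIV {n. n k \<noteq> 0}"
    by (rule bij_betw_byWitness[where f' = "lower_index k"]) (auto simp: raise_lower_index)
  have b_raise: "b (raise_index k n) = taylor_coeff f n" for n by (simp add: b_def)
  have "square_summable b"
    unfolding square_summable_def
  proof (rule nonneg_bounded_partial_sums_imp_summable_on)
    show "\<forall>\<^sub>F F in finite_subsets_at_top UNIV. (\<Sum>n\<in>F. weight n * (cmod (b n))\<^sup>2) \<le> (norm f)\<^sup>2"
    proof (rule eventually_finite_subsets_at_top_weakI)
      fix F :: "('a \<Rightarrow> nat) set" assume F: "finite F"
      have "(\<Sum>n\<in>F. weight n * (cmod (b n))\<^sup>2) = (\<Sum>n\<in>{n \<in> F. n k \<noteq> 0}. weight n * (cmod (b n))\<^sup>2)"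
        using F by (intro sum.mono_neutral_right) (auto simp: b_def)
      also have "\<dots> = (\<Sum>n\<in>lower_index k ` {n \<in> F. n k \<noteq> 0}. weight (raise_index k n) * (cmod (taylor_coeff f n))\<^sup>2)"
        by (rule sum.reindex_bij_witness[where i = "raise_index k" and j = "lower_index k"])
          (auto simp: raise_lower_index b_def)
      also have "\<dots> \<le> (\<Sum>n\<in>lower_index k ` {n \<in> F. n k \<noteq> 0}. weight n * (cmod (taylor_coeff f n))\<^sup>2)"
      proof (intro sum_mono mult_right_mono)
        fix n :: "'a \<Rightarrow> nat"
        have "real (Suc (n k)) / real (Suc (total_degree n)) \<le> 1"
          using index_le_degree[of n k] by simp
        from mult_right_mono[OF this weight_nonneg, of n] show "weight (raise_index k n) \<le> weight n"
          unfolding weight_raise_index by simp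
      qed simp
      also have "\<dots> \<le> (norm f)\<^sup>2" using F by (intro sum_coeff_le_norm) simp
      finally show "(\<Sum>n\<in>F. weight n * (cmod (b n))\<^sup>2) \<le> (norm f)\<^sup>2" .
    qed
  qed simp
  moreover have "power_series_on_ball b (fock_fun (coord_mult k f))"
    unfolding power_series_on_ball_def
  proof
    fix z :: "complex ^ 'a" assume z: "z \<in> ball 0 1"
    have "((\<lambda>n. z $ k * (taylor_coeff f n * zpow z n)) has_sum z $ k * fock_fun f z) UNIV"
      using power_series_taylor_coeff[of f] z by (intro has_sum_cmult_right) (auto simp: power_series_on_ball_def)
    then have "((\<lambda>n. b (raise_index k n) * zpow z (raise_index k n)) has_sum fock_fun (coord_mult k f) z) UNIV"
      using zpow_fun_upd_Suc[of z _ k] by (simp add: b_raise coord_mult.rep_eq raise_index_def[symmetric] mult_ac)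
    then have "((\<lambda>n. b n * zpow z n) has_sum fock_fun (coord_mult k f) z) {n. n k \<noteq> 0}"
      by (simp only: has_sum_reindex_bij_betw[OF bij, of "\<lambda>n. b n * zpow z n"])
    then show "((\<lambda>n. b n * zpow z n) has_sum fock_fun (coord_mult k f) z) UNIV"
      by (rule has_sum_cong_neutral[THEN iffD1, rotated -1]) (auto simp: b_def)
  qed
  ultimately have "taylor_coeff (coord_mult k f) = b" by (rule taylor_coeff_eqI)
  then show ?thesis by (simp add: b_def)
qed

text \<open>Coordinates in the orthonormal basis of normalized monomials, with all \<open>r\<close>
  components collected in one vector of \<open>\<complex>^r\<close>. The factor
  \<open>sqrt (weight n)\<close> makes Parseval hold without weights and turns the shifts into
  weighted shifts.\<close>

definition coef :: "'d::finite fock ^ 'r::finite \<Rightarrow> ('d \<Rightarrow> nat) \<Rightarrow> complex ^ 'r"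
  where "coef F n = (\<chi> i. complex_of_real (sqrt (weight n)) * taylor_coeff (F $ i) n)"

lemma coef_add: "coef (F + G) n = coef F n + coef G n"
  by (simp add: coef_def vec_eq_iff taylor_coeff_add distrib_left)

lemma coef_diff: "coef (F - G) n = coef F n - coef G n"
  by (simp add: coef_def vec_eq_iff taylor_coeff_diff right_diff_distrib)

lemma coef_scaleC: "coef (c *\<^sub>C F) n = c *\<^sub>C coef F n"
  by (simp add: coef_def vec_eq_iff taylor_coeff_scaleC scaleC_vec_def scaleC_complex_def)

lemma coef_zero [simp]: "coef 0 n = 0"
  by (simp add: coef_def vec_eq_iff taylor_coeff_zero)

lemma coef_sum: "coef (\<Sum>i\<in>I. F i) n = (\<Sum>i\<in>I. coef (F i) n)"
  by (induction I rule: infinite_finite_induct) (simp_all add: coef_add)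

lemma coef_eqI:
  assumes "\<And>n. coef F n = coef G n" shows "F = G"
proof -
  have "taylor_coeff (F $ i) n = taylor_coeff (G $ i) n" for i n
    using arg_cong[OF assms[of n], of "\<lambda>v. v $ i"] by (simp add: coef_def less_imp_neq[OF weight_pos, symmetric])
  then show ?thesis by (simp add: vec_eq_iff fock_eqI fun_eq_iff)
qed

lemma power2_norm_vec:
  fixes v :: "'a::real_normed_vector ^ 'i::finite"
  shows "(norm v)\<^sup>2 = (\<Sum>i\<in>UNIV. (norm (v $ i))\<^sup>2)"
  by (simp add: norm_vec_def L2_set_def sum_nonneg)

lemma has_sum_norm_coef: "((\<lambda>n. (norm (coef F n))\<^sup>2) has_sum (norm F)\<^sup>2) UNIV"
proof -
  have "((\<lambda>n. weight n * (cmod (taylor_coeff (F $ i) n))\<^sup>2) has_sum (norm (F $ i))\<^sup>2) UNIV" for i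
    unfolding norm_fock using square_summable_taylor_coeff[of "F $ i"]
    by (intro has_sum_infsum) (simp add: square_summable_def)
  then have "((\<lambda>n. \<Sum>i\<in>UNIV. weight n * (cmod (taylor_coeff (F $ i) n))\<^sup>2) has_sum (\<Sum>i\<in>UNIV. (norm (F $ i))\<^sup>2)) UNIV"
    by (intro has_sum_finite_sum) auto
  moreover have "(norm (coef F n))\<^sup>2 = (\<Sum>i\<in>UNIV. weight n * (cmod (taylor_coeff (F $ i) n))\<^sup>2)" for n
    by (simp add: power2_norm_vec coef_def norm_mult power_mult_distrib)
  ultimately show ?thesis by (simp add: power2_norm_vec[of F])
qed

lemma sum_norm_coef_le: "finite A \<Longrightarrow> (\<Sum>n\<in>A. (norm (coef F n))\<^sup>2) \<le> (norm F)\<^sup>2"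
  using finite_sum_le_has_sum[OF has_sum_norm_coef, of A] by simp

lemma norm_coef_le: "norm (coef F n) \<le> norm F"
  using sum_norm_coef_le[of "{n}" F] by (auto intro: power2_le_imp_le)

lemma bounded_linear_coef: "bounded_linear (\<lambda>F :: 'd::finite fock ^ 'r::finite. coef F n)"
proof (rule bounded_linear_intro[of _ 1])
  show "coef (c *\<^sub>R F) n = c *\<^sub>R coef F n" for c and F :: "'d fock ^ 'r"
    unfolding scaleR_scaleC by (rule coef_scaleC)
qed (simp_all add: coef_add norm_coef_le)

text \<open>Norm bound for weighted shifts: each coefficient of \<open>G\<close> is charged to one
  coefficient of \<open>F\<close>, and injectivity of \<open>\<sigma>\<close> on \<open>S\<close>
  prevents charging twice. \<open>S\<close> can leave out the indices that the shift does not
  reach.\<close>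

lemma norm_le_reindex:
  fixes F G :: "'d::finite fock ^ 'r::finite"
  assumes inj: "inj_on \<sigma> S" and C: "C \<ge> 0"
    and le: "\<And>n. n \<in> S \<Longrightarrow> norm (coef G n) \<le> C * norm (coef F (\<sigma> n))"
    and zero: "\<And>n. n \<notin> S \<Longrightarrow> coef G n = 0"
  shows "norm G \<le> C * norm F"
proof -
  have "(norm G)\<^sup>2 \<le> (C * norm F)\<^sup>2"
  proof (rule has_sum_le_finite_sums[OF has_sum_norm_coef])
    fix A :: "('d \<Rightarrow> nat) set" assume A: "finite A"
    have "(\<Sum>n\<in>A. (norm (coef G n))\<^sup>2) = (\<Sum>n\<in>A \<inter> S. (norm (coef G n))\<^sup>2)"
      using A zero by (intro sum.mono_neutral_right) auto
    also have "\<dots> \<le> (\<Sum>n\<in>A \<inter> S. (C * norm (coef F (\<sigma> n)))\<^sup>2)"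
      using le by (intro sum_mono power_mono) auto
    also have "\<dots> = C\<^sup>2 * (\<Sum>n\<in>\<sigma> ` (A \<inter> S). (norm (coef F n))\<^sup>2)"
      using inj by (subst sum.reindex) (auto simp: power_mult_distrib sum_distrib_left intro: inj_on_subset)
    also have "\<dots> \<le> C\<^sup>2 * (norm F)\<^sup>2"
      using A by (intro mult_left_mono sum_norm_coef_le) auto
    finally show "(\<Sum>n\<in>A. (norm (coef G n))\<^sup>2) \<le> (C * norm F)\<^sup>2" by (simp add: power_mult_distrib)
  qed
  then show ?thesis using C by (intro power2_le_imp_le[of "norm G"]) auto
qed

lemma norm_le_coef:
  fixes F G :: "'d::finite fock ^ 'r::finite"
  assumes "C \<ge> 0" "\<And>n. norm (coef G n) \<le> C * norm (coef F n)"
  shows "norm G \<le> C * norm F"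
  by (rule norm_le_reindex[where \<sigma> = "\<lambda>n. n" and S = UNIV]) (use assms in auto)

definition basis_vector :: "('d::finite \<Rightarrow> nat) \<Rightarrow> complex ^ 'r \<Rightarrow> 'd fock ^ 'r::finite"
  where "basis_vector n \<zeta> = simple_tensor (complex_of_real (1 / sqrt (weight n)) *\<^sub>C z_monomial n) \<zeta>"

lemma coef_basis_vector: "coef (basis_vector n \<zeta>) m = (if m = n then \<zeta> else 0)"
  by (simp add: coef_def basis_vector_def simple_tensor_def vec_eq_iff taylor_coeff_scaleC
      taylor_coeff_z_monomial less_imp_neq[OF weight_pos, symmetric])

lemma cinner_basis_vector: "cinner F (basis_vector n \<zeta>) = cinner (coef F n) \<zeta>"
proof -
  have *: "cinner f (z_monomial n) = complex_of_real (weight n) * taylor_coeff f n" for f :: "'a fock"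
  proof -
    have "cinner f (z_monomial n) = (\<Sum>\<^sub>\<infinity>m\<in>{n}. complex_of_real (weight m) * taylor_coeff f m)"
      unfolding cinner_fock_def taylor_coeff_z_monomial by (rule infsum_cong_neutral) auto
    then show ?thesis by simp
  qed
  have w: "complex_of_real (weight n) / complex_of_real (sqrt (weight n)) = complex_of_real (sqrt (weight n))"
    unfolding of_real_divide[symmetric] by (simp add: real_div_sqrt)
  show ?thesis
    unfolding cinner_vec_def
  proof (intro sum.cong refl)
    fix i
    have "cinner (F $ i) (basis_vector n \<zeta> $ i) =
        cnj (\<zeta> $ i) * (complex_of_real (weight n) / complex_of_real (sqrt (weight n))) * taylor_coeff (F $ i) n"
      by (simp add: basis_vector_def simple_tensor_def cinner_scaleC_right *)
    then show "cinner (F $ i) (basis_vector n \<zeta> $ i) = cinner (coef F n $ i) (\<zeta> $ i)"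
      unfolding w by (simp add: coef_def cinner_complex_def)
  qed
qed

lemma basis_vector_add: "basis_vector n (\<zeta> + \<eta>) = basis_vector n \<zeta> + basis_vector n \<eta>"
  by (rule coef_eqI) (simp add: coef_basis_vector coef_add)

lemma basis_vector_scaleC: "basis_vector n (c *\<^sub>C \<zeta>) = c *\<^sub>C basis_vector n \<zeta>"
  by (rule coef_eqI) (simp add: coef_basis_vector coef_scaleC)

lemma basis_vector_zero [simp]: "basis_vector n 0 = 0"
  by (rule coef_eqI) (simp add: coef_basis_vector)

lemma basis_vector_sum: "basis_vector n (\<Sum>i\<in>I. f i) = (\<Sum>i\<in>I. basis_vector n (f i))"
  by (induction I rule: infinite_finite_induct) (simp_all add: basis_vector_add)

lemma norm_basis_vector: "norm (basis_vector n \<zeta>) = norm \<zeta>"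
proof -
  have "cinner (basis_vector n \<zeta>) (basis_vector n \<zeta>) = cinner \<zeta> \<zeta>"
    by (simp add: cinner_basis_vector coef_basis_vector)
  then have "(norm (basis_vector n \<zeta>))\<^sup>2 = (norm \<zeta>)\<^sup>2"
    unfolding cinner_self by (simp only: of_real_eq_iff)
  then show ?thesis by simp
qed

lemma bounded_linear_basis_vector:
  "bounded_linear (basis_vector n :: complex ^ 'r::finite \<Rightarrow> 'd::finite fock ^ 'r)"
proof (rule bounded_linear_intro[of _ 1])
  show "(basis_vector n (c *\<^sub>R \<zeta>) :: 'd fock ^ 'r) = c *\<^sub>R basis_vector n \<zeta>" for c and \<zeta> :: "complex ^ 'r"
    unfolding scaleR_scaleC by (rule basis_vector_scaleC)
qed (simp_all add: basis_vector_add norm_basis_vector)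

text \<open>If \<open>n k = 0\<close> then \<open>lower_index k n = n\<close> by truncated subtraction, but the factor in front
  vanishes (also for \<open>n = 0\<close>, where it is \<open>0 / 0 = 0\<close>).\<close>

lemma coef_d_shift:
  "coef (d_shift k F) n = complex_of_real (sqrt (real (n k) / real (total_degree n))) *\<^sub>C coef F (lower_index k n)"
proof (cases "n k = 0")
  case True
  then show ?thesis by (simp add: coef_def d_shift_def taylor_coeff_coord_mult vec_eq_iff scaleC_vec_def)
next
  case False
  let ?m = "lower_index k n"
  have "n = raise_index k ?m" using False by (simp add: raise_lower_index)
  then have "weight n = real (Suc (?m k)) / real (Suc (total_degree ?m)) * weight ?m"
    using weight_raise_index[of k ?m] by simp
  then have "weight n = real (n k) / real (total_degree n) * weight ?m"
    using False degree_lower_index[of n k] by simp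
  then have "sqrt (weight n) = sqrt (real (n k) / real (total_degree n)) * sqrt (weight ?m)"
    by (simp add: real_sqrt_mult[symmetric])
  then show ?thesis
    using False by (simp add: coef_def d_shift_def taylor_coeff_coord_mult vec_eq_iff scaleC_vec_def scaleC_complex_def)
qed

lemma d_shift_add: "d_shift k (F + G) = d_shift k F + d_shift k G"
  by (rule coef_eqI) (simp add: coef_d_shift coef_add scaleC_add_right)

lemma d_shift_diff: "d_shift k (F - G) = d_shift k F - d_shift k G"
  by (rule coef_eqI) (simp add: coef_d_shift coef_diff complex_vector.scale_right_diff_distrib)

lemma d_shift_scaleC: "d_shift k (c *\<^sub>C F) = c *\<^sub>C d_shift k F"
  by (rule coef_eqI) (simp add: coef_d_shift coef_scaleC scaleC_scaleC mult.commute)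

lemma d_shift_commute: "d_shift j (d_shift k F) = d_shift k (d_shift j F)"
proof -
  have "coord_mult j (coord_mult k f) = coord_mult k (coord_mult j f)" for f
    by transfer (simp add: fun_eq_iff)
  then show ?thesis by (simp add: d_shift_def)
qed

lemma d_shift_basis_vector:
  "d_shift k (basis_vector n \<zeta>) =
    complex_of_real (sqrt (real (Suc (n k)) / real (Suc (total_degree n)))) *\<^sub>C basis_vector (raise_index k n) \<zeta>"
proof (rule coef_eqI)
  fix m
  show "coef (d_shift k (basis_vector n \<zeta>)) m =
      coef (complex_of_real (sqrt (real (Suc (n k)) / real (Suc (total_degree n)))) *\<^sub>C basis_vector (raise_index k n) \<zeta>) m"
  proof (cases "m k = 0")
    case True
    then have "m \<noteq> raise_index k n" by auto
    with True show ?thesis by (simp add: coef_d_shift coef_scaleC coef_basis_vector)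
  next
    case False
    then have "lower_index k m = n \<longleftrightarrow> m = raise_index k n"
      using raise_lower_index[of m k] by auto
    then show ?thesis by (simp add: coef_d_shift coef_scaleC coef_basis_vector del: of_nat_Suc)
  qed
qed

lemma coefficient_le_1: "sqrt (real (n k) / real (total_degree n)) \<le> 1"
  using index_le_degree[of n k] by (cases "total_degree n = 0") (simp_all add: divide_le_eq_1)

lemma inj_on_lower_index: "inj_on (lower_index k) {n. n k > 0}"
  by (rule inj_on_inverseI[where g = "raise_index k"]) (simp add: raise_lower_index)

lemma norm_d_shift_le: "norm (d_shift k F) \<le> norm F"
proof -
  have "norm (d_shift k F) \<le> 1 * norm F"
  proof (rule norm_le_reindex[OF inj_on_lower_index[of k]])
    show "norm (coef (d_shift k F) n) \<le> 1 * norm (coef F (lower_index k n))" for n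
      unfolding coef_d_shift norm_scaleC using coefficient_le_1[of n k] by (intro mult_right_mono) auto
  qed (auto simp: coef_d_shift)
  then show ?thesis by simp
qed


section \<open>The degree seminorm\<close>

text \<open>An element of the Fock space with prescribed coefficients is available only through an
  existence statement, hence the \<open>SOME\<close>; \<open>coef_eqI\<close> makes the choice
  unique.\<close>

definition degree_smoothing :: "'d::finite fock ^ 'r::finite \<Rightarrow> 'd fock ^ 'r"
  where "degree_smoothing F = (SOME G. \<forall>n. coef G n = complex_of_real (1 / real (Suc (total_degree n))) *\<^sub>C coef F n)"

lemma coef_degree_smoothing:
  fixes F :: "'d::finite fock ^ 'r::finite"
  shows "coef (degree_smoothing F) n = complex_of_real (1 / real (Suc (total_degree n))) *\<^sub>C coef F n"
proof -
  have "\<exists>g. taylor_coeff g = (\<lambda>n. complex_of_real (1 / real (Suc (total_degree n))) * taylor_coeff f n)" for f :: "'d fock"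
  proof (rule ex_fock_coeff, unfold square_summable_def, rule summable_on_comparison_test)
    show "(\<lambda>n. weight n * (cmod (taylor_coeff f n))\<^sup>2) summable_on UNIV"
      using square_summable_taylor_coeff[of f] by (simp add: square_summable_def)
    fix n :: "'d \<Rightarrow> nat"
    have "cmod (complex_of_real (1 / real (Suc (total_degree n))) * taylor_coeff f n) \<le> cmod (taylor_coeff f n)"
      unfolding norm_mult norm_of_real by (rule mult_left_le_one_le) auto
    then show "weight n * (cmod (complex_of_real (1 / real (Suc (total_degree n))) * taylor_coeff f n))\<^sup>2
        \<le> weight n * (cmod (taylor_coeff f n))\<^sup>2"
      by (intro mult_left_mono power_mono) auto
  qed simp
  then obtain g where g: "\<And>f :: 'd fock. taylor_coeff (g f) = (\<lambda>n. complex_of_real (1 / real (Suc (total_degree n))) * taylor_coeff f n)"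
    by metis
  have "coef (\<chi> i. g (F $ i)) n = complex_of_real (1 / real (Suc (total_degree n))) *\<^sub>C coef F n" for n
    by (simp add: coef_def vec_eq_iff g scaleC_vec_def scaleC_complex_def del: of_nat_Suc)
  then have "\<exists>G. \<forall>n. coef G n = complex_of_real (1 / real (Suc (total_degree n))) *\<^sub>C coef F n" by blast
  from someI_ex[OF this] show ?thesis unfolding degree_smoothing_def by blast
qed

lemma norm_coef_degree_smoothing:
  "norm (coef (degree_smoothing F) n) = norm (coef F n) / real (Suc (total_degree n))"
  by (simp add: coef_degree_smoothing norm_scaleC norm_divide del: of_nat_Suc)

definition degree_seminorm :: "'d::finite fock ^ 'r::finite \<Rightarrow> real"
  where "degree_seminorm F = norm (degree_smoothing F)"

lemma degree_seminorm_triangle: "degree_seminorm (F + G) \<le> degree_seminorm F + degree_seminorm G"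
proof -
  have "degree_smoothing (F + G) = degree_smoothing F + degree_smoothing G"
    by (rule coef_eqI) (simp add: coef_degree_smoothing coef_add scaleC_add_right)
  then show ?thesis by (simp add: degree_seminorm_def norm_triangle_ineq)
qed

lemma degree_seminorm_scaleC: "degree_seminorm (c *\<^sub>C F) = cmod c * degree_seminorm F"
proof -
  have "degree_smoothing (c *\<^sub>C F) = c *\<^sub>C degree_smoothing F"
    by (rule coef_eqI) (simp add: coef_degree_smoothing coef_scaleC scaleC_scaleC mult.commute)
  then show ?thesis by (simp add: degree_seminorm_def norm_scaleC)
qed

lemma degree_seminorm_decay:
  assumes "\<And>n. total_degree n < m \<Longrightarrow> coef F n = 0"
  shows "degree_seminorm F \<le> norm F / real (Suc m)"
proof -
  have "norm (degree_smoothing F) \<le> (1 / real (Suc m)) * norm F"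
  proof (rule norm_le_coef)
    fix n
    show "norm (coef (degree_smoothing F) n) \<le> (1 / real (Suc m)) * norm (coef F n)"
    proof (cases "total_degree n < m")
      case False
      then have "1 / real (Suc (total_degree n)) \<le> 1 / real (Suc m)" by (intro divide_left_mono) auto
      from mult_right_mono[OF this norm_ge_zero] show ?thesis
        by (simp add: norm_coef_degree_smoothing del: of_nat_Suc)
    qed (simp add: assms norm_coef_degree_smoothing)
  qed simp
  then show ?thesis by (simp add: degree_seminorm_def)
qed

lemma degree_seminorm_le_norm: "degree_seminorm F \<le> norm F"
  using degree_seminorm_decay[of 0 F] by simp

text \<open>The inequality is strict so that the orthogonal complement starts in degree
  \<open>m\<close>, where the inverse of number operator plus one is at most
  \<open>1 / (m + 1)\<close>. For \<open>m = 0\<close> the family is empty.\<close>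

definition low_degree_basis :: "nat \<Rightarrow> ('d::finite fock ^ 'r::finite) set"
  where "low_degree_basis m = (\<lambda>(n, i). basis_vector n (axis i 1)) ` ({n. total_degree n < m} \<times> UNIV)"

lemma finite_low_degree_basis: "finite (low_degree_basis m)"
  by (simp add: low_degree_basis_def finite_degree_less)

lemma cinner_axis_1: "cinner v (axis i 1) = (v :: complex ^ 'r::finite) $ i"
  by (simp add: cinner_vec_def axis_def cinner_complex_def if_distrib cong: if_cong)

lemma inj_basis_vector_axis: "inj_on (\<lambda>(n, i). basis_vector n (axis i 1) :: 'd::finite fock ^ 'r::finite) A"
proof (rule inj_onI, clarify)
  fix n m :: "'d \<Rightarrow> nat" and i j :: 'r
  assume eq: "(basis_vector n (axis i 1) :: 'd fock ^ 'r) = basis_vector m (axis j 1)"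
  have "axis i 1 = (if n = m then axis j 1 else 0 :: complex ^ 'r)"
    using arg_cong[OF eq, of "\<lambda>F. coef F n"] by (simp add: coef_basis_vector)
  then show "n = m \<and> i = j"
    by (auto simp: axis_eq_axis split: if_splits)
qed

lemma card_low_degree_basis:
  "real (card (low_degree_basis m :: ('d::finite fock ^ 'r::finite) set)) \<le> real CARD('r) * real (Suc m) ^ CARD('d)"
proof -
  have "card (low_degree_basis m :: ('d fock ^ 'r) set) \<le> card ({n :: 'd \<Rightarrow> nat. total_degree n < m} \<times> (UNIV :: 'r set))"
    unfolding low_degree_basis_def by (rule card_image_le) (simp add: finite_degree_less)
  also have "\<dots> \<le> m ^ CARD('d) * CARD('r)"
    unfolding card_cartesian_product by (intro mult_right_mono card_degree_less) simp
  also have "\<dots> \<le> CARD('r) * Suc m ^ CARD('d)"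
    by (simp add: power_mono)
  finally have "real (card (low_degree_basis m :: ('d fock ^ 'r) set)) \<le> real (CARD('r) * Suc m ^ CARD('d))"
    by (simp only: of_nat_le_iff)
  then show ?thesis by simp
qed

lemma orthonormal_low_degree_basis: "orthonormal (low_degree_basis m :: ('d::finite fock ^ 'r::finite) set)"
  unfolding orthonormal_def low_degree_basis_def
proof safe
  fix n m :: "'d \<Rightarrow> nat" and i j :: 'r
  have "(basis_vector n (axis i 1) :: 'd fock ^ 'r) = basis_vector m (axis j 1) \<longleftrightarrow> n = m \<and> i = j"
    using inj_onD[OF inj_basis_vector_axis, of "(n, i)" "(m, j)" UNIV] by auto
  moreover have "cinner (basis_vector n (axis i 1) :: 'd fock ^ 'r) (basis_vector m (axis j 1)) = (if n = m \<and> i = j then 1 else 0)"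
    by (simp add: cinner_basis_vector coef_basis_vector cinner_axis_1) (simp add: axis_def)
  ultimately show "cinner (basis_vector n (axis i 1) :: 'd fock ^ 'r) (basis_vector m (axis j 1)) =
      (if basis_vector n (axis i 1) = (basis_vector m (axis j 1) :: 'd fock ^ 'r) then 1 else 0)"
    by simp
qed

lemma fourier_sum_low_degree_basis:
  "fourier_sum (low_degree_basis m) F = (\<Sum>n | total_degree n < m. basis_vector n (coef F n))"
proof -
  have v: "v = (\<Sum>i\<in>UNIV. (v $ i) *\<^sub>C axis i 1)" for v :: "complex ^ 'b"
    by (simp add: vec_eq_iff scaleC_vec_def scaleC_complex_def axis_def if_distrib cong: if_cong)
  have "fourier_sum (low_degree_basis m) F =
      (\<Sum>(n, i)\<in>{n. total_degree n < m} \<times> UNIV. (coef F n $ i) *\<^sub>C basis_vector n (axis i 1))"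
    unfolding fourier_sum_def low_degree_basis_def sum.reindex[OF inj_basis_vector_axis]
    by (intro sum.cong) (auto simp: cinner_basis_vector cinner_axis_1)
  also have "\<dots> = (\<Sum>n | total_degree n < m. \<Sum>i\<in>UNIV. (coef F n $ i) *\<^sub>C basis_vector n (axis i 1))"
    by (rule sum.cartesian_product[symmetric])
  also have "\<dots> = (\<Sum>n | total_degree n < m. basis_vector n (coef F n))"
    by (subst (2) v) (simp add: basis_vector_sum basis_vector_scaleC)
  finally show ?thesis .
qed

lemma orth_low_degree_basis:
  assumes "\<forall>b\<in>low_degree_basis m. cinner F b = 0" "total_degree n < m" shows "coef F n = 0"
proof -
  have "coef F n $ i = 0" for i
  proof -
    have "basis_vector n (axis i 1) \<in> low_degree_basis m"
      using assms(2) by (auto simp: low_degree_basis_def)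
    then show ?thesis using assms(1) by (auto simp: cinner_basis_vector cinner_axis_1)
  qed
  then show ?thesis by (simp add: vec_eq_iff)
qed

lemma filtered_subspaceI:
  fixes K :: "('d::finite fock ^ 'r::finite) set"
  assumes K: "csubspace K" "closed K" and graded: "\<And>x n. x \<in> K \<Longrightarrow> basis_vector n (coef x n) \<in> K"
  shows "filtered_subspace K degree_seminorm low_degree_basis (real CARD('r)) CARD('d)"
proof
  show "fourier_sum (low_degree_basis m) x \<in> K" if "x \<in> K" for x m
    unfolding fourier_sum_low_degree_basis using K that by (intro csubspace_sum graded)
qed (use K in \<open>auto simp: degree_seminorm_triangle degree_seminorm_scaleC degree_seminorm_le_norm
    finite_low_degree_basis orthonormal_low_degree_basis card_low_degree_basis simp del: of_nat_Suc
    intro!: degree_seminorm_decay orth_low_degree_basis\<close>)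


section \<open>Stabilization of monotone functions of multi-indices\<close>

text \<open>A monotone subsequence exists; if it decreases, it is constant from the point where it
  attains its minimum.\<close>

lemma incseq_subsequence_nat:
  fixes s :: "nat \<Rightarrow> nat"
  shows "\<exists>r. strict_mono r \<and> incseq (\<lambda>i. s (r i))"
proof -
  obtain f where f: "strict_mono f" "monoseq (\<lambda>i. s (f i))"
    using seq_monosub[of s] by blast
  show ?thesis
  proof (cases "incseq (\<lambda>i. s (f i))")
    case True
    with f show ?thesis by blast
  next
    case False
    with f(2) have dec: "decseq (\<lambda>i. s (f i))" by (simp add: monoseq_iff)
    define m where "m = (LEAST v. \<exists>i. s (f i) = v)"
    have "\<exists>i. s (f i) = m" unfolding m_def by (rule LeastI_ex) blast
    then obtain i0 where i0: "s (f i0) = m" ..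
    have "s (f (i + i0)) = m" for i
      using decseqD[OF dec, of i0 "i + i0"] i0 Least_le[of "\<lambda>v. \<exists>i. s (f i) = v" "s (f (i + i0))"]
      unfolding m_def[symmetric] by force
    moreover have "strict_mono (\<lambda>i. f (i + i0))"
      using f(1) by (auto simp: strict_mono_def)
    ultimately show ?thesis by (intro exI[of _ "\<lambda>i. f (i + i0)"]) (auto simp: incseq_def)
  qed
qed

text \<open>Dickson's lemma for sequences, obtained by refining one coordinate after
  another.\<close>

lemma incseq_subsequence_multiindex:
  fixes s :: "nat \<Rightarrow> 'd::finite \<Rightarrow> nat"
  shows "\<exists>r. strict_mono r \<and> (\<forall>k. incseq (\<lambda>i. s (r i) k))"
proof -
  have "\<exists>r. strict_mono r \<and> (\<forall>k\<in>A. incseq (\<lambda>i. s (r i) k))" if "finite A" for A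
    using that
  proof induction
    case empty
    show ?case by (intro exI[of _ "\<lambda>i. i"]) (auto simp: strict_mono_def)
  next
    case (insert k A)
    then obtain r where r: "strict_mono r" "\<And>k. k \<in> A \<Longrightarrow> incseq (\<lambda>i. s (r i) k)" by blast
    obtain q where q: "strict_mono q" "incseq (\<lambda>i. s (r (q i)) k)"
      using incseq_subsequence_nat[of "\<lambda>i. s (r i) k"] by blast
    have "incseq (\<lambda>i. s (r (q i)) k')" if "k' \<in> A" for k'
      using r(2)[OF that] strict_mono_mono[OF q(1)] by (auto simp: incseq_def mono_def)
    moreover have "strict_mono (\<lambda>i. r (q i))"
      using r(1) q(1) by (auto simp: strict_mono_def)
    ultimately show ?case using q(2) by (intro exI[of _ "\<lambda>i. r (q i)"]) auto
  qed
  from this[of UNIV] show ?thesis by simp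
qed

context
  fixes g :: "('d::finite \<Rightarrow> nat) \<Rightarrow> nat"
  assumes le_raise: "\<And>n k. g n \<le> g (raise_index k n)"
begin

lemma mono_multiindex:
  assumes "\<And>k. n k \<le> m k" shows "g n \<le> g m"
  using assms
proof (induction "total_degree m" arbitrary: m rule: less_induct)
  case less
  show ?case
  proof (cases "n = m")
    case False
    then obtain k where k: "n k < m k" using less.prems by (metis ext le_neq_implies_less)
    then have "m k > 0" by simp
    have "n j \<le> lower_index k m j" for j
      using k less.prems[of j] by (cases "j = k") (auto simp: lower_index_other)
    then have "g n \<le> g (lower_index k m)"
      using degree_lower_index[of m k, OF \<open>m k > 0\<close>] by (intro less.hyps) auto
    also have "\<dots> \<le> g m"
      using le_raise[of "lower_index k m" k] raise_lower_index[of m k, OF \<open>m k > 0\<close>] by simp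
    finally show ?thesis .
  qed simp
qed

text \<open>If direction \<open>k\<close> had no threshold, \<open>g\<close> would jump at indices
  with arbitrarily large entry \<open>k\<close>. Along a coordinatewise increasing subsequence a
  later index lies above the raised earlier one, so the jumps accumulate and exceed
  \<open>b\<close>.\<close>

lemma bounded_mono_stabilizes:
  assumes bounded: "\<And>n. g n \<le> b"
  shows "\<exists>N. \<forall>n k. N \<le> n k \<longrightarrow> g (raise_index k n) = g n"
proof -
  have "\<exists>N. \<forall>n. N \<le> n k \<longrightarrow> g (raise_index k n) = g n" for k
  proof (rule ccontr)
    assume "\<nexists>N. \<forall>n. N \<le> n k \<longrightarrow> g (raise_index k n) = g n"
    then have "\<forall>N. \<exists>n. N \<le> n k \<and> g (raise_index k n) \<noteq> g n" by blast
    then obtain s where s: "\<And>N. N \<le> s N k" "\<And>N. g (raise_index k (s N)) \<noteq> g (s N)" by metis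
    obtain r where r: "strict_mono r" "\<And>k. incseq (\<lambda>i. s (r i) k)"
      using incseq_subsequence_multiindex[of s] by blast
    have step: "\<exists>j. g (s (r i)) < g (s (r j))" for i
    proof -
      \<comment> \<open>Large enough that entry \<open>k\<close> of \<open>s (r j)\<close>, being at
        least \<open>r j\<close> and hence at least \<open>j\<close>, exceeds that of
        \<open>s (r i)\<close>; the other entries grow because \<open>j\<close> is at least
        \<open>i\<close>.\<close>
      define j where "j = i + Suc (s (r i) k)"
      have "raise_index k (s (r i)) l \<le> s (r j) l" for l
      proof (cases "l = k")
        case True
        have "Suc (s (r i) k) \<le> j" by (simp add: j_def)
        also have "\<dots> \<le> r j" using r(1) by (rule strict_mono_imp_increasing)
        also have "\<dots> \<le> s (r j) k" by (rule s(1))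
        finally show ?thesis using True by simp
      next
        case False
        then show ?thesis using incseqD[OF r(2), of i j l] by (simp add: raise_index_other j_def)
      qed
      then have "g (raise_index k (s (r i))) \<le> g (s (r j))" by (rule mono_multiindex)
      moreover have "g (s (r i)) < g (raise_index k (s (r i)))"
        using le_raise[of "s (r i)" k] s(2)[of "r i"] by simp
      ultimately show ?thesis by (intro exI[of _ j]) simp
    qed
    have "\<exists>i. c \<le> g (s (r i))" for c
    proof (induction c)
      case (Suc c)
      then obtain i where "c \<le> g (s (r i))" ..
      moreover obtain j where "g (s (r i)) < g (s (r j))" using step by blast
      ultimately show ?case by (intro exI[of _ j]) simp
    qed simp
    from this[of "Suc b"] bounded show False by (metis Suc_n_not_le_n le_trans)
  qed
  then obtain N where N: "\<And>k n. N k \<le> n k \<Longrightarrow> g (raise_index k n) = g n" by metis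
  have "N k \<le> Max (range N)" for k by simp
  then show ?thesis using N le_trans by blast
qed

end


section \<open>Graded invariant subspaces\<close>

lemma coef_d_shift_real:
  "coef (d_shift k F) n = sqrt (real (n k) / real (total_degree n)) *\<^sub>R coef F (lower_index k n)"
  unfolding coef_d_shift scaleR_scaleC ..

lemma cinner_basis_vector_left: "cinner (basis_vector n \<zeta>) F = cinner \<zeta> (coef F n)"
  by (subst (1 2) cinner_commute) (simp add: cinner_basis_vector)

text \<open>The vectors all of whose homogeneous pieces lie in the hull form a closed invariant
  subspace \<open>N\<close>. It contains the monomial generators, hence the hull.\<close>

lemma basis_coef_in_hull:
  fixes G :: "('d::finite fock ^ 'r::finite) set"
  assumes G: "G \<subseteq> monomials" and F: "F \<in> closed_invariant_subspace hull G"
  shows "basis_vector n (coef F n) \<in> closed_invariant_subspace hull G"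
proof -
  define M where "M = closed_invariant_subspace hull G"
  define N where "N = {F :: 'd fock ^ 'r. \<forall>n. basis_vector n (coef F n) \<in> M}"
  have M: "csubspace M" "closed M" "\<And>k x. x \<in> M \<Longrightarrow> d_shift k x \<in> M"
    using closed_invariant_subspace_hull[of G] by (auto simp: closed_invariant_subspace_def M_def)
  have "closed_invariant_subspace N"
    unfolding closed_invariant_subspace_def
  proof (intro conjI allI)
    show "csubspace N"
      using M(1) by (intro complex_vector.subspaceI)
        (auto simp: N_def coef_add coef_scaleC basis_vector_add basis_vector_scaleC csubspace_0 csubspace_add csubspace_scale)
    have "N = (\<Inter>n. (\<lambda>F. basis_vector n (coef F n)) -` M)" by (auto simp: N_def)
    moreover have "closed ((\<lambda>F. basis_vector n (coef F n)) -` M)" for n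
      using M(2) by (intro continuous_closed_vimage linear_continuous_at
        bounded_linear_compose[OF bounded_linear_basis_vector bounded_linear_coef])
    ultimately show "closed N" by (simp add: closed_INT)
    fix k
    show "d_shift k ` N \<subseteq> N"
      unfolding N_def
    proof clarify
      fix F :: "'d fock ^ 'r" and n :: "'d \<Rightarrow> nat" assume F: "\<forall>n. basis_vector n (coef F n) \<in> M"
      show "basis_vector n (coef (d_shift k F) n) \<in> M"
      proof (cases "n k = 0")
        case True
        then show ?thesis using M(1) by (simp add: coef_d_shift csubspace_0)
      next
        case False
        let ?m = "lower_index k n"
        \<comment> \<open>The shift maps the piece at \<open>?m\<close> to \<open>c\<close> times
          the one at \<open>n\<close>, and \<open>c\<close> is nonzero, so it can be divided
          out.\<close>
        define c where "c = complex_of_real (sqrt (real (Suc (?m k)) / real (Suc (total_degree ?m))))"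
        have "c \<noteq> 0" by (simp add: c_def del: of_nat_Suc)
        have "d_shift k (basis_vector ?m (coef F ?m)) \<in> M" using F M(3) by blast
        then have "c *\<^sub>C basis_vector n (coef F ?m) \<in> M"
          using False by (simp only: d_shift_basis_vector raise_lower_index c_def neq0_conv)
        from csubspace_scale[OF M(1) this, of "inverse c"] have "basis_vector n (coef F ?m) \<in> M"
          using \<open>c \<noteq> 0\<close> by (simp add: scaleC_scaleC)
        then show ?thesis
          using M(1) by (simp add: coef_d_shift basis_vector_scaleC csubspace_scale)
      qed
    qed
  qed
  moreover have "G \<subseteq> N"
  proof
    fix x assume x: "x \<in> G"
    then obtain m \<zeta> where "x = simple_tensor (z_monomial m) \<zeta>" using G by (auto simp: monomials_def)
    then have "x = complex_of_real (sqrt (weight m)) *\<^sub>C basis_vector m \<zeta>"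
      by (simp add: basis_vector_def simple_tensor_def vec_eq_iff scaleC_vec_def scaleC_scaleC
          less_imp_neq[OF weight_pos, symmetric])
    then have "basis_vector n (coef x n) = (if n = m then x else 0)" for n
      by (simp add: coef_scaleC coef_basis_vector basis_vector_scaleC)
    moreover have "x \<in> M" using x hull_subset[of G] by (auto simp: M_def)
    ultimately show "x \<in> N" using csubspace_0[OF M(1)] by (simp add: N_def)
  qed
  ultimately have "M \<subseteq> N" unfolding M_def by (intro hull_minimal)
  then show ?thesis using F by (auto simp: M_def[symmetric] N_def)
qed

section \<open>Fibers of a graded invariant subspace and of its complement\<close>

locale graded_invariant_subspace =
  fixes M :: "('d::{finite, linorder} fock ^ 'r::finite) set"
  assumes invariant: "closed_invariant_subspace M"
    and basis_coef_in: "F \<in> M \<Longrightarrow> basis_vector n (coef F n) \<in> M"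
begin

abbreviation K :: "('d fock ^ 'r) set" where "K \<equiv> orth_complement M"

definition fiber :: "('d \<Rightarrow> nat) \<Rightarrow> (complex ^ 'r) set"
  where "fiber n = {\<zeta>. basis_vector n \<zeta> \<in> M}"

definition cofiber_proj :: "('d \<Rightarrow> nat) \<Rightarrow> complex ^ 'r \<Rightarrow> complex ^ 'r"
  where "cofiber_proj n v = v - ortho_proj (fiber n) v"

lemma M: "csubspace M" "closed M" and d_shift_in_M: "F \<in> M \<Longrightarrow> d_shift k F \<in> M"
  using invariant by (auto simp: closed_invariant_subspace_def)

lemmas K = csubspace_orth_complement[of M] closed_orth_complement[of M]

lemma coef_in_fiber: "F \<in> M \<Longrightarrow> coef F n \<in> fiber n"
  by (simp add: fiber_def basis_coef_in)

lemma csubspace_fiber: "csubspace (fiber n)"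
  using M(1) by (intro complex_vector.subspaceI)
    (auto simp: fiber_def basis_vector_add basis_vector_scaleC csubspace_0 csubspace_add csubspace_scale)

lemma closed_fiber: "closed (fiber n)"
proof -
  have "fiber n = basis_vector n -` M" by (auto simp: fiber_def)
  then show ?thesis
    using M(2) by (simp add: continuous_closed_vimage linear_continuous_at bounded_linear_basis_vector)
qed

lemmas fiber = csubspace_fiber closed_fiber

lemma fiber_raise_index: "fiber n \<subseteq> fiber (raise_index k n)"
proof
  fix \<zeta> assume "\<zeta> \<in> fiber n"
  define c where "c = complex_of_real (sqrt (real (Suc (n k)) / real (Suc (total_degree n))))"
  have "c \<noteq> 0" by (simp add: c_def del: of_nat_Suc)
  have "c *\<^sub>C basis_vector (raise_index k n) \<zeta> \<in> M"
    using d_shift_in_M[of "basis_vector n \<zeta>" k] \<open>\<zeta> \<in> fiber n\<close>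
    by (simp only: fiber_def mem_Collect_eq d_shift_basis_vector c_def)
  from csubspace_scale[OF M(1) this, of "inverse c"] show "\<zeta> \<in> fiber (raise_index k n)"
    using \<open>c \<noteq> 0\<close> by (simp add: scaleC_scaleC fiber_def)
qed

text \<open>The stabilization result is applied to the real dimension of the fibers; nested
  subspaces of equal finite dimension coincide.\<close>

lemma fiber_stabilizes: "\<exists>N. \<forall>n k. N \<le> n k \<longrightarrow> fiber (raise_index k n) = fiber n"
proof -
  have "\<exists>N. \<forall>n k. N \<le> n k \<longrightarrow> dim (fiber (raise_index k n)) = dim (fiber n)"
    by (rule bounded_mono_stabilizes[where b = "DIM(complex ^ 'r)"])
      (simp_all add: dim_subset[OF fiber_raise_index] dim_subset_UNIV del: DIM_cart)
  then show ?thesis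
    using subspace_dim_equal[OF csubspace_imp_subspace[OF csubspace_fiber] csubspace_imp_subspace[OF csubspace_fiber]
        fiber_raise_index] by (metis order_refl)
qed

lemma coef_in_orth_fiber: "x \<in> K \<Longrightarrow> coef x n \<in> orth_complement (fiber n)"
  by (auto simp: orth_complement_def fiber_def simp flip: cinner_basis_vector)

lemma basis_vector_in_K: "\<zeta> \<in> orth_complement (fiber n) \<Longrightarrow> basis_vector n \<zeta> \<in> K"
  using coef_in_fiber by (auto simp: orth_complement_def cinner_basis_vector_left)

sublocale filtered_subspace K degree_seminorm low_degree_basis "real CARD('r)" "CARD('d)"
  by (intro filtered_subspaceI K basis_vector_in_K coef_in_orth_fiber)

lemma cofiber_proj_scaleR: "cofiber_proj n (c *\<^sub>R v) = c *\<^sub>R cofiber_proj n v"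
  unfolding cofiber_proj_def scaleR_scaleC ortho_proj_scaleC[OF fiber]
  by (simp add: complex_vector.scale_right_diff_distrib)

lemma cofiber_proj_orth: "v \<in> orth_complement (fiber n) \<Longrightarrow> cofiber_proj n v = v"
  by (simp add: cofiber_proj_def ortho_proj_orth_complement[OF csubspace_fiber])

lemma norm_cofiber_proj_le: "norm (cofiber_proj n v) \<le> norm v"
  unfolding cofiber_proj_def by (rule norm_diff_ortho_proj_le[OF fiber])

text \<open>Both \<open>M\<close> and its complement are graded, so the coefficients of the two
  parts of \<open>x\<close> split \<open>coef x n\<close> orthogonally. Hence the projection acts
  separately at every multi-index.\<close>

lemma coef_diff_ortho_proj: "coef (x - ortho_proj M x) n = cofiber_proj n (coef x n)"
proof -
  have "coef x n - coef (ortho_proj M x) n \<in> orth_complement (fiber n)"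
    using coef_in_orth_fiber[OF diff_ortho_proj_in[OF M]] by (simp add: coef_diff)
  then have "ortho_proj (fiber n) (coef x n) = coef (ortho_proj M x) n"
    by (intro ortho_proj_unique csubspace_fiber coef_in_fiber ortho_proj_in M)
  then show ?thesis by (simp add: cofiber_proj_def coef_diff)
qed

section \<open>The compressed shift and its adjoint in coordinates\<close>

abbreviation (input) T :: "'d \<Rightarrow> 'd fock ^ 'r \<Rightarrow> 'd fock ^ 'r" where "T \<equiv> compressed_shift M"
abbreviation (input) Tadj :: "'d \<Rightarrow> 'd fock ^ 'r \<Rightarrow> 'd fock ^ 'r" where "Tadj k \<equiv> adjoint_on K (compressed_shift M k)"

lemma compressed_shift_eq: "x \<in> K \<Longrightarrow> T k x = d_shift k x - ortho_proj M (d_shift k x)"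
  by (simp add: compressed_shift_def)

lemma compressed_shift_in: "x \<in> K \<Longrightarrow> T k x \<in> K"
  by (simp add: compressed_shift_eq diff_ortho_proj_in[OF M])

lemma bounded_compressed_shift: "bounded_operator K (T k)"
proof (rule bounded_operatorI[where C = 1])
  fix x y c assume x: "x \<in> K"
  show "T k x \<in> K" by (rule compressed_shift_in[OF x])
  show "T k (x + y) = T k x + T k y" if "y \<in> K"
    using x that by (simp add: compressed_shift_eq csubspace_add[OF K(1)] d_shift_add ortho_proj_add[OF M])
  show "T k (c *\<^sub>C x) = c *\<^sub>C T k x"
    using x by (simp add: compressed_shift_eq csubspace_scale[OF K(1)] d_shift_scaleC ortho_proj_scaleC[OF M]
        complex_vector.scale_right_diff_distrib)
  show "norm (T k x) \<le> 1 * norm x"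
    using norm_diff_ortho_proj_le[OF M, of "d_shift k x"] norm_d_shift_le[of k x] x
    by (simp add: compressed_shift_eq)
qed (simp add: compressed_shift_def)

lemmas Tadj_in = adjoint_on_in[OF K bounded_compressed_shift]

text \<open>As \<open>M\<close> is invariant, what the inner projection removes is mapped into
  \<open>M\<close> again and removed by the outer one. So \<open>T j (T k x)\<close> is the
  compression of the product of the two commuting shifts.\<close>

lemma compressed_shift_commute:
  assumes x: "x \<in> K" shows "T j (T k x) = T k (T j x)"
proof -
  have "T j (T k x) = d_shift j (d_shift k x) - ortho_proj M (d_shift j (d_shift k x))" for j k
  proof -
    let ?p = "ortho_proj M (d_shift k x)"
    have p: "d_shift j ?p \<in> M" by (intro d_shift_in_M ortho_proj_in M)
    have "ortho_proj M (d_shift j ?p) = d_shift j ?p"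
      using p csubspace_0[OF K(1)] by (intro ortho_proj_unique M) simp_all
    moreover have "ortho_proj M (d_shift j (d_shift k x)) =
        ortho_proj M (d_shift j (T k x)) + ortho_proj M (d_shift j ?p)"
      using x by (simp add: compressed_shift_eq d_shift_diff flip: ortho_proj_add[OF M])
    ultimately show ?thesis
      using x by (simp add: compressed_shift_eq[OF compressed_shift_in[OF x]])
        (simp add: compressed_shift_eq d_shift_diff)
  qed
  then show ?thesis by (simp add: d_shift_commute[of j k])
qed

lemma coef_compressed_shift:
  assumes "x \<in> K"
  shows "coef (T k x) n = sqrt (real (n k) / real (total_degree n)) *\<^sub>R cofiber_proj n (coef x (lower_index k n))"
  using assms by (simp add: compressed_shift_eq coef_diff_ortho_proj coef_d_shift_real cofiber_proj_scaleR)

text \<open>No projection appears: \<open>K\<close> is invariant under the adjoint shifts, because a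
  vector orthogonal to the fiber at \<open>raise_index k n\<close> is orthogonal to the smaller
  fiber at \<open>n\<close>. The difference \<open>u\<close> of both sides is thus an admissible
  test vector.\<close>

lemma coef_adjoint_compressed_shift:
  assumes x: "x \<in> K"
  shows "coef (Tadj k x) n = sqrt (real (Suc (n k)) / real (Suc (total_degree n))) *\<^sub>R coef x (raise_index k n)"
proof -
  define c where "c = complex_of_real (sqrt (real (Suc (n k)) / real (Suc (total_degree n))))"
  define u where "u = coef (Tadj k x) n - c *\<^sub>C coef x (raise_index k n)"
  have "coef x (raise_index k n) \<in> orth_complement (fiber n)"
    using coef_in_orth_fiber[OF x] orth_complement_antimono[OF fiber_raise_index] by blast
  then have u: "u \<in> orth_complement (fiber n)"
    unfolding u_def by (intro csubspace_diff csubspace_scale csubspace_orth_complement coef_in_orth_fiber Tadj_in x)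
  have b: "basis_vector n u \<in> K" by (rule basis_vector_in_K[OF u])
  have "cinner (coef (Tadj k x) n) u = cinner (Tadj k x) (basis_vector n u)"
    by (simp add: cinner_basis_vector)
  also have "\<dots> = cinner x (T k (basis_vector n u))"
    by (rule cinner_adjoint_on_left[OF K bounded_compressed_shift b x])
  also have "\<dots> = cinner x (d_shift k (basis_vector n u))"
    using x ortho_proj_in[OF M] by (simp add: compressed_shift_eq[OF b] cinner_diff_right orth_complement_def)
  also have "\<dots> = c * cinner (coef x (raise_index k n)) u"
    unfolding d_shift_basis_vector cinner_scaleC_right cinner_basis_vector by (simp add: c_def del: of_nat_Suc)
  finally have "cinner u u = 0"
    by (subst (1) u_def) (simp add: cinner_diff_left cinner_scaleC_left)
  then show ?thesis by (simp add: u_def c_def scaleR_scaleC del: of_nat_Suc)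
qed

lemma adjoint_coefficient_le_1: "sqrt (real (Suc (n k)) / real (Suc (total_degree n))) \<le> 1"
  using index_le_degree[of n k] by simp

text \<open>\<open>T k\<close> raises the degree and so only improves the factor
  \<open>1 / (m + 1)\<close>. The adjoint lowers the degree by one, which costs
  \<open>(m + 2) / (m + 1)\<close>, at most \<open>2\<close>.\<close>

lemma preserving_compressed_shift: "preserving (T k)"
  unfolding preserving_def
proof (intro conjI)
  show "controlled (T k)"
  proof (rule controlledI[OF bounded_compressed_shift, of 1])
    fix x assume x: "x \<in> K"
    show "degree_seminorm (T k x) \<le> 1 * degree_seminorm x"
      unfolding degree_seminorm_def
    proof (rule norm_le_reindex[OF inj_on_lower_index[of k]])
      fix n :: "'d \<Rightarrow> nat" assume n: "n \<in> {n. n k > 0}"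
      have "norm (coef (T k x) n) \<le> 1 * norm (coef x (lower_index k n))"
        unfolding coef_compressed_shift[OF x] norm_scaleR
        using coefficient_le_1[of n k] by (intro mult_mono norm_cofiber_proj_le) auto
      then have "norm (coef (T k x) n) / real (Suc (total_degree n)) \<le>
          norm (coef x (lower_index k n)) / real (Suc (total_degree (lower_index k n)))"
        using n degree_lower_index[of n k] by (intro frac_le) auto
      then show "norm (coef (degree_smoothing (T k x)) n) \<le> 1 * norm (coef (degree_smoothing x) (lower_index k n))"
        by (simp add: norm_coef_degree_smoothing)
    qed (auto simp: coef_degree_smoothing coef_compressed_shift[OF x])
  qed simp
  show "controlled (Tadj k)"
  proof (rule controlledI[OF bounded_operator_adjoint_on[OF K bounded_compressed_shift], of 2])
    fix x assume x: "x \<in> K"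
    show "degree_seminorm (Tadj k x) \<le> 2 * degree_seminorm x"
      unfolding degree_seminorm_def
    proof (rule norm_le_reindex[where \<sigma> = "raise_index k" and S = UNIV])
      show "inj (raise_index k)" by (rule inj_on_inverseI[where g = "lower_index k"]) simp
      fix n
      have "norm (coef (Tadj k x) n) \<le> 1 * norm (coef x (raise_index k n))"
        unfolding coef_adjoint_compressed_shift[OF x] norm_scaleR
        using adjoint_coefficient_le_1[of n k] by (intro mult_right_mono) auto
      then have "norm (coef (Tadj k x) n) / real (Suc (total_degree n)) \<le>
          norm (coef x (raise_index k n)) / (real (Suc (Suc (total_degree n))) / 2)"
        by (intro frac_le) auto
      then show "norm (coef (degree_smoothing (Tadj k x)) n) \<le> 2 * norm (coef (degree_smoothing x) (raise_index k n))"
        by (simp add: norm_coef_degree_smoothing mult.commute)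
    qed auto
  qed simp
qed

lemma sum_compressed_shift_adjoint:
  assumes x: "x \<in> K"
  shows "norm ((\<Sum>k\<in>UNIV. T k (Tadj k x)) - x) \<le> 1 * degree_seminorm x"
  unfolding degree_seminorm_def
proof (rule norm_le_coef)
  fix n :: "'d \<Rightarrow> nat"
  have "coef (T k (Tadj k x)) n = (real (n k) / real (total_degree n)) *\<^sub>R coef x n" for k
  proof (cases "n k = 0")
    case False
    then have "coef (Tadj k x) (lower_index k n) = sqrt (real (n k) / real (total_degree n)) *\<^sub>R coef x n"
      using degree_lower_index[of n k] by (simp add: coef_adjoint_compressed_shift[OF x] raise_lower_index)
    then show ?thesis
      by (simp add: coef_compressed_shift Tadj_in[OF x] cofiber_proj_scaleR
          cofiber_proj_orth[OF coef_in_orth_fiber[OF x]])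
  qed (simp add: coef_compressed_shift Tadj_in[OF x])
  then have "coef ((\<Sum>k\<in>UNIV. T k (Tadj k x)) - x) n = (\<Sum>k\<in>UNIV. real (n k) / real (total_degree n)) *\<^sub>R coef x n - coef x n"
    by (simp only: coef_diff coef_sum scaleR_left.sum)
  \<comment> \<open>In degree \<open>0\<close> division by zero makes the sum \<open>0\<close>, and
    all of \<open>coef x n\<close> remains as an error; \<open>\<delta>\<close> gives this degree
    the full weight \<open>1\<close>.\<close>
  also have "(\<Sum>k\<in>UNIV. real (n k) / real (total_degree n)) = (if total_degree n = 0 then 0 else 1)"
    by (simp add: total_degree_def sum_divide_distrib[symmetric] of_nat_sum[symmetric] del: of_nat_sum)
  finally show "norm (coef ((\<Sum>k\<in>UNIV. T k (Tadj k x)) - x) n) \<le> 1 * norm (coef (degree_smoothing x) n)"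
    by (auto simp: norm_coef_degree_smoothing split: if_splits)
qed simp

text \<open>Estimate for the case without cancellation. The factor \<open>2\<close> for
  \<open>q\<close> allows for denominators \<open>m\<close> in place of
  \<open>m + 1\<close>.\<close>

lemma norm_diff_scaleR_le:
  fixes y :: "'v::real_normed_vector"
  assumes "norm u \<le> norm y" "norm v \<le> norm y" "0 \<le> p" "0 \<le> q" "p \<le> e" "q \<le> 2 * e"
  shows "norm (p *\<^sub>R u - q *\<^sub>R v) \<le> 3 * e * norm y"
proof -
  have "norm (p *\<^sub>R u - q *\<^sub>R v) \<le> norm (p *\<^sub>R u) + norm (q *\<^sub>R v)" by (rule norm_triangle_ineq4)
  also have "\<dots> = p * norm u + q * norm v" using assms by simp
  also have "\<dots> \<le> e * norm y + 2 * e * norm y" using assms by (intro add_mono mult_mono) auto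
  finally show ?thesis by (simp add: algebra_simps)
qed

section \<open>Coefficient estimates for the cross commutators\<close>

context
  fixes N :: nat
  assumes N: "\<And>n k. N \<le> n k \<Longrightarrow> fiber (raise_index k n) = fiber n"
begin

text \<open>For \<open>n k\<close> at least \<open>N\<close> the projection is trivial and the
  factors \<open>(n k + 1) / (m + 1)\<close> and \<open>n k / m\<close> differ by at most
  \<open>1 / (m + 1)\<close>. Otherwise both are small, at most \<open>N / (m + 1)\<close> and
  \<open>2 * N / (m + 1)\<close>; the constant \<open>3 * N + 1\<close> covers both cases.\<close>

lemma cross_commutator_same_coef:
  assumes x: "x \<in> K"
  shows "norm (coef (op_commutator K (Tadj k) (T k) x) n) \<le> (3 * real N + 1) * norm (coef (degree_smoothing x) n)"
proof -
  define y where "y = coef x n"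
  define m where "m = total_degree n"
  define u where "u = cofiber_proj (raise_index k n) y"
  have nk: "n k \<le> m" unfolding m_def by (rule index_le_degree)
  have "coef (Tadj k (T k x)) n = (real (Suc (n k)) / real (Suc m)) *\<^sub>R u"
    by (simp add: coef_adjoint_compressed_shift compressed_shift_in x coef_compressed_shift u_def y_def m_def del: of_nat_Suc)
  moreover have "coef (T k (Tadj k x)) n = (real (n k) / real m) *\<^sub>R y"
  proof (cases "n k = 0")
    case False
    then have "coef (Tadj k x) (lower_index k n) = sqrt (real (n k) / real m) *\<^sub>R y"
      using degree_lower_index[of n k] by (simp add: coef_adjoint_compressed_shift[OF x] raise_lower_index y_def m_def)
    then show ?thesis
      using cofiber_proj_orth[OF coef_in_orth_fiber[OF x], of n]
      by (simp add: coef_compressed_shift Tadj_in[OF x] cofiber_proj_scaleR y_def m_def)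
  qed (simp add: coef_compressed_shift Tadj_in[OF x])
  ultimately have eq: "coef (op_commutator K (Tadj k) (T k) x) n = (real (Suc (n k)) / real (Suc m)) *\<^sub>R u - (real (n k) / real m) *\<^sub>R y"
    using x by (simp add: op_commutator_def coef_diff)
  have "norm (coef (op_commutator K (Tadj k) (T k) x) n) \<le> (3 * real N + 1) / real (Suc m) * norm y"
  proof (cases "N \<le> n k")
    case True
    then have "u = y"
      unfolding u_def y_def using coef_in_orth_fiber[OF x, of n] by (intro cofiber_proj_orth) (simp add: N)
    then have "norm (coef (op_commutator K (Tadj k) (T k) x) n) = \<bar>real (Suc (n k)) / real (Suc m) - real (n k) / real m\<bar> * norm y"
      unfolding eq by (simp only: scaleR_left_diff_distrib[symmetric] norm_scaleR)
    also have "\<dots> \<le> (3 * real N + 1) / real (Suc m) * norm y"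
    proof (rule mult_right_mono)
      have "\<bar>real (Suc (n k)) / real (Suc m) - real (n k) / real m\<bar> \<le> 1 / real (Suc m)"
      proof (cases "m = 0")
        case False
        then have "real (Suc (n k)) / real (Suc m) - real (n k) / real m = (real m - real (n k)) / real m * (1 / real (Suc m))"
          by (simp add: field_simps)
        also have "\<bar>\<dots>\<bar> \<le> 1 * (1 / real (Suc m))"
          unfolding abs_mult using nk False by (intro mult_mono) auto
        finally show ?thesis by simp
      qed (use nk in simp)
      also have "\<dots> \<le> (3 * real N + 1) / real (Suc m)" by (intro divide_right_mono) auto
      finally show "\<bar>real (Suc (n k)) / real (Suc m) - real (n k) / real m\<bar> \<le> (3 * real N + 1) / real (Suc m)" .
    qed simp
    finally show ?thesis .
  next
    case False
    have q: "real (n k) / real m \<le> 2 * (real N / real (Suc m))"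
    proof (cases "m = 0")
      case m: False
      have "real (n k) * real (Suc m) \<le> real N * (2 * real m)"
        using False m by (intro mult_mono) auto
      then show ?thesis using m by (simp add: field_simps)
    qed simp
    have "norm (coef (op_commutator K (Tadj k) (T k) x) n) \<le> 3 * (real N / real (Suc m)) * norm y"
      unfolding eq
    proof (rule norm_diff_scaleR_le[OF _ _ _ _ _ q])
      show "norm u \<le> norm y" unfolding u_def by (rule norm_cofiber_proj_le)
      show "real (Suc (n k)) / real (Suc m) \<le> real N / real (Suc m)"
        using False by (intro divide_right_mono) auto
    qed auto
    also have "\<dots> \<le> (3 * real N + 1) / real (Suc m) * norm y"
      by (intro mult_right_mono) (auto simp: divide_right_mono)
    finally show ?thesis .
  qed
  then show ?thesis by (simp add: norm_coef_degree_smoothing y_def m_def)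
qed

text \<open>The commutator moves the coefficient \<open>y\<close> at \<open>?l\<close>, that is
  \<open>n + e_j - e_k\<close>, to \<open>n\<close>. Both products carry the factor
  \<open>s\<close>, over \<open>m + 1\<close> and over \<open>m\<close>, with projections
  \<open>u\<close> and \<open>v\<close> of \<open>y\<close>. If \<open>u = v\<close> the fractions
  nearly cancel; otherwise \<open>s\<close> is at most \<open>N\<close>.\<close>

lemma cross_commutator_distinct_coef:
  assumes x: "x \<in> K" and jk: "j \<noteq> k" and pos: "n k > 0"
  shows "norm (coef (op_commutator K (Tadj j) (T k) x) n) \<le>
    (3 * real N + 1) * norm (coef (degree_smoothing x) (raise_index j (lower_index k n)))"
proof -
  let ?l = "raise_index j (lower_index k n)"
  define y where "y = coef x ?l"
  define m where "m = total_degree n"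
  define s where "s = sqrt (real (Suc (n j)) * real (n k))"
  define u where "u = cofiber_proj (raise_index j n) y"
  define v where "v = cofiber_proj n y"
  have m: "m > 0" "Suc (total_degree (lower_index k n)) = m"
    using degree_lower_index[of n k, OF pos] by (auto simp: m_def)
  have l: "total_degree ?l = m" "lower_index k (raise_index j n) = ?l" "raise_index k ?l = raise_index j n"
    using m(2) jk pos by (simp_all add: lower_raise_index_commute raise_index_commute[of k j] raise_lower_index)
  have "coef (Tadj j (T k x)) n = (s / real (Suc m)) *\<^sub>R u"
    using jk by (simp add: coef_adjoint_compressed_shift compressed_shift_in x coef_compressed_shift u_def y_def
        m_def l(2) raise_index_other s_def real_sqrt_divide real_sqrt_mult del: of_nat_Suc)
  moreover have "coef (T k (Tadj j x)) n = (s / real m) *\<^sub>R v"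
    using jk m(1) by (simp add: coef_adjoint_compressed_shift x coef_compressed_shift Tadj_in v_def y_def
        m(2) lower_index_other cofiber_proj_scaleR s_def real_sqrt_divide real_sqrt_mult m_def[symmetric] del: of_nat_Suc)
  ultimately have eq: "coef (op_commutator K (Tadj j) (T k) x) n = (s / real (Suc m)) *\<^sub>R u - (s / real m) *\<^sub>R v"
    using x by (simp add: op_commutator_def coef_diff)
  have s: "s \<ge> 0" by (simp add: s_def)
  have uv: "norm u \<le> norm y" "norm v \<le> norm y" by (simp_all add: u_def v_def norm_cofiber_proj_le)
  have "norm (coef (op_commutator K (Tadj j) (T k) x) n) \<le> (3 * real N + 1) / real (Suc m) * norm y"
  proof (cases "u = v")
    case True
    then have "norm (coef (op_commutator K (Tadj j) (T k) x) n) = \<bar>s / real (Suc m) - s / real m\<bar> * norm v"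
      unfolding eq by (simp only: scaleR_left_diff_distrib[symmetric] norm_scaleR)
    also have "\<dots> \<le> (3 * real N + 1) / real (Suc m) * norm y"
    proof (rule mult_mono)
      \<comment> \<open>The arithmetic-geometric mean inequality; the extra \<open>1\<close> in the
        numerator is absorbed by \<open>m > 0\<close>.\<close>
      have "s \<le> (real (Suc (n j)) + real (n k)) / 2"
        unfolding s_def by (rule arith_geo_mean_sqrt) auto
      also have "\<dots> \<le> real m"
        using index_add_le_degree[of j k n, OF jk] m(1) unfolding m_def[symmetric] by simp
      finally have "s \<le> real m" .
      have "s / real (Suc m) - s / real m = - (s / real m * (1 / real (Suc m)))"
        using m(1) by (simp add: field_simps)
      then have "\<bar>s / real (Suc m) - s / real m\<bar> = s / real m * (1 / real (Suc m))"
        using s by simp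
      also have "\<dots> \<le> 1 * (1 / real (Suc m))"
        using \<open>s \<le> real m\<close> m(1) by (intro mult_right_mono) auto
      also have "\<dots> \<le> (3 * real N + 1) / real (Suc m)" 
        unfolding mult_1 by (intro divide_right_mono) auto
      finally show "\<bar>s / real (Suc m) - s / real m\<bar> \<le> (3 * real N + 1) / real (Suc m)" .
    qed (use uv in auto)
    finally show ?thesis .
  next
    case False
    \<comment> \<open>the two projections of \<open>y\<close> can differ only where the fibers still grow in both directions \<open>j\<close> and \<open>k\<close>\<close>
    have "\<not> N \<le> n j"
    proof
      assume "N \<le> n j"
      then have "fiber (raise_index j n) = fiber n" by (rule N)
      then show False using False by (simp add: u_def v_def cofiber_proj_def)
    qed
    \<comment> \<open>Raising \<open>?l\<close> in direction \<open>k\<close> gives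
      \<open>raise_index j n\<close>. If the fiber does not grow there, \<open>y\<close> is
      orthogonal to the fibers at \<open>raise_index j n\<close> and at \<open>n\<close>, and both
      projections fix it.\<close>
    moreover have "\<not> N \<le> ?l k"
    proof
      assume "N \<le> ?l k"
      then have "fiber (raise_index j n) = fiber ?l" using N[of ?l k] l(3) by simp
      then have y: "y \<in> orth_complement (fiber (raise_index j n))"
        using coef_in_orth_fiber[OF x, of ?l] by (simp add: y_def)
      then have "y \<in> orth_complement (fiber n)"
        using orth_complement_antimono[OF fiber_raise_index] by blast
      with y False show False by (simp add: u_def v_def cofiber_proj_orth)
    qed
    ultimately have "real (Suc (n j)) \<le> real N" "real (n k) \<le> real N"
      using jk by (simp_all add: raise_index_other)
    then have "real (Suc (n j)) * real (n k) \<le> real N * real N" by (intro mult_mono) auto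
    then have sN: "s \<le> real N" unfolding s_def by (intro real_le_lsqrt) (auto simp: power2_eq_square)
    have "norm (coef (op_commutator K (Tadj j) (T k) x) n) \<le> 3 * (real N / real (Suc m)) * norm y"
      unfolding eq
    proof (rule norm_diff_scaleR_le[OF uv])
      show "s / real (Suc m) \<le> real N / real (Suc m)" using sN by (intro divide_right_mono) auto
      have "s * real (Suc m) \<le> real N * (2 * real m)" using sN s m(1) by (intro mult_mono) auto
      then show "s / real m \<le> 2 * (real N / real (Suc m))" using m(1) by (simp add: field_simps)
    qed (use s in auto)
    also have "\<dots> \<le> (3 * real N + 1) / real (Suc m) * norm y"
      by (intro mult_right_mono) (auto simp: divide_right_mono)
    finally show ?thesis .
  qed
  then show ?thesis unfolding norm_coef_degree_smoothing l(1) y_def by simp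
qed

end

lemma dominated_cross_commutator: "dominated (op_commutator K (Tadj j) (T k))"
proof -
  obtain N where N: "\<And>n k. N \<le> n k \<Longrightarrow> fiber (raise_index k n) = fiber n"
    using fiber_stabilizes by blast
  show ?thesis
  proof (rule dominatedI[where C = "3 * real N + 1"])
    show "bounded_operator K (op_commutator K (Tadj j) (T k))"
      by (intro bounded_operator_op_commutator bounded_operator_adjoint_on K bounded_compressed_shift)
    fix x assume x: "x \<in> K"
    show "norm (op_commutator K (Tadj j) (T k) x) \<le> (3 * real N + 1) * degree_seminorm x"
      unfolding degree_seminorm_def
    proof (cases "j = k")
      case True
      show "norm (op_commutator K (Tadj j) (T k) x) \<le> (3 * real N + 1) * norm (degree_smoothing x)"
        unfolding True by (rule norm_le_coef[OF _ cross_commutator_same_coef[OF N x]]) auto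
    next
      case False
      show "norm (op_commutator K (Tadj j) (T k) x) \<le> (3 * real N + 1) * norm (degree_smoothing x)"
      proof (rule norm_le_reindex[where \<sigma> = "\<lambda>n. raise_index j (lower_index k n)" and S = "{n. n k > 0}"])
        show "inj_on (\<lambda>n. raise_index j (lower_index k n)) {n. n k > 0}"
          by (rule inj_on_inverseI[where g = "\<lambda>n. raise_index k (lower_index j n)"]) (simp add: raise_lower_index)
        fix n
        show "norm (coef (op_commutator K (Tadj j) (T k) x) n) \<le>
            (3 * real N + 1) * norm (coef (degree_smoothing x) (raise_index j (lower_index k n)))" if "n \<in> {n. n k > 0}"
          using that by (intro cross_commutator_distinct_coef[OF N x False]) auto
        \<comment> \<open>Both products vanish at \<open>n k = 0\<close>: \<open>T k\<close>
          produces no coefficient at such indices, and \<open>Tadj j\<close> with \<open>j\<close>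
          different from \<open>k\<close> does not touch entry \<open>k\<close>.\<close>
        show "coef (op_commutator K (Tadj j) (T k) x) n = 0" if "n \<notin> {n. n k > 0}"
          using that x False
          by (simp add: op_commutator_def coef_diff coef_adjoint_compressed_shift compressed_shift_in
              coef_compressed_shift Tadj_in raise_index_other)
      qed auto
    qed
  qed simp
qed

text \<open>The adjoint of \<open>[T_j*, T_k]\<close> is \<open>[T_k*, T_j]\<close>, again a cross
  commutator, so the one-sided estimate already covers both sides.\<close>

lemma smoothing_cross_commutator: "smoothing (op_commutator K (Tadj j) (T k))"
  unfolding smoothing_def
    adjoint_on_op_commutator[OF bounded_operator_adjoint_on[OF K bounded_compressed_shift] bounded_compressed_shift]
    adjoint_on_adjoint_on[OF K bounded_compressed_shift]
  by (intro conjI dominated_cross_commutator)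

lemma smoothing_commutator: "smoothing (op_commutator K (T j) (T k))"
proof -
  have "op_commutator K (T j) (T k) = (\<lambda>x\<in>K. 0)"
    by (auto simp: op_commutator_def fun_eq_iff compressed_shift_commute[of _ j k])
  then show ?thesis by (simp add: smoothing_zero)
qed

lemma commutator_ideal_schatten:
  assumes "p > real CARD('d)"
  shows "commutator_ideal K (star_algebra K (range T)) \<subseteq> schatten_class p K"
proof
  fix X assume "X \<in> commutator_ideal K (star_algebra K (range T))"
  then have "smoothing X"
    by (rule smoothing_commutator_ideal[rotated -1])
      (auto simp: preserving_compressed_shift smoothing_commutator smoothing_cross_commutator)
  then show "X \<in> schatten_class p K" using assms by (rule smoothing_in_schatten_class)
qed

lemma fredholm_compressed_shift: "fredholm_multioperator K T"
proof (rule fredholm_multioperatorI)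
  show "\<exists>C\<ge>0. \<forall>x\<in>K. norm ((\<Sum>i\<in>UNIV. T i (Tadj i x)) - x) \<le> C * degree_seminorm x"
    using sum_compressed_shift_adjoint by (intro exI[of _ 1]) auto
qed (fact bounded_compressed_shift compressed_shift_commute dominated_cross_commutator)+

end

theorem corollary2p2:
  fixes G M :: "('d::{finite, linorder} fock ^ 'r::finite) set"
  assumes "G \<subseteq> monomials"
    and "M = closed_invariant_subspace hull G"
  shows "(\<forall>p::real. p > real CARD('d) \<longrightarrow>
      commutator_ideal (orth_complement M)
        (star_algebra (orth_complement M) (range (compressed_shift M)))
      \<subseteq> schatten_class p (orth_complement M)) \<and>
    fredholm_multioperator (orth_complement M) (compressed_shift M)"
proof -
  interpret graded_invariant_subspace M
    by unfold_locales
      (use closed_invariant_subspace_hull basis_coef_in_hull[OF assms(1)] in \<open>auto simp: assms(2)\<close>)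
  show ?thesis using commutator_ideal_schatten fredholm_compressed_shift by blast
qed

end
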